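(* Let $q\geq5$ be a prime power with $q\equiv2\pmod 3$, $m=(q+1)/3$. Let $P=P_{(a,b)}\in\mathcal X_3(\mathbb F_{q^2})\setminus\mathcal O$ with $\alpha(P)^2-\alpha(P)+1\neq0$, and let $i$ be the $\mathcal P$-order of $\alpha(P)$. If $i\le m-2$, then $$H(P)=\langle q,\ q+1,\ (q-1)+j(q-2),\ (q-1)+i(q-2)-1\ \mid\ j=0,\ldots,i-1\rangle.$$ If $i=m-1$, then $$H(P)=\langle q,\ q+1,\ (q-1)+j(q-2)\ \mid\ j=0,\ldots,m-2\rangle.$$
   Context: Let $q$ be a prime power with $q\equiv 2\pmod 3$, $m=(q+1)/3$. Let $\mathcal X_3$ be the nonsingular projective model (defined over $\mathbb F_{q^2}$) of the plane curve $y^{q+1}+x^{2m}+x^m=0$. Let $\mathcal O_0$ be the $m$ points centered at the singular point $(0,0)$ (zeros of $x$) and $\mathcal O_\infty$ the $m$ points over the point at infinity (poles of $x$); every other point has affine coordinates $(a,b)$, $a\ne0$, and is denoted $P_{(a,b)}$. Let $\mathcal O_m=\{P_{(a,0)}: a^m+1=0\}$, $\mathcal O=\mathcal O_0\cup\mathcal O_\infty\cup\mathcal O_m$, and for $P=P_{(a,b)}\notin\mathcal O$ let $\alpha(P)=a^m/(1+a^m)$. Fix a primitive cube root of unity $\zeta_3\in\mathbb F_{q^2}$ and for $i\in\mathbb Z$ let $\mathcal P_i(s)=\frac{(s+\zeta_3)^{3i}-(s+\zeta_3^2)^{3i}}{3(\zeta_3-\zeta_3^2)s(s-1)}$ (a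 polynomial for $i\ge1$). For $\alpha\in\overline{\mathbb F}_{q^2}\setminus\{0,1,-\zeta_3,-\zeta_3^2\}$, the $\mathcal P$-order of $\alpha$ is the smallest positive integer $i$ with $\mathcal P_{i+1}(\alpha)=0$ (such $i$ always exists). $H(P)$ is the Weierstrass semigroup at $P$ (integers $n\ge0$ such that some function has pole divisor exactly $nP$); $\langle\cdot\rangle$ is the semigroup generated by the listed integers. *)

theory Defs
  imports "HOL-Computational_Algebra.Polynomial"
begin

definition prime_power :: "nat \<Rightarrow> bool" where
  "prime_power q \<longleftrightarrow> (\<exists>p k. prime p \<and> k > 0 \<and> q = p ^ k)"

definition is_subfield :: "'a::field set \<Rightarrow> bool" where
  "is_subfield F \<longleftrightarrow> 0 \<in> F \<and> 1 \<in> F \<and>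
     (\<forall>a\<in>F. \<forall>b\<in>F. a + b \<in> F \<and> a - b \<in> F \<and> a * b \<in> F) \<and>
     (\<forall>a\<in>F. inverse a \<in> F)"

definition transcendental_over :: "'a::field set \<Rightarrow> 'a \<Rightarrow> bool" where
  "transcendental_over K x \<longleftrightarrow>
     (\<forall>p::'a poly. p \<noteq> 0 \<and> (\<forall>i. coeff p i \<in> K) \<longrightarrow> poly p x \<noteq> 0)"

text \<open>A place of the function field L/K, represented by its normalized (surjective)
  discrete valuation, trivial on K. Values at 0 are irrelevant.\<close>
definition place_val :: "'a::field set \<Rightarrow> ('a \<Rightarrow> int) \<Rightarrow> bool" where
  "place_val K v \<longleftrightarrow>
     (\<forall>a b. a \<noteq> 0 \<and> b \<noteq> 0 \<longrightarrow> v (a * b) = v a + v b) \<and>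
     (\<forall>a b. a \<noteq> 0 \<and> b \<noteq> 0 \<and> a + b \<noteq> 0 \<longrightarrow> v (a + b) \<ge> min (v a) (v b)) \<and>
     (\<forall>c\<in>K. c \<noteq> 0 \<longrightarrow> v c = 0) \<and>
     (\<exists>t. t \<noteq> 0 \<and> v t = 1)"

definition weierstrass_semigroup :: "'a::field set \<Rightarrow> ('a \<Rightarrow> int) \<Rightarrow> nat set" where
  "weierstrass_semigroup K v =
     {n. \<exists>f. f \<noteq> 0 \<and> v f = - int n \<and>
            (\<forall>w. place_val K w \<and> (\<exists>g. g \<noteq> 0 \<and> w g \<noteq> v g) \<longrightarrow> w f \<ge> 0)}"

inductive_set gen_semigroup :: "nat set \<Rightarrow> nat set" for S where
  zero: "0 \<in> gen_semigroup S"
| add: "s \<in> S \<Longrightarrow> a \<in> gen_semigroup S \<Longrightarrow> s + a \<in> gen_semigroup S"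

definition Pcal :: "'a::field \<Rightarrow> nat \<Rightarrow> 'a \<Rightarrow> 'a" where
  "Pcal \<zeta> i s = ((s + \<zeta>) ^ (3 * i) - (s + \<zeta>\<^sup>2) ^ (3 * i)) / (3 * (\<zeta> - \<zeta>\<^sup>2) * s * (s - 1))"

definition P_order :: "'a::field \<Rightarrow> 'a \<Rightarrow> nat" where
  "P_order \<zeta> \<alpha> = (LEAST i. i > 0 \<and> Pcal \<zeta> (i + 1) \<alpha> = 0)"

end

theory Submission
  imports Defs "HOL-Library.FuncSet"
begin

text \<open>Put \<open>e = a^m\<close>; then \<open>e^q = e\<close>. In the rescaled coordinates \<open>X = a^q x\<close>,
  \<open>Y = b^q y\<close>, \<open>Z = Y^3 / X\<close> the curve lies on the cubic surface \<open>X Z = Y^3\<close>, and the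
  plane section \<open>T = 1 + X + Z - 3 Y\<close> has divisor \<open>(q + 1) P - (X)\<^sub>\<infinity>\<close>. So
  functions with poles only at \<open>P\<close> are the quotients \<open>G / T^d\<close> with \<open>G\<close> a form of
  degree \<open>d\<close>. Up to order \<open>q\<close> at \<open>P\<close> the curve coincides with the nodal cubic
  \<open>T = 0\<close>. On it a form of degree \<open>d\<close> is a polynomial of degree at most \<open>3 d\<close> in the
  parameter \<open>s\<close> taking equal values at \<open>\<zeta>\<close> and \<open>\<zeta>\<^sup>2\<close>, so the
  order \<open>3 d\<close> at \<open>s = e\<close> is possible exactly if \<open>(\<zeta> - e)^(3 d) = (\<zeta>\<^sup>2 -
  e)^(3 d)\<close>, that is, if \<open>Pcal \<zeta> d \<alpha> = 0\<close>, and otherwise \<open>3 d - 1\<close> is.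

  That there are no further pole numbers follows by counting: \<open>f \<mapsto> f T^m\<close> maps the functions with a pole
  of order at most \<open>m (q + 1)\<close> at \<open>P\<close> into the Riemann-Roch space of \<open>m
  (X)\<^sub>\<infinity>\<close>. The latter is bounded by splitting it under the Kummer automorphisms \<open>Y \<mapsto>
  \<eta> Y\<close>; the components are regular rational functions of \<open>X\<close>, hence polynomials, because there is a
  place above every non-constant polynomial (by Zorn's lemma, a maximal subring not containing the inverse of the polynomial is a
  valuation ring, and it is discrete by finiteness over \<open>K(X)\<close>).\<close>

section \<open>Subrings, subfields and linear algebra\<close>

text \<open>Where \<open>T\<close> comes from: with \<open>X = s^3\<close>, \<open>Z = t^3\<close>,
  \<open>Y = s t\<close> on the surface, \<open>T\<close> is the norm form
  \<open>1 + s^3 + t^3 - 3 s t\<close>, the product of \<open>1 + s + t\<close>,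
  \<open>1 + \<zeta> s + \<zeta>\<^sup>2 t\<close> and
  \<open>1 + \<zeta>\<^sup>2 s + \<zeta> t\<close>. The vanishing of the first factor parametrises
  the plane section, and the point is \<open>s = e\<close>, \<open>t = be = - 1 - e\<close>. The
  rescaling turns the coordinates of the point into norms to the field with \<open>q\<close>
  elements; as \<open>e\<close> and \<open>be\<close> are then fixed by the \<open>q\<close>-th
  power, the curve equation restricted to the section is \<open>- (s - e)^(q+1)\<close>, whence the
  contact order. The count closes because it does not see the P-order: each degree
  \<open>d < m\<close> contributes \<open>3 d\<close> pole numbers above
  \<open>(d - 1) (q + 1)\<close> and up to \<open>d (q + 1)\<close>, whether the last order is
  \<open>3 d\<close> or \<open>3 d - 1\<close>. It stops at \<open>m\<close> because
  \<open>3 m = q + 1\<close>: the congruence with the nodal cubic decides only orders up to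
  \<open>q\<close>, and above \<open>m (q + 1)\<close> there are no gaps.\<close>

definition is_subring :: "'a::field set \<Rightarrow> bool" where
  "is_subring R \<longleftrightarrow> 0 \<in> R \<and> 1 \<in> R \<and> (\<forall>a\<in>R. \<forall>b\<in>R. a + b \<in> R \<and> a - b \<in> R \<and> a * b \<in> R)"

lemma is_subringI:
  assumes "0 \<in> R" "1 \<in> R" "\<And>a b. a \<in> R \<Longrightarrow> b \<in> R \<Longrightarrow> a + b \<in> R"
    "\<And>a. a \<in> R \<Longrightarrow> - a \<in> R" "\<And>a b. a \<in> R \<Longrightarrow> b \<in> R \<Longrightarrow> a * b \<in> R"
  shows "is_subring R"
proof -
  have "a - b \<in> R" if "a \<in> R" "b \<in> R" for a b
    using assms(3)[OF that(1) assms(4)[OF that(2)]] by simp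
  then show ?thesis
    unfolding is_subring_def by (intro conjI ballI assms)
qed

context
  fixes R :: "'a::field set"
  assumes R: "is_subring R"
begin

lemma subring_0: "0 \<in> R" and subring_1: "1 \<in> R"
  using R by (auto simp: is_subring_def)

lemma subring_add: "a \<in> R \<Longrightarrow> b \<in> R \<Longrightarrow> a + b \<in> R"
  and subring_diff: "a \<in> R \<Longrightarrow> b \<in> R \<Longrightarrow> a - b \<in> R"
  and subring_mult: "a \<in> R \<Longrightarrow> b \<in> R \<Longrightarrow> a * b \<in> R"
  using R by (auto simp: is_subring_def)

lemma subring_uminus: "a \<in> R \<Longrightarrow> - a \<in> R"
  using subring_diff[OF subring_0] by simp

lemma subring_power: "a \<in> R \<Longrightarrow> a ^ n \<in> R"
  by (induction n) (auto intro: subring_1 subring_mult)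

lemma subring_sum: "(\<And>i. i \<in> I \<Longrightarrow> f i \<in> R) \<Longrightarrow> sum f I \<in> R"
  by (induction I rule: infinite_finite_induct) (auto intro: subring_0 subring_add)

lemma subring_of_nat: "of_nat n \<in> R"
  by (induction n) (auto intro: subring_0 subring_1 subring_add)

lemma subring_numeral: "numeral n \<in> R"
  by (metis of_nat_numeral subring_of_nat)

lemmas subring_closed = subring_0 subring_1 subring_add subring_diff subring_mult
  subring_uminus subring_power subring_sum subring_of_nat subring_numeral

end

lemma subfield_subring: "is_subfield F \<Longrightarrow> is_subring F"
  by (auto simp: is_subfield_def is_subring_def)

lemma subfield_inverse: "is_subfield F \<Longrightarrow> a \<in> F \<Longrightarrow> inverse a \<in> F"
  by (auto simp: is_subfield_def)

lemma subfield_divide: "is_subfield F \<Longrightarrow> a \<in> F \<Longrightarrow> b \<in> F \<Longrightarrow> a / b \<in> F"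
  by (simp add: divide_inverse subfield_inverse subfield_subring subring_mult)

definition polys_over :: "'a::field set \<Rightarrow> 'a poly set" where
  "polys_over R = {p. \<forall>i. coeff p i \<in> R}"

context
  fixes R :: "'a::field set"
  assumes R: "is_subring R"
begin

lemma polys_over_add: "p \<in> polys_over R \<Longrightarrow> r \<in> polys_over R \<Longrightarrow> p + r \<in> polys_over R"
  and polys_over_diff: "p \<in> polys_over R \<Longrightarrow> r \<in> polys_over R \<Longrightarrow> p - r \<in> polys_over R"
  and polys_over_smult: "c \<in> R \<Longrightarrow> p \<in> polys_over R \<Longrightarrow> smult c p \<in> polys_over R"
  and polys_over_uminus: "p \<in> polys_over R \<Longrightarrow> - p \<in> polys_over R"
  by (auto simp: polys_over_def intro: subring_closed[OF R])

lemma polys_over_mult: "p \<in> polys_over R \<Longrightarrow> r \<in> polys_over R \<Longrightarrow> p * r \<in> polys_over R"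
  by (auto simp: polys_over_def coeff_mult intro!: subring_sum[OF R] subring_mult[OF R])

lemma polys_over_0: "0 \<in> polys_over R"
  by (auto simp: polys_over_def intro: subring_closed[OF R])

lemma polys_over_pCons: "c \<in> R \<Longrightarrow> p \<in> polys_over R \<Longrightarrow> pCons c p \<in> polys_over R"
  by (auto simp: polys_over_def coeff_pCons intro: subring_closed[OF R] split: nat.split)

lemma polys_over_1: "1 \<in> polys_over R"
  by (simp add: one_pCons polys_over_pCons polys_over_0 subring_1[OF R])

lemma polys_over_monom: "c \<in> R \<Longrightarrow> monom c n \<in> polys_over R"
  by (auto simp: polys_over_def intro: subring_closed[OF R])

lemma polys_over_power: "p \<in> polys_over R \<Longrightarrow> p ^ n \<in> polys_over R"
  by (induction n) (auto intro: polys_over_1 polys_over_mult)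

lemma polys_over_sum: "(\<And>i. i \<in> I \<Longrightarrow> f i \<in> polys_over R) \<Longrightarrow> sum f I \<in> polys_over R"
  by (induction I rule: infinite_finite_induct) (auto intro: polys_over_0 polys_over_add)

lemma polys_over_pderiv: "p \<in> polys_over R \<Longrightarrow> pderiv p \<in> polys_over R"
  unfolding polys_over_def mem_Collect_eq coeff_pderiv
  by (blast intro: subring_mult[OF R] subring_of_nat[OF R])

lemma polys_over_coeff: "p \<in> polys_over R \<Longrightarrow> coeff p i \<in> R"
  by (auto simp: polys_over_def)

lemma poly_closed: "p \<in> polys_over R \<Longrightarrow> z \<in> R \<Longrightarrow> poly p z \<in> R"
  unfolding poly_altdef by (intro subring_sum[OF R] subring_mult[OF R] subring_power[OF R] polys_over_coeff) auto

lemmas polys_over_closed = polys_over_0 polys_over_1 polys_over_add polys_over_diff polys_over_uminus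
  polys_over_smult polys_over_mult polys_over_pCons polys_over_monom polys_over_power polys_over_sum

definition adjoin :: "'a \<Rightarrow> 'a set" where
  "adjoin s = (\<lambda>p. poly p s) ` polys_over R"

lemma adjoin_subring: "is_subring (adjoin s)"
proof (rule is_subringI)
  show "0 \<in> adjoin s" "1 \<in> adjoin s"
    unfolding adjoin_def using polys_over_0 polys_over_1 by (force simp: image_iff)+
next
  fix a b assume "a \<in> adjoin s" "b \<in> adjoin s"
  then obtain p r where pr: "a = poly p s" "b = poly r s" "p \<in> polys_over R" "r \<in> polys_over R"
    unfolding adjoin_def by blast
  have "poly (p + r) s \<in> adjoin s" "poly (p * r) s \<in> adjoin s"
    unfolding adjoin_def using pr by (auto intro!: imageI polys_over_add polys_over_mult simp del: poly_add poly_mult)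
  then show "a + b \<in> adjoin s" "a * b \<in> adjoin s"
    using pr by auto
next
  fix a assume "a \<in> adjoin s"
  then obtain p where pr: "a = poly p s" "p \<in> polys_over R"
    unfolding adjoin_def by blast
  have "poly (- p) s \<in> adjoin s"
    unfolding adjoin_def using pr by (auto intro!: imageI polys_over_uminus simp del: poly_minus)
  then show "- a \<in> adjoin s" using pr by auto
qed

lemma adjoin_superset: "R \<subseteq> adjoin s"
proof
  fix c assume "c \<in> R"
  then show "c \<in> adjoin s"
    unfolding adjoin_def by (intro image_eqI[where x="[:c:]"]) (auto intro: polys_over_closed)
qed

lemma adjoin_self: "s \<in> adjoin s"
  unfolding adjoin_def
  by (intro image_eqI[where x="[:0, 1:]"]) (auto intro!: polys_over_closed subring_closed[OF R])

lemma adjoin_least: "is_subring S \<Longrightarrow> R \<subseteq> S \<Longrightarrow> s \<in> S \<Longrightarrow> adjoin s \<subseteq> S"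
  unfolding adjoin_def polys_over_def poly_altdef
  by (auto intro!: subring_sum subring_mult subring_power)

end

lemma polys_over_mono: "R \<subseteq> S \<Longrightarrow> polys_over R \<subseteq> polys_over S"
  by (auto simp: polys_over_def)

lemma polys_over_division:
  assumes F: "is_subfield F" and p: "p \<in> polys_over F" "p \<noteq> 0" and f: "f \<in> polys_over F"
  shows "\<exists>g\<in>polys_over F. \<exists>r\<in>polys_over F. f = g * p + r \<and> (r = 0 \<or> degree r < degree p)"
  using f
proof (induction "degree f" arbitrary: f rule: less_induct)
  case (less f)
  note R = subfield_subring[OF F]
  show ?case
  proof (cases "f = 0 \<or> degree f < degree p")
    case True
    then show ?thesis
      using less.prems by (intro bexI[of _ 0] bexI[of _ f]) (auto intro: polys_over_0[OF R])
  next
    case False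
    define h where "h = monom (lead_coeff f / lead_coeff p) (degree f - degree p)"
    have h: "h \<in> polys_over F"
      unfolding h_def using less.prems p
      by (intro polys_over_monom[OF R] subfield_divide[OF F] polys_over_coeff[OF R]) auto
    have f': "f - h * p \<in> polys_over F"
      using less.prems h p by (intro polys_over_closed[OF R])
    have dh: "degree (h * p) = degree f"
      using False p by (subst degree_mult_eq) (auto simp: h_def degree_monom_eq)
    have lc: "coeff (h * p) (degree f) = lead_coeff f"
    proof -
      have "coeff (h * p) (degree f) = lead_coeff h * lead_coeff p"
        using dh lead_coeff_mult[of h p] by simp
      also have "lead_coeff h = lead_coeff f / lead_coeff p"
        using False p by (simp add: h_def degree_monom_eq)
      finally show ?thesis using p by simp
    qed
    show ?thesis
    proof (cases "f - h * p = 0")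
      case True
      then show ?thesis
        using h by (intro bexI[of _ h] bexI[of _ 0]) (auto intro: polys_over_0[OF R])
    next
      case nz: False
      have "degree (f - h * p) < degree f"
      proof -
        have "degree (f - h * p) \<le> degree f"
          by (simp add: degree_diff_le dh)
        moreover have "degree (f - h * p) \<noteq> degree f"
          using nz lc by (metis coeff_diff diff_self leading_coeff_0_iff)
        ultimately show ?thesis by simp
      qed
      from less.hyps[OF this f'] obtain g r where "g \<in> polys_over F" "r \<in> polys_over F"
        "f - h * p = g * p + r" "r = 0 \<or> degree r < degree p" by blast
      then show ?thesis
        using h by (intro bexI[of _ "g + h"] bexI[of _ r])
          (auto intro: polys_over_add[OF R] simp: algebra_simps)
    qed
  qed
qed

section \<open>Fields of fractions and the rational function field \<open>K(s)\<close>\<close>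

text \<open>The field \<open>K(s)\<close>. Zero denominators are harmless: such a quotient is
  \<open>0\<close> in HOL, which is a fraction anyway.\<close>

definition ratfun :: "'a::field set \<Rightarrow> 'a \<Rightarrow> 'a set" where
  "ratfun K s = {f / g | f g. f \<in> adjoin K s \<and> g \<in> adjoin K s}"

lemma fractions_subfield:
  assumes A: "is_subring A"
  shows "is_subfield {f / g | f g. f \<in> A \<and> g \<in> A}" (is "is_subfield ?F")
proof -
  note cl = subring_closed[OF A]
  have I: "f / g \<in> ?F" if "f \<in> A" "g \<in> A" for f g
    using that by blast
  have rep: "\<exists>f g. f \<in> A \<and> g \<in> A \<and> g \<noteq> 0 \<and> x = f / g" if x: "x \<in> ?F" for x
  proof -
    obtain f g where fg: "f \<in> A" "g \<in> A" "x = f / g" using x by blast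
    show ?thesis
    proof (cases "g = 0")
      case True
      then show ?thesis
        using fg cl(1,2) by (intro exI[of _ 0] exI[of _ 1]) auto
    next
      case False
      then show ?thesis using fg by blast
    qed
  qed
  have "x + y \<in> ?F \<and> x - y \<in> ?F \<and> x * y \<in> ?F" if "x \<in> ?F" "y \<in> ?F" for x y
  proof -
    obtain f g where 1: "f \<in> A" "g \<in> A" "g \<noteq> 0" "x = f / g" using rep[OF \<open>x \<in> ?F\<close>] by blast
    obtain f' g' where 2: "f' \<in> A" "g' \<in> A" "g' \<noteq> 0" "y = f' / g'" using rep[OF \<open>y \<in> ?F\<close>] by blast
    have e: "x + y = (f * g' + f' * g) / (g * g')" "x - y = (f * g' - f' * g) / (g * g')"
      "x * y = (f * f') / (g * g')"
      using 1(3,4) 2(3,4) by (auto simp: field_simps)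
    have "f * g' + f' * g \<in> A" "f * g' - f' * g \<in> A" "f * f' \<in> A" "g * g' \<in> A"
      using 1(1,2) 2(1,2) by (auto intro: cl(3-5))
    then show ?thesis unfolding e by (intro conjI I)
  qed
  moreover have "inverse x \<in> ?F" if x: "x \<in> ?F" for x
  proof -
    obtain f g where "f \<in> A" "g \<in> A" "x = f / g" using rep[OF x] by blast
    then show ?thesis using I[of g f] by simp
  qed
  moreover have "0 \<in> ?F" "1 \<in> ?F"
    using I[of 0 1] I[of 1 1] cl(1,2) by auto
  ultimately show ?thesis
    unfolding is_subfield_def by (intro conjI ballI) (simp_all only:)
qed

lemma fractions_superset:
  assumes "is_subring A" shows "A \<subseteq> {f / g | f g. f \<in> A \<and> g \<in> A}"
proof
  fix f assume "f \<in> A"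
  then show "f \<in> {f / g | f g. f \<in> A \<and> g \<in> A}"
    using subring_1[OF assms] by (intro CollectI exI[of _ f] exI[of _ 1]) auto
qed

context
  fixes K :: "'a::field set"
  assumes K: "is_subfield K"
begin

lemma ratfun_subfield: "is_subfield (ratfun K s)"
  unfolding ratfun_def by (rule fractions_subfield[OF adjoin_subring[OF subfield_subring[OF K]]])

lemma adjoin_ratfun: "adjoin K s \<subseteq> ratfun K s"
  unfolding ratfun_def by (rule fractions_superset[OF adjoin_subring[OF subfield_subring[OF K]]])

lemma K_ratfun: "K \<subseteq> ratfun K s"
  using adjoin_ratfun adjoin_superset[OF subfield_subring[OF K]] by blast

lemma self_ratfun: "s \<in> ratfun K s"
  using adjoin_ratfun adjoin_self[OF subfield_subring[OF K]] by blast

lemma ratfun_least: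
  assumes F: "is_subfield F" "K \<subseteq> F" "s \<in> F"
  shows "ratfun K s \<subseteq> F"
  using adjoin_least[OF subfield_subring[OF K] subfield_subring[OF F(1)] F(2,3)]
    subfield_divide[OF F(1)] unfolding ratfun_def by blast

lemma ratfun_inverse: "ratfun K (inverse s) = ratfun K s"
proof
  show "ratfun K (inverse s) \<subseteq> ratfun K s"
    by (rule ratfun_least) (auto intro: ratfun_subfield subsetD[OF K_ratfun]
        subfield_inverse[OF ratfun_subfield] self_ratfun)
  have "s \<in> ratfun K (inverse s)"
    using subfield_inverse[OF ratfun_subfield self_ratfun, of "inverse s"] by simp
  then show "ratfun K s \<subseteq> ratfun K (inverse s)"
    by (intro ratfun_least) (auto intro: ratfun_subfield subsetD[OF K_ratfun])
qed

end

section \<open>Linear dependence over a subfield\<close>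

text \<open>Gaussian elimination, by induction on the equations: a pivot \<open>r k j\<close>
  removes the unknown \<open>c k\<close> from the other equations, and \<open>c k\<close> is
  recovered from equation \<open>j\<close> at the end. Only field operations are used, so the
  solution stays in the subfield.\<close>

lemma homogeneous_system:
  assumes F: "is_subfield F" and "finite J" and "finite I" "card J < card I"
    and "\<And>i j. i \<in> I \<Longrightarrow> j \<in> J \<Longrightarrow> r i j \<in> F"
  shows "\<exists>c. (\<forall>i\<in>I. c i \<in> F) \<and> (\<exists>i\<in>I. c i \<noteq> 0) \<and> (\<forall>j\<in>J. (\<Sum>i\<in>I. c i * r i j) = 0)"
  using assms(2-5)
proof (induction J arbitrary: I r rule: finite_induct)
  case empty
  then have "I \<noteq> {}" by auto
  then show ?case
    using subring_1[OF subfield_subring[OF F]] by (intro exI[of _ "\<lambda>_. 1"]) auto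
next
  case (insert j J)
  note cl = subring_closed[OF subfield_subring[OF F]]
  show ?case
  proof (cases "\<forall>i\<in>I. r i j = 0")
    case True
    have "card J < card I" using insert by auto
    from insert.IH[OF \<open>finite I\<close> this] insert.prems obtain c where
      "\<forall>i\<in>I. c i \<in> F" "\<exists>i\<in>I. c i \<noteq> 0" "\<forall>j\<in>J. (\<Sum>i\<in>I. c i * r i j) = 0" by blast
    then show ?thesis using True by (intro exI[of _ c]) auto
  next
    case False
    then obtain k where k: "k \<in> I" "r k j \<noteq> 0" by blast
    define I' where "I' = I - {k}"
    define r' where "r' = (\<lambda>i l. r i l - r i j / r k j * r k l)"
    have fin: "finite I'" and card: "card J < card I'"
      using insert k by (auto simp: I'_def)
    have "r' i l \<in> F" if "i \<in> I'" "l \<in> J" for i l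
      using that insert.prems k unfolding r'_def I'_def
      by (intro cl subfield_divide[OF F]) auto
    from insert.IH[where r=r', OF fin card this] obtain c where c:
      "\<forall>i\<in>I'. c i \<in> F" "\<exists>i\<in>I'. c i \<noteq> 0" "\<forall>l\<in>J. (\<Sum>i\<in>I'. c i * r' i l) = 0" by blast
    define d where "d = - (\<Sum>i\<in>I'. c i * r i j) / r k j"
    define c' where "c' = c(k := d)"
    have sum: "(\<Sum>i\<in>I. c' i * r i l) = d * r k l + (\<Sum>i\<in>I'. c i * r i l)" for l
    proof -
      have "(\<Sum>i\<in>I. c' i * r i l) = c' k * r k l + (\<Sum>i\<in>I'. c' i * r i l)"
        using k insert.prems unfolding I'_def by (simp add: sum.remove)
      also have "(\<Sum>i\<in>I'. c' i * r i l) = (\<Sum>i\<in>I'. c i * r i l)"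
        by (rule sum.cong) (auto simp: c'_def I'_def)
      finally show ?thesis by (simp add: c'_def)
    qed
    have "(\<Sum>i\<in>I. c' i * r i l) = 0" if "l \<in> insert j J" for l
    proof (cases "l = j")
      case True
      then show ?thesis using k by (simp add: sum d_def)
    next
      case False
      then have "(\<Sum>i\<in>I'. c i * r' i l) = 0" using that c by auto
      moreover have "(\<Sum>i\<in>I'. c i * r' i l)
          = (\<Sum>i\<in>I'. c i * r i l) - (\<Sum>i\<in>I'. c i * r i j) / r k j * r k l"
        by (simp add: r'_def algebra_simps sum_subtractf sum_distrib_left sum_divide_distrib)
      ultimately show ?thesis by (simp add: sum d_def algebra_simps)
    qed
    moreover have "d \<in> F"
      unfolding d_def using c k insert.prems
      by (intro subfield_divide[OF F] cl) (auto simp: I'_def)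
    then have "\<forall>i\<in>I. c' i \<in> F"
      using c by (auto simp: c'_def I'_def)
    moreover have "\<exists>i\<in>I. c' i \<noteq> 0"
      using c by (auto simp: c'_def I'_def)
    ultimately show ?thesis by blast
  qed
qed

definition span_upto :: "'a::field set \<Rightarrow> (nat \<Rightarrow> 'a) \<Rightarrow> nat \<Rightarrow> 'a set" where
  "span_upto F e N = {\<Sum>j<N. r j * e j | r. \<forall>j<N. r j \<in> F}"

lemma span_upto_dependent:
  assumes F: "is_subfield F" and I: "finite I" "N < card I"
    and g: "\<And>i. i \<in> I \<Longrightarrow> g i \<in> span_upto F e N"
  shows "\<exists>c. (\<forall>i\<in>I. c i \<in> F) \<and> (\<exists>i\<in>I. c i \<noteq> 0) \<and> (\<Sum>i\<in>I. c i * g i) = 0"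
proof -
  have "\<forall>i\<in>I. \<exists>r. (\<forall>j<N. r j \<in> F) \<and> g i = (\<Sum>j<N. r j * e j)"
    using g unfolding span_upto_def by auto
  then obtain r where r: "\<And>i j. i \<in> I \<Longrightarrow> j < N \<Longrightarrow> r i j \<in> F"
    "\<And>i. i \<in> I \<Longrightarrow> g i = (\<Sum>j<N. r i j * e j)" by metis
  obtain c where c: "\<forall>i\<in>I. c i \<in> F" "\<exists>i\<in>I. c i \<noteq> 0" "\<forall>j\<in>{..<N}. (\<Sum>i\<in>I. c i * r i j) = 0"
    using homogeneous_system[OF F, of "{..<N}" I r] I r by auto
  have "(\<Sum>i\<in>I. c i * g i) = (\<Sum>i\<in>I. \<Sum>j<N. c i * r i j * e j)"
    by (rule sum.cong) (auto simp: r sum_distrib_left mult.assoc)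
  also have "\<dots> = (\<Sum>j<N. (\<Sum>i\<in>I. c i * r i j) * e j)"
    by (subst sum.swap) (simp add: sum_distrib_right)
  finally show ?thesis using c by auto
qed

section \<open>Existence of valuation rings\<close>

definition valuation_ring :: "'a::field set \<Rightarrow> bool" where
  "valuation_ring V \<longleftrightarrow> is_subring V \<and> (\<forall>z. z \<noteq> 0 \<longrightarrow> z \<in> V \<or> inverse z \<in> V)"

text \<open>The reversal is padded to a prescribed \<open>n\<close>, so that the power of
  \<open>z\<close> can be matched with the degree of another relation.\<close>

lemma poly_reversal:
  assumes R: "is_subring R" and p: "p \<in> polys_over R" "degree p \<le> n" and "z \<noteq> 0"
  shows "\<exists>r\<in>polys_over R. degree r \<le> n \<and> poly r z = z ^ n * poly p (inverse z)"
proof -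
  define r where "r = (\<Sum>j\<le>n. monom (coeff p j) (n - j))"
  have "r \<in> polys_over R"
    unfolding r_def using p by (intro polys_over_sum[OF R] polys_over_monom[OF R] polys_over_coeff[OF R])
  moreover have "degree r \<le> n"
    unfolding r_def by (rule degree_sum_le) (auto intro: order.trans[OF degree_monom_le])
  moreover have "poly r z = z ^ n * poly p (inverse z)"
  proof -
    have "poly p (inverse z) = (\<Sum>j\<le>n. coeff p j * inverse z ^ j)"
      unfolding poly_altdef by (rule sum.mono_neutral_left) (use p in \<open>auto intro: coeff_eq_0\<close>)
    then have "z ^ n * poly p (inverse z) = (\<Sum>j\<le>n. coeff p j * (z ^ n * inverse z ^ j))"
      by (simp add: sum_distrib_left mult_ac)
    also have "\<dots> = (\<Sum>j\<le>n. coeff p j * z ^ (n - j))"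
      by (rule sum.cong) (use \<open>z \<noteq> 0\<close> in \<open>auto simp: power_diff field_simps\<close>)
    finally show ?thesis by (simp add: r_def poly_sum poly_monom)
  qed
  ultimately show ?thesis by blast
qed

text \<open>A relation for \<open>z\<close> of minimal degree can be shortened by one for \<open>1/z\<close> of no larger degree.\<close>

lemma no_two_relations:
  assumes V: "is_subring V" and t: "t \<in> V" "t \<noteq> 0" "inverse t \<notin> V"
    and units: "\<And>b. b \<in> V \<Longrightarrow> inverse (1 - t * b) \<in> V"
    and "z \<noteq> 0" "p \<in> polys_over V" "r \<in> polys_over V"
    and "t * poly p z = 1" "t * poly r (inverse z) = 1"
  shows False
  using assms(6-10)
proof (induction "degree p + degree r" arbitrary: z p r rule: less_induct)
  case less
  note cl = subring_closed[OF V]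
  have const: "t * b \<noteq> 1" if "b \<in> V" for b
    using that t by (metis inverse_unique)
  have main: False
    if z: "z \<noteq> 0" and p: "p \<in> polys_over V" and r: "r \<in> polys_over V"
      and rel: "t * poly p z = 1" "t * poly r (inverse z) = 1" and le: "degree r \<le> degree p"
      and IH: "\<And>p'. p' \<in> polys_over V \<Longrightarrow> degree p' < degree p \<Longrightarrow> t * poly p' z \<noteq> 1" for z p r
  proof -
    define n where "n = degree p"
    have n: "n > 0"
    proof (rule ccontr)
      assume "\<not> n > 0"
      then have "degree p = 0" by (simp add: n_def)
      then obtain c where "p = [:c:]" by (rule degree_eq_zeroE)
      then show False
        using rel const[of c] polys_over_coeff[OF V p, of 0] by simp
    qed
    obtain b r1 where r1: "r = pCons b r1" by (cases r)
    have b: "b \<in> V" and r1V: "r1 \<in> polys_over V"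
      using r polys_over_coeff[OF V r, of 0] polys_over_coeff[OF V r, of "Suc i" for i]
      by (auto simp: r1 polys_over_def)
    have "degree r1 \<le> n - 1"
      using le n by (cases "r1 = 0") (auto simp: r1 n_def)
    from poly_reversal[OF V r1V this z] obtain r2 where
      r2: "r2 \<in> polys_over V" "degree r2 \<le> n - 1" "poly r2 z = z ^ (n - 1) * poly r1 (inverse z)"
      by blast
    \<comment> \<open>In \<open>t * r(1/z) = 1\<close> the constant term is moved to the right,
      where it leaves the unit \<open>u\<close>. Multiplied by \<open>z^n / u\<close> the relation
      expresses \<open>z^n\<close> through lower powers, and this removes the leading term of
      \<open>p\<close>.\<close>
    define u where "u = 1 - t * b"
    have u: "u \<noteq> 0" "inverse u \<in> V"
      using const[OF b] units[OF b] by (auto simp: u_def)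
    have "t * inverse z * poly r1 (inverse z) = u"
      using rel(2) by (simp add: r1 u_def algebra_simps)
    then have "t * poly r1 (inverse z) = u * z"
      using z by (simp add: field_simps)
    then have "t * poly r2 z = u * (z ^ (n - 1) * z)"
      by (simp add: r2 algebra_simps)
    also have "z ^ (n - 1) * z = z ^ n"
      using n by (metis power_minus_mult)
    finally have zn: "z ^ n = t * inverse u * poly r2 z"
      using u by (simp add: field_simps)
    define a where "a = lead_coeff p"
    define p' where "p' = (p - monom a n) + smult (a * (t * inverse u)) r2"
    have a: "a \<in> V" unfolding a_def by (rule polys_over_coeff[OF V p])
    have "p' \<in> polys_over V"
      unfolding p'_def using p a t(1) u(2) r2(1)
      by (intro polys_over_add[OF V] polys_over_diff[OF V] polys_over_monom[OF V] polys_over_smult[OF V] cl)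
    moreover have "degree p' < degree p"
    proof -
      have "degree (p - monom a n) \<le> n - 1"
      proof (rule degree_le, intro allI impI)
        fix i assume "n - 1 < i"
        then show "coeff (p - monom a n) i = 0"
          using n by (cases "i = n") (auto simp: a_def n_def intro: coeff_eq_0)
      qed
      moreover have "degree (smult (a * (t * inverse u)) r2) \<le> n - 1"
        using r2(2) by (meson degree_smult_le order.trans)
      ultimately have "degree p' \<le> n - 1"
        unfolding p'_def by (rule degree_add_le)
      then show ?thesis using n by (simp add: n_def)
    qed
    moreover have "poly p' z = poly p z"
      by (simp add: p'_def poly_monom zn algebra_simps)
    ultimately show False using IH[of p'] rel(1) by simp
  qed
  show False
  proof (cases "degree r \<le> degree p")
    case True
    show False
    proof (rule main[OF less.prems True])
      fix p' assume "p' \<in> polys_over V" "degree p' < degree p"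
      then show "t * poly p' z \<noteq> 1"
        using less.hyps[of p' r z] less.prems by auto
    qed
  next
    case False
    show False
    proof (rule main[of "inverse z" r p])
      fix p' assume "p' \<in> polys_over V" "degree p' < degree r"
      then show "t * poly p' (inverse z) \<noteq> 1"
        using less.hyps[of p p' z] less.prems by auto
    qed (use less.prems False in auto)
  qed
qed

lemma one_minus_power:
  assumes V: "is_subring V" and "t \<in> V" "b \<in> V"
  shows "\<exists>d\<in>V. (1 - t * b) ^ k = 1 - t * d"
proof (induction k)
  case 0
  then show ?case using subring_0[OF V] by (intro bexI[of _ 0]) auto
next
  case (Suc k)
  then obtain d where d: "d \<in> V" "(1 - t * b) ^ k = 1 - t * d" by blast
  then have "(1 - t * b) ^ Suc k = (1 - t * b) * (1 - t * d)"
    by simp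
  then have "(1 - t * b) ^ Suc k = 1 - t * (b + d - t * b * d)"
    by (simp add: algebra_simps)
  moreover have "b + d - t * b * d \<in> V"
    using assms d by (intro subring_add[OF V] subring_diff[OF V] subring_mult[OF V])
  ultimately show ?case by blast
qed

lemma exists_valuation_ring:
  assumes R: "is_subring R" and t: "t \<in> R" "t \<noteq> 0" "inverse t \<notin> R"
  shows "\<exists>V. valuation_ring V \<and> R \<subseteq> V \<and> inverse t \<notin> V"
proof -
  define \<A> where "\<A> = {S. is_subring S \<and> R \<subseteq> S \<and> inverse t \<notin> S}"
  have "\<exists>V\<in>\<A>. \<forall>X\<in>\<A>. V \<subseteq> X \<longrightarrow> X = V"
  proof (rule subset_Zorn_nonempty)
    show "\<A> \<noteq> {}" using R t by (auto simp: \<A>_def)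
  next
    fix \<C> assume C: "\<C> \<noteq> {}" "subset.chain \<A> \<C>"
    have sub: "is_subring S" "R \<subseteq> S" "inverse t \<notin> S" if "S \<in> \<C>" for S
      using C that by (auto simp: subset_chain_def \<A>_def)
    have two: "\<exists>S\<in>\<C>. a \<in> S \<and> b \<in> S" if ab: "a \<in> \<Union>\<C>" "b \<in> \<Union>\<C>" for a b
    proof -
      obtain S S' where "S \<in> \<C>" "S' \<in> \<C>" "a \<in> S" "b \<in> S'" using ab by blast
      moreover have "S \<subseteq> S' \<or> S' \<subseteq> S"
        using C \<open>S \<in> \<C>\<close> \<open>S' \<in> \<C>\<close> by (auto simp: subset_chain_def)
      ultimately show ?thesis by (metis subsetD)
    qed
    obtain S0 where S0: "S0 \<in> \<C>" using C by blast
    have "is_subring (\<Union>\<C>)"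
    proof (rule is_subringI)
      show "0 \<in> \<Union>\<C>" "1 \<in> \<Union>\<C>"
        using S0 subring_0[OF sub(1)[OF S0]] subring_1[OF sub(1)[OF S0]] by blast+
    next
      fix a b assume "a \<in> \<Union>\<C>" "b \<in> \<Union>\<C>"
      then obtain S where S: "S \<in> \<C>" "a \<in> S" "b \<in> S" using two by blast
      then show "a + b \<in> \<Union>\<C>" "a * b \<in> \<Union>\<C>"
        using subring_add[OF sub(1)[OF S(1)] S(2,3)] subring_mult[OF sub(1)[OF S(1)] S(2,3)] by blast+
    next
      fix a assume "a \<in> \<Union>\<C>"
      then obtain S where S: "S \<in> \<C>" "a \<in> S" by blast
      then show "- a \<in> \<Union>\<C>" using subring_uminus[OF sub(1)[OF S(1)] S(2)] by blast
    qed
    then show "\<Union>\<C> \<in> \<A>"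
      using S0 sub by (auto simp: \<A>_def)
  qed
  then obtain V where VA: "V \<in> \<A>" and max: "\<And>X. X \<in> \<A> \<Longrightarrow> V \<subseteq> X \<Longrightarrow> X = V" by blast
  have V: "is_subring V" "R \<subseteq> V" "inverse t \<notin> V" using VA by (auto simp: \<A>_def)
  note cl = subring_closed[OF V(1)]
  have tV: "t \<in> V" using V t by blast
  \<comment> \<open>By maximality the ring \<open>V[z]\<close> contains \<open>1/t\<close>; the
    claim is this membership, multiplied by \<open>t\<close>.\<close>
  have ext: "\<exists>p\<in>polys_over V. t * poly p z = 1" if "z \<notin> V" for z
  proof (rule ccontr)
    assume no: "\<not> ?thesis"
    have "inverse t \<notin> adjoin V z"
    proof
      assume "inverse t \<in> adjoin V z"
      then obtain p where "p \<in> polys_over V" "inverse t = poly p z"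
        unfolding adjoin_def[OF V(1)] by blast
      then show False using no t by (metis right_inverse)
    qed
    then have "adjoin V z \<in> \<A>"
      using adjoin_subring[OF V(1)] adjoin_superset[OF V(1)] V(2) by (auto simp: \<A>_def)
    from max[OF this adjoin_superset[OF V(1)]] show False
      using adjoin_self[OF V(1), of z] that by simp
  qed
  \<comment> \<open>Otherwise there is a relation for \<open>1/u\<close>. Multiplied by a power of
    \<open>u\<close>, which is congruent to 1 modulo \<open>t\<close>, it becomes
    \<open>t * (r(u) + d) = 1\<close> and puts \<open>1/t\<close> into \<open>V\<close>.\<close>
  have units: "inverse (1 - t * b) \<in> V" if b: "b \<in> V" for b
  proof (rule ccontr)
    assume nV: "inverse (1 - t * b) \<notin> V"
    define u where "u = 1 - t * b"
    have uV: "u \<in> V" unfolding u_def using b tV by (intro cl)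
    have "u \<noteq> 0" using nV cl(1) by (auto simp: u_def)
    obtain p where p: "p \<in> polys_over V" "t * poly p (inverse u) = 1"
      using ext[of "inverse u"] nV by (auto simp: u_def)
    obtain r where r: "r \<in> polys_over V" "poly r u = u ^ degree p * poly p (inverse u)"
      using poly_reversal[OF V(1) p(1) order.refl \<open>u \<noteq> 0\<close>] by blast
    obtain d where d: "d \<in> V" "u ^ degree p = 1 - t * d"
      using one_minus_power[OF V(1) tV b] by (auto simp: u_def)
    have "u ^ degree p * (t * poly p (inverse u)) = t * poly r u"
      using r(2) by (simp add: algebra_simps)
    then have "t * (poly r u + d) = 1"
      using p(2) d(2) by (simp add: algebra_simps)
    then have "inverse t = poly r u + d" by (rule inverse_unique)
    moreover have "poly r u + d \<in> V"
      using poly_closed[OF V(1) r(1) uV] d(1) by (intro cl)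
    ultimately show False using V(3) by simp
  qed
  have "z \<in> V \<or> inverse z \<in> V" if z: "z \<noteq> 0" for z
  proof (rule ccontr)
    assume "\<not> ?thesis"
    then obtain p r where "p \<in> polys_over V" "t * poly p z = 1"
        "r \<in> polys_over V" "t * poly r (inverse z) = 1"
      using ext[of z] ext[of "inverse z"] by blast
    then show False
      using no_two_relations[OF V(1) tV t(2) V(3) units z, of p r] by blast
  qed
  then show ?thesis using V unfolding valuation_ring_def by blast
qed

section \<open>Units, maximal ideal and integral closure of a valuation ring\<close>

context
  fixes V :: "'a::field set"
  assumes V: "valuation_ring V"
begin

lemma vring_subring: "is_subring V"
  using V by (simp add: valuation_ring_def)

lemma vring_cases: "z \<in> V \<or> inverse z \<in> V"
  using V subring_0[OF vring_subring] by (cases "z = 0") (auto simp: valuation_ring_def)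

text \<open>The maximal ideal of \<open>V\<close>. Zero is listed separately because
  \<open>inverse 0 = 0\<close> lies in \<open>V\<close>.\<close>

definition nonunits :: "'a set" where
  "nonunits = {f \<in> V. f = 0 \<or> inverse f \<notin> V}"

definition units :: "'a set" where
  "units = {f \<in> V. f \<noteq> 0 \<and> inverse f \<in> V}"

lemma nonunitsD: "f \<in> nonunits \<Longrightarrow> f \<in> V"
  and unitsD: "f \<in> units \<Longrightarrow> f \<in> V" "f \<in> units \<Longrightarrow> f \<noteq> 0" "f \<in> units \<Longrightarrow> inverse f \<in> V"
  and vring_dichotomy: "f \<in> V \<Longrightarrow> f \<in> nonunits \<or> f \<in> units"
  and units_not_nonunits: "f \<in> units \<Longrightarrow> f \<notin> nonunits"
  by (auto simp: nonunits_def units_def)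

lemma one_unit: "1 \<in> units"
  by (simp add: units_def subring_1[OF vring_subring])

lemma zero_nonunit: "0 \<in> nonunits"
  by (simp add: nonunits_def subring_0[OF vring_subring])

lemma units_mult: "f \<in> units \<Longrightarrow> g \<in> units \<Longrightarrow> f * g \<in> units"
  by (auto simp: units_def intro: subring_mult[OF vring_subring])

lemma units_inverse: "f \<in> units \<Longrightarrow> inverse f \<in> units"
  by (auto simp: units_def)

lemma units_divide: "f \<in> units \<Longrightarrow> g \<in> units \<Longrightarrow> f / g \<in> units"
  by (simp add: divide_inverse units_mult units_inverse)

lemma nonunits_mult: "f \<in> nonunits \<Longrightarrow> g \<in> V \<Longrightarrow> f * g \<in> nonunits"
proof (rule ccontr)
  assume f: "f \<in> nonunits" and g: "g \<in> V" and "f * g \<notin> nonunits"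
  then have "f * g \<in> units"
    using vring_dichotomy[OF subring_mult[OF vring_subring nonunitsD[OF f] g]] by blast
  then have "f \<noteq> 0" "g \<noteq> 0" and "g * inverse (f * g) \<in> V"
    using subring_mult[OF vring_subring g unitsD(3)[OF \<open>f * g \<in> units\<close>]]
      unitsD(2)[OF \<open>f * g \<in> units\<close>] by auto
  moreover have "g * inverse (f * g) = inverse f"
    using \<open>g \<noteq> 0\<close> by (simp add: field_simps)
  ultimately have "inverse f \<in> V" by metis
  then show False using f \<open>f \<noteq> 0\<close> by (simp add: nonunits_def)
qed

lemma not_in_vring: "f \<notin> V \<Longrightarrow> inverse f \<in> nonunits"
  using vring_cases[of f] by (auto simp: nonunits_def)

text \<open>One of \<open>f / g\<close> and \<open>g / f\<close> lies in \<open>V\<close>, so the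
  sum is a multiple of \<open>g\<close> or of \<open>f\<close> by an element of
  \<open>V\<close>.\<close>

lemma nonunits_add:
  assumes f: "f \<in> nonunits" and g: "g \<in> nonunits"
  shows "f + g \<in> nonunits"
proof -
  have main: "f + g \<in> nonunits" if "f \<in> nonunits" "g \<in> nonunits" "f / g \<in> V" "g \<noteq> 0" for f g
  proof -
    have "f + g = g * (f / g + 1)" using that by (simp add: field_simps)
    moreover have "f / g + 1 \<in> V"
      using that subring_1[OF vring_subring] by (intro subring_add[OF vring_subring])
    ultimately show ?thesis using nonunits_mult that by metis
  qed
  show ?thesis
  proof (cases "f = 0 \<or> g = 0")
    case True
    then show ?thesis using f g by auto
  next
    case False
    then show ?thesis
      using main[of f g] main[of g f] f g vring_cases[of "f / g"] by (auto simp: add.commute)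
  qed
qed

lemma one_plus_nonunit: "f \<in> nonunits \<Longrightarrow> 1 + f \<in> units"
proof -
  assume f: "f \<in> nonunits"
  have "1 + f \<in> V" using f nonunitsD subring_1[OF vring_subring] by (intro subring_add[OF vring_subring])
  moreover have "1 + f \<notin> nonunits"
  proof
    assume "1 + f \<in> nonunits"
    moreover have "- f \<in> nonunits"
      using nonunits_mult[OF f, of "- 1"] subring_uminus[OF vring_subring subring_1[OF vring_subring]] by simp
    ultimately have "1 + f + - f \<in> nonunits" by (rule nonunits_add)
    then show False using one_unit units_not_nonunits by simp
  qed
  ultimately show ?thesis using vring_dichotomy by blast
qed

text \<open>Valuation rings are integrally closed: if \<open>z\<close> were outside,
  \<open>1/z\<close> would be a nonunit, and dividing the relation by \<open>z^k\<close> would write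
  1 as a sum of nonunits.\<close>

lemma vring_integral:
  assumes "\<And>i. i < k \<Longrightarrow> c i \<in> V" and rel: "z ^ k = (\<Sum>i<k. c i * z ^ i)"
  shows "z \<in> V"
proof (rule ccontr)
  assume z: "z \<notin> V"
  then have z0: "z \<noteq> 0" using subring_0[OF vring_subring] by blast
  have zi: "inverse z \<in> nonunits" by (rule not_in_vring[OF z])
  have "(\<Sum>i<k. c i * inverse z ^ (k - i)) \<in> nonunits"
  proof -
    have "(\<Sum>i\<in>I. c i * inverse z ^ (k - i)) \<in> nonunits" if "I \<subseteq> {..<k}" "finite I" for I
      using that(2,1)
    proof (induction I rule: finite_induct)
      case empty
      then show ?case by (simp add: zero_nonunit)
    next
      case (insert i I)
      then have "k - i = Suc (k - i - 1)" by auto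
      then have e: "c i * inverse z ^ (k - i) = inverse z * (c i * inverse z ^ (k - i - 1))"
        by (metis mult.left_commute power_Suc)
      have "inverse z * (c i * inverse z ^ (k - i - 1)) \<in> nonunits"
        using insert assms(1)[of i] nonunitsD[OF zi]
        by (intro nonunits_mult[OF zi] subring_mult[OF vring_subring] subring_power[OF vring_subring]) auto
      then have "c i * inverse z ^ (k - i) \<in> nonunits"
        unfolding e .
      then show ?case using insert by (simp add: nonunits_add)
    qed
    then show ?thesis by blast
  qed
  moreover have "(\<Sum>i<k. c i * inverse z ^ (k - i)) = 1"
  proof -
    have "(\<Sum>i<k. c i * inverse z ^ (k - i)) = (\<Sum>i<k. c i * z ^ i) / z ^ k"
      unfolding sum_divide_distrib
      by (rule sum.cong) (use z0 in \<open>auto simp: power_diff field_simps\<close>)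
    then show ?thesis using z0 by (simp flip: rel)
  qed
  ultimately show False using one_unit units_not_nonunits by simp
qed

text \<open>The ultrametric principle before any valuation exists: terms are compared through their
  quotients, and the dominant one determines the sum up to the unit \<open>1 + r\<close>.\<close>

lemma dominant_term:
  assumes "finite I" "I \<noteq> {}" "\<And>i. i \<in> I \<Longrightarrow> g i \<noteq> 0"
    and "\<And>i j. i \<in> I \<Longrightarrow> j \<in> I \<Longrightarrow> i \<noteq> j \<Longrightarrow> g i / g j \<in> nonunits \<or> g j / g i \<in> nonunits"
  shows "\<exists>k\<in>I. \<exists>r\<in>nonunits. sum g I = g k * (1 + r)"
  using assms
proof (induction I rule: finite_ne_induct)
  case (singleton i)
  then show ?case using zero_nonunit by force
next
  case (insert j I)
  then obtain k r where k: "k \<in> I" "r \<in> nonunits" "sum g I = g k * (1 + r)" by blast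
  have nz: "g k \<noteq> 0" "g j \<noteq> 0" using insert k by auto
  have sum: "sum g (insert j I) = g j + g k * (1 + r)"
    using insert k by simp
  from insert.prems(2)[of j k] k insert.hyps
  consider "g j / g k \<in> nonunits" | "g k / g j \<in> nonunits" by auto
  then show ?case
  proof cases
    case 1
    then have "r + g j / g k \<in> nonunits" using k by (intro nonunits_add)
    moreover have "sum g (insert j I) = g k * (1 + (r + g j / g k))"
      using sum nz by (simp add: field_simps)
    ultimately show ?thesis using k by blast
  next
    case 2
    then have "g k / g j * (1 + r) \<in> nonunits"
      using k one_plus_nonunit unitsD by (intro nonunits_mult) auto
    moreover have "sum g (insert j I) = g j * (1 + (g k / g j * (1 + r)))"
      using sum nz by (simp add: field_simps)
    ultimately show ?thesis by blast
  qed
qed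

lemma sum_nonzero_of_distinct:
  assumes "finite I" "I \<noteq> {}" "\<And>i. i \<in> I \<Longrightarrow> g i \<noteq> 0"
    and "\<And>i j. i \<in> I \<Longrightarrow> j \<in> I \<Longrightarrow> i \<noteq> j \<Longrightarrow> g i / g j \<in> nonunits \<or> g j / g i \<in> nonunits"
  shows "sum g I \<noteq> 0"
  using dominant_term[OF assms] assms(3) one_plus_nonunit unitsD(2) by fastforce

end

text \<open>The \<open>N + 1\<close> powers \<open>f^0, ..., f^N\<close> are dependent; dividing by
  the coefficient of largest index makes the relation monic, as needed for
  \<open>vring_integral\<close>.\<close>

lemma algebraic_relation:
  assumes F: "is_subfield F" and span: "\<And>f. f \<in> span_upto F e N"
  shows "\<exists>k c. (\<forall>i<k. c i \<in> F) \<and> f ^ k = (\<Sum>i<k. c i * f ^ i)"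
proof -
  obtain c where c: "\<forall>i\<le>N. c i \<in> F" "\<exists>i\<le>N. c i \<noteq> 0" "(\<Sum>i\<le>N. c i * f ^ i) = 0"
    using span_upto_dependent[OF F, of "{..N}" N "\<lambda>i. f ^ i" e] span by auto
  define k where "k = Max {i. i \<le> N \<and> c i \<noteq> 0}"
  have "k \<in> {i. i \<le> N \<and> c i \<noteq> 0}"
    unfolding k_def using c by (intro Max_in) auto
  then have k: "k \<le> N" "c k \<noteq> 0" by auto
  have kmax: "c i = 0" if "i \<le> N" "k < i" for i
  proof (rule ccontr)
    assume "c i \<noteq> 0"
    then have "i \<le> k" unfolding k_def using that by (intro Max_ge) auto
    then show False using that by simp
  qed
  have "(\<Sum>i\<le>N. c i * f ^ i) = (\<Sum>i\<in>insert k {..<k}. c i * f ^ i)"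
    by (rule sum.mono_neutral_right) (use k kmax in \<open>auto simp: not_less\<close>)
  then have "c k * f ^ k = - (\<Sum>i<k. c i * f ^ i)"
    using c(3) by (simp add: eq_neg_iff_add_eq_0)
  then have "f ^ k = - (\<Sum>i<k. c i * f ^ i) / c k"
    using k by (simp add: field_simps)
  also have "\<dots> = (\<Sum>i<k. - (c i / c k) * f ^ i)"
    by (simp add: sum_divide_distrib sum_negf)
  finally have "f ^ k = (\<Sum>i<k. - (c i / c k) * f ^ i)" .
  moreover have "\<forall>i<k. - (c i / c k) \<in> F"
    using c k by (auto intro!: subring_uminus[OF subfield_subring[OF F]] subfield_divide[OF F])
  ultimately show ?thesis by (intro exI[of _ k] exI[of _ "\<lambda>i. - (c i / c k)"]) blast
qed

section \<open>Places of a function field of one variable\<close>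

text \<open>Finiteness over \<open>K(s)\<close> is given by a spanning family of \<open>N\<close>
  elements: it is used in the form that \<open>N + 1\<close> elements are dependent.\<close>

locale function_field =
  fixes K :: "'a::field set" and s :: 'a and e :: "nat \<Rightarrow> 'a" and N :: nat
  assumes K: "is_subfield K" and trans: "transcendental_over K s"
    and span: "\<And>f. f \<in> span_upto (ratfun K s) e N"
begin

lemmas K_ring = subfield_subring[OF K]

lemma poly_nonzero: "p \<in> polys_over K \<Longrightarrow> p \<noteq> 0 \<Longrightarrow> poly p s \<noteq> 0"
  using trans by (auto simp: transcendental_over_def polys_over_def)

lemma poly_inj:
  assumes "p \<in> polys_over K" "r \<in> polys_over K" "poly p s = poly r s" shows "p = r"
  using poly_nonzero[of "p - r"] polys_over_diff[OF K_ring assms(1,2)] assms(3) by auto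

lemma s_nonzero: "s \<noteq> 0"
proof -
  have "[:0, 1:] \<in> polys_over K"
    by (intro polys_over_closed[OF K_ring] subring_closed[OF K_ring])
  from poly_nonzero[OF this] show ?thesis by simp
qed

lemma ratfun_cases:
  assumes "f \<in> ratfun K s" "f \<noteq> 0"
  obtains p r where "p \<in> polys_over K" "r \<in> polys_over K" "p \<noteq> 0" "r \<noteq> 0" "f = poly p s / poly r s"
proof -
  from assms obtain p r where "p \<in> polys_over K" "r \<in> polys_over K" "f = poly p s / poly r s"
    unfolding ratfun_def adjoin_def[OF K_ring] by blast
  then show ?thesis using that assms(2) by (metis div_0 div_by_0 poly_0)
qed

end

locale function_field_vring = function_field K s e N
  for K :: "'a::field set" and s :: 'a and e :: "nat \<Rightarrow> 'a" and N :: nat +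
  fixes V :: "'a set"
  assumes V: "valuation_ring V" and KV: "K \<subseteq> V" and proper: "V \<noteq> UNIV" and sV: "s \<in> V"
begin

lemmas cl = subring_closed[OF vring_subring[OF V]]

abbreviation "\<mm> \<equiv> nonunits V"
abbreviation "\<uu> \<equiv> units V"

lemma K_poly_V: "p \<in> polys_over K \<Longrightarrow> poly p s \<in> V"
  using poly_closed[OF vring_subring[OF V] subsetD[OF polys_over_mono[OF KV]] sV] .

text \<open>Otherwise all nonzero polynomials are units, \<open>V\<close> contains
  \<open>K(s)\<close>, and then everything integral over \<open>K(s)\<close>, that is, the whole
  field.\<close>

lemma exists_poly_nonunit: "\<exists>p\<in>polys_over K. p \<noteq> 0 \<and> poly p s \<in> \<mm>"
proof (rule ccontr)
  assume no: "\<not> ?thesis"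
  have "f \<in> V" if "f \<in> ratfun K s" for f
  proof (cases "f = 0")
    case True
    then show ?thesis using cl(1) by simp
  next
    case False
    from ratfun_cases[OF that False] obtain p r where
      "p \<in> polys_over K" "r \<in> polys_over K" "p \<noteq> 0" "r \<noteq> 0" "f = poly p s / poly r s" by metis
    then have "f \<in> \<uu>"
      using no K_poly_V vring_dichotomy[OF V] by (auto intro!: units_divide[OF V])
    then show ?thesis by (rule unitsD(1)[OF V])
  qed
  moreover have "\<exists>k c. (\<forall>i<k. c i \<in> ratfun K s) \<and> f ^ k = (\<Sum>i<k. c i * f ^ i)" for f
    by (rule algebraic_relation[OF ratfun_subfield[OF K] span])
  ultimately have "f \<in> V" for f
    using vring_integral[OF V] by metis
  then show False using proper by blast
qed

lemma exists_prime:
  "\<exists>\<pi>\<in>polys_over K. \<pi> \<noteq> 0 \<and> poly \<pi> s \<in> \<mm> \<and>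
     (\<forall>p\<in>polys_over K. p \<noteq> 0 \<longrightarrow> poly p s \<in> \<mm> \<longrightarrow> degree \<pi> \<le> degree p)"
  using exists_poly_nonunit
    ex_has_least_nat[of "\<lambda>p. p \<in> polys_over K \<and> p \<noteq> 0 \<and> poly p s \<in> \<mm>" _ degree]
  by (metis (mono_tags, lifting))

text \<open>A generator of the prime ideal that the nonunits of \<open>V\<close> cut out on
  \<open>K[s]\<close>.\<close>

definition \<pi> :: "'a poly" where
  "\<pi> = (SOME \<pi>. \<pi> \<in> polys_over K \<and> \<pi> \<noteq> 0 \<and> poly \<pi> s \<in> \<mm> \<and>
     (\<forall>p\<in>polys_over K. p \<noteq> 0 \<longrightarrow> poly p s \<in> \<mm> \<longrightarrow> degree \<pi> \<le> degree p))"

lemma prime: "\<pi> \<in> polys_over K" "\<pi> \<noteq> 0" "poly \<pi> s \<in> \<mm>"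
  and prime_least: "p \<in> polys_over K \<Longrightarrow> p \<noteq> 0 \<Longrightarrow> poly p s \<in> \<mm> \<Longrightarrow> degree \<pi> \<le> degree p"
proof -
  have "\<exists>\<pi>. \<pi> \<in> polys_over K \<and> \<pi> \<noteq> 0 \<and> poly \<pi> s \<in> \<mm> \<and>
     (\<forall>p\<in>polys_over K. p \<noteq> 0 \<longrightarrow> poly p s \<in> \<mm> \<longrightarrow> degree \<pi> \<le> degree p)"
    using exists_prime by blast
  from someI_ex[OF this, folded \<pi>_def]
  show "\<pi> \<in> polys_over K" "\<pi> \<noteq> 0" "poly \<pi> s \<in> \<mm>"
    "p \<in> polys_over K \<Longrightarrow> p \<noteq> 0 \<Longrightarrow> poly p s \<in> \<mm> \<Longrightarrow> degree \<pi> \<le> degree p" by blast+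
qed

definition P :: 'a where "P = poly \<pi> s"

lemma P: "P \<in> \<mm>" "P \<in> V" "P \<noteq> 0"
  using prime poly_nonzero nonunitsD[OF V] by (auto simp: P_def)

lemma prime_degree: "degree \<pi> > 0"
proof (rule ccontr)
  assume "\<not> degree \<pi> > 0"
  then have "degree \<pi> = 0" by simp
  then obtain c where c: "\<pi> = [:c:]" by (rule degree_eq_zeroE)
  then have "c \<in> K" using polys_over_coeff[OF subfield_subring[OF K] prime(1), of 0] by simp
  then have "c \<in> \<uu>"
    using c prime(2) KV subfield_inverse[OF K] by (auto simp: units_def[OF V])
  then show False using P(1) c units_not_nonunits[OF V] by (auto simp: P_def)
qed

text \<open>On \<open>K[s]\<close> the ring \<open>V\<close> is the \<open>\<pi>\<close>-adic one:
  the remainder of a nonunit modulo \<open>\<pi>\<close> is a nonunit of smaller degree, hence zero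
  by the choice of \<open>\<pi>\<close>.\<close>

lemma poly_factorisation:
  assumes "f \<in> polys_over K" "f \<noteq> 0"
  shows "\<exists>k. \<exists>u\<in>\<uu>. poly f s = P ^ k * u"
  using assms
proof (induction "degree f" arbitrary: f rule: less_induct)
  case (less f)
  show ?case
  proof (cases "poly f s \<in> \<mm>")
    case False
    then have "poly f s \<in> \<uu>"
      using K_poly_V[OF less.prems(1)] vring_dichotomy[OF V] by blast
    then show ?thesis by (intro exI[of _ 0] bexI[of _ "poly f s"]) auto
  next
    case True
    obtain g r where gr: "g \<in> polys_over K" "r \<in> polys_over K" "f = g * \<pi> + r"
      "r = 0 \<or> degree r < degree \<pi>"
      using polys_over_division[OF K prime(1,2) less.prems(1)] by blast
    have "poly r s = poly f s + P * (- poly g s)"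
      using gr by (simp add: P_def)
    moreover have "P * (- poly g s) \<in> \<mm>"
      using K_poly_V[OF gr(1)] P by (intro nonunits_mult[OF V] cl)
    ultimately have "poly r s \<in> \<mm>"
      using nonunits_add[OF V True] by metis
    then have "r = 0" using prime_least[of r] gr by fastforce
    then have fg: "f = g * \<pi>" and "g \<noteq> 0" using gr less.prems by auto
    then have "degree g < degree f"
      using prime_degree prime(2) by (simp add: degree_mult_eq)
    from less.hyps[OF this gr(1) \<open>g \<noteq> 0\<close>] obtain k u where "u \<in> \<uu>" "poly g s = P ^ k * u" by blast
    then show ?thesis
      by (intro exI[of _ "Suc k"] bexI[of _ u]) (auto simp: fg P_def)
  qed
qed

lemma ratfun_factorisation:
  assumes "f \<in> ratfun K s" "f \<noteq> 0"
  shows "\<exists>k::int. \<exists>u\<in>\<uu>. f = P powi k * u"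
proof -
  from ratfun_cases[OF assms] obtain p r where
    pr: "p \<in> polys_over K" "r \<in> polys_over K" "p \<noteq> 0" "r \<noteq> 0" "f = poly p s / poly r s" by metis
  obtain k u where ku: "u \<in> \<uu>" "poly p s = P ^ k * u"
    using poly_factorisation[OF pr(1,3)] by blast
  obtain l v where lv: "v \<in> \<uu>" "poly r s = P ^ l * v"
    using poly_factorisation[OF pr(2,4)] by blast
  have "f = P powi (int k - int l) * (u / v)"
    using pr(5) ku lv P(3) unitsD(2)[OF V] by (simp add: power_int_diff)
  then show ?thesis using units_divide[OF V ku(1) lv(1)] by blast
qed

lemma powi_V: "k \<ge> 0 \<Longrightarrow> z \<in> V \<Longrightarrow> z powi k \<in> V"
  using cl(7)[of z "nat k"] by (simp add: power_int_def)

lemma bounded_denominator_ratfun: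
  assumes "f \<in> ratfun K s"
  shows "\<exists>M. P ^ M * f \<in> V"
proof (cases "f = 0")
  case True
  then show ?thesis using cl(1) by auto
next
  case False
  obtain k u where ku: "u \<in> \<uu>" "f = P powi k * u"
    using ratfun_factorisation[OF assms False] by blast
  have "P ^ nat \<bar>k\<bar> = P powi \<bar>k\<bar>" by (simp add: power_int_def)
  then have "P ^ nat \<bar>k\<bar> * f = P powi (\<bar>k\<bar> + k) * u"
    using P(3) ku(2) by (simp add: power_int_add)
  also have "\<dots> \<in> V" using ku P unitsD(1)[OF V] by (intro cl powi_V) auto
  finally show ?thesis by blast
qed

text \<open>\<open>P^M\<close> clears the denominators of all coefficients of a monic relation for
  \<open>f\<close>; rescaling the relation shows that \<open>P^M * f\<close> is integral over
  \<open>V\<close>.\<close>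

lemma bounded_denominator: "\<exists>M. P ^ M * f \<in> V"
proof -
  obtain k c where kc: "\<And>i. i < k \<Longrightarrow> c i \<in> ratfun K s" "f ^ k = (\<Sum>i<k. c i * f ^ i)"
    using algebraic_relation[OF ratfun_subfield[OF K] span] by blast
  have "\<forall>i. \<exists>M. i < k \<longrightarrow> P ^ M * c i \<in> V"
    using bounded_denominator_ratfun kc(1) by blast
  then obtain m where m: "\<And>i. i < k \<Longrightarrow> P ^ m i * c i \<in> V" by metis
  define M where "M = (\<Sum>i<k. m i)"
  have "P ^ M * f \<in> V"
  proof (rule vring_integral[OF V, of k "\<lambda>i. P ^ (M * (k - i)) * c i"])
    fix i assume i: "i < k"
    then have "m i \<le> M" unfolding M_def by (intro member_le_sum) auto
    also have "M \<le> M * (k - i)" using i by (cases "k - i") auto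
    finally have "P ^ (M * (k - i)) * c i = P ^ (M * (k - i) - m i) * (P ^ m i * c i)"
      by (simp flip: power_add mult.assoc)
    then show "P ^ (M * (k - i)) * c i \<in> V"
      using cl(5)[OF cl(7)[OF P(2)] m[OF i]] by metis
  next
    have "(P ^ M * f) ^ k = (\<Sum>i<k. P ^ (M * k) * (c i * f ^ i))"
      by (simp add: power_mult_distrib kc(2) sum_distrib_left flip: power_mult)
    also have "\<dots> = (\<Sum>i<k. P ^ (M * (k - i)) * c i * (P ^ M * f) ^ i)"
    proof (rule sum.cong)
      fix i assume "i \<in> {..<k}"
      then have "M * k = M * (k - i) + M * i" by (simp flip: distrib_left)
      then show "P ^ (M * k) * (c i * f ^ i) = P ^ (M * (k - i)) * c i * (P ^ M * f) ^ i"
        by (simp add: power_add power_mult_distrib mult_ac flip: power_mult)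
    qed simp
    finally show "(P ^ M * f) ^ k = (\<Sum>i<k. P ^ (M * (k - i)) * c i * (P ^ M * f) ^ i)" .
  qed
  then show ?thesis by blast
qed

text \<open>In a relation over \<open>K(s)\<close> among the \<open>x i\<close> no two terms could have the same value, because the
  values of \<open>K(s)\<close> are multiples of that of \<open>P\<close>. This bounds the ramification.\<close>

lemma no_long_chain:
  assumes x: "\<And>i. i \<le> N \<Longrightarrow> x i \<in> V" "\<And>i. i \<le> N \<Longrightarrow> x i \<noteq> 0" "\<And>i. i \<le> N \<Longrightarrow> P / x i \<in> \<mm>"
    and chain: "\<And>i j. i < j \<Longrightarrow> j \<le> N \<Longrightarrow> x i / x j \<in> \<mm>"
  shows False
proof -
  obtain c where c: "\<forall>i\<le>N. c i \<in> ratfun K s" "\<exists>i\<le>N. c i \<noteq> 0" "(\<Sum>i\<le>N. c i * x i) = 0"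
    using span_upto_dependent[OF ratfun_subfield[OF K], of "{..N}" N x s e] span by auto
  define I where "I = {i. i \<le> N \<and> c i \<noteq> 0}"
  have "\<forall>i. \<exists>k u. i \<in> I \<longrightarrow> u \<in> \<uu> \<and> c i = P powi k * u"
    using ratfun_factorisation c(1) unfolding I_def by blast
  then obtain k u where ku: "\<And>i. i \<in> I \<Longrightarrow> u i \<in> \<uu>" "\<And>i. i \<in> I \<Longrightarrow> c i = P powi k i * u i"
    by metis
  have x0: "x i \<noteq> 0" "u i \<noteq> 0" if "i \<in> I" for i
    using that x(2) ku(1) unitsD(2)[OF V] by (auto simp: I_def)
  have bigger: "(c i * x i) / (c j * x j) \<in> \<mm>" if ij: "i \<in> I" "j \<in> I" "k j < k i" for i j
  proof -
    \<comment> \<open>One factor \<open>P\<close> is kept back to form the nonunit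
      \<open>P / x j\<close>; hence the \<open>- 1\<close>.\<close>
    define n where "n = nat (k i - k j - 1)"
    have "P powi k i = P powi k j * P * P ^ n"
    proof -
      have "k i = k j + 1 + int n" using ij by (simp add: n_def)
      then show ?thesis using P(3) by (simp add: power_int_add)
    qed
    then have "(c i * x i) / (c j * x j) = (P / x j) * (P ^ n * (u i / u j) * x i)"
      using ku ij P(3) x0 by (simp add: field_simps)
    moreover have "P ^ n * (u i / u j) * x i \<in> V"
      using cl(5)[OF cl(5)[OF cl(7)[OF P(2)]
            unitsD(1)[OF V units_divide[OF V ku(1)[OF ij(1)] ku(1)[OF ij(2)]]]] x(1)[of i]] ij(1)
      by (simp add: I_def)
    moreover have "P / x j \<in> \<mm>" using x(3) ij(2) by (simp add: I_def)
    ultimately show ?thesis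
      using nonunits_mult[OF V] by metis
  qed
  have same: "(c i * x i) / (c j * x j) \<in> \<mm>" if ij: "i \<in> I" "j \<in> I" "k j = k i" "i < j" for i j
  proof -
    have "(c i * x i) / (c j * x j) = (x i / x j) * (u i / u j)"
      using ku ij P(3) x0 by (simp add: field_simps)
    moreover have "x i / x j \<in> \<mm>" using chain ij by (simp add: I_def)
    ultimately show ?thesis
      using nonunits_mult[OF V _ unitsD(1)[OF V units_divide[OF V ku(1)[OF ij(1)] ku(1)[OF ij(2)]]]]
      by metis
  qed
  have "(\<Sum>i\<in>I. c i * x i) \<noteq> 0"
  proof (rule sum_nonzero_of_distinct[OF V])
    show "finite I" "I \<noteq> {}" using c(2) by (auto simp: I_def)
    show "c i * x i \<noteq> 0" if "i \<in> I" for i using that x(2) by (auto simp: I_def)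
    show "c i * x i / (c j * x j) \<in> \<mm> \<or> c j * x j / (c i * x i) \<in> \<mm>"
      if "i \<in> I" "j \<in> I" "i \<noteq> j" for i j
      using bigger[of i j] bigger[of j i] same[of i j] same[of j i] that
      by (metis linorder_neqE_nat linorder_neqE)
  qed
  moreover have "(\<Sum>i\<in>I. c i * x i) = (\<Sum>i\<le>N. c i * x i)"
    by (rule sum.mono_neutral_left) (auto simp: I_def)
  ultimately show False using c(3) by simp
qed

text \<open>If no nonunit divided all the others, repeated choice starting from \<open>P\<close>
  would give proper divisors without end, against \<open>no_long_chain\<close>.\<close>

lemma exists_uniformizer: "\<exists>\<tau>\<in>\<mm>. \<tau> \<noteq> 0 \<and> (\<forall>f\<in>\<mm>. f / \<tau> \<in> V)"
proof (rule ccontr)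
  assume no: "\<not> ?thesis"
  have "\<forall>\<tau>. \<exists>f. \<tau> \<in> \<mm> \<and> \<tau> \<noteq> 0 \<longrightarrow> f \<in> \<mm> \<and> f \<noteq> 0 \<and> \<tau> / f \<in> \<mm>"
  proof
    fix \<tau>
    show "\<exists>f. \<tau> \<in> \<mm> \<and> \<tau> \<noteq> 0 \<longrightarrow> f \<in> \<mm> \<and> f \<noteq> 0 \<and> \<tau> / f \<in> \<mm>"
    proof (cases "\<tau> \<in> \<mm> \<and> \<tau> \<noteq> 0")
      case True
      then obtain f where f: "f \<in> \<mm>" "f / \<tau> \<notin> V" using no by blast
      then have "f \<noteq> 0" using cl(1) by auto
      moreover have "\<tau> / f \<in> \<mm>" using not_in_vring[OF V f(2)] by simp
      ultimately show ?thesis using f by blast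
    qed blast
  qed
  then obtain F where F: "\<And>\<tau>. \<tau> \<in> \<mm> \<Longrightarrow> \<tau> \<noteq> 0 \<Longrightarrow> F \<tau> \<in> \<mm> \<and> F \<tau> \<noteq> 0 \<and> \<tau> / F \<tau> \<in> \<mm>"
    by metis
  define x where "x = (\<lambda>n. (F ^^ n) P)"
  have x: "x n \<in> \<mm> \<and> x n \<noteq> 0" for n
    by (induction n) (use P F in \<open>auto simp: x_def\<close>)
  have step: "x n / x (Suc n) \<in> \<mm>" for n
    using F[of "x n"] x[of n] by (simp add: x_def)
  have chain: "x i / x (i + Suc d) \<in> \<mm>" for i d
  proof (induction d)
    case 0
    then show ?case using step by simp
  next
    case (Suc d)
    have "x i / x (i + Suc (Suc d)) = x i / x (i + Suc d) * (x (i + Suc d) / x (Suc (i + Suc d)))"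
      using x by simp
    then show ?case
      using nonunits_mult[OF V Suc.IH nonunitsD[OF V step]] by metis
  qed
  have chain': "x i / x j \<in> \<mm>" if "i < j" for i j
    using chain[of i "j - i - 1"] that by simp
  show False
  \<comment> \<open>The chain starts at index 1: \<open>x 0\<close> is \<open>P\<close> itself, and
    \<open>P / x 0\<close> is no nonunit.\<close>
  proof (rule no_long_chain[of "\<lambda>i. x (Suc i)"])
    show "x (Suc i) \<in> V" "x (Suc i) \<noteq> 0" for i using x nonunitsD[OF V] by auto
    show "P / x (Suc i) \<in> \<mm>" for i using chain'[of 0 "Suc i"] by (simp add: x_def)
    show "x (Suc i) / x (Suc j) \<in> \<mm>" if "i < j" for i j using chain' that by simp
  qed
qed

text \<open>Some power of \<open>\<tau>\<close> is a multiple of \<open>P\<close>, because its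
  powers form a chain of bounded length below \<open>P\<close>. As \<open>P^M / g\<close> lies in
  \<open>V\<close> for some \<open>M\<close>, divisibility of \<open>g\<close> by all powers of
  \<open>\<tau>\<close> would make \<open>\<tau>\<close> a unit.\<close>

lemma bounded_exponent:
  assumes \<tau>: "\<tau> \<in> \<mm>" "\<tau> \<noteq> 0" and g: "g \<noteq> 0"
  shows "\<exists>k. g / \<tau> ^ k \<notin> V"
proof (rule ccontr)
  assume "\<not> ?thesis"
  then have div: "g / \<tau> ^ k \<in> V" for k by blast
  have \<tau>k: "\<tau> ^ Suc k \<in> \<mm>" for k
    using nonunits_mult[OF V \<tau>(1) cl(7)[OF nonunitsD[OF V \<tau>(1)], of k]] by simp
  have e: "P / \<tau> ^ (N + 2) \<notin> V"
  proof
    assume a: "P / \<tau> ^ (N + 2) \<in> V"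
    show False
    \<comment> \<open>The \<open>N + 1\<close> powers from \<open>\<tau>^(N+1)\<close> down to
      \<open>\<tau>\<close>, listed so that each is a nonunit multiple of the next. The exponent
      \<open>N + 2\<close> leaves one factor to spare against the largest of them.\<close>
    proof (rule no_long_chain[of "\<lambda>i. \<tau> ^ Suc (N - i)"])
      fix i show "\<tau> ^ Suc (N - i) \<in> V" using \<tau>k nonunitsD[OF V] by blast
      show "\<tau> ^ Suc (N - i) \<noteq> 0" using \<tau> by simp
    next
      fix i assume i: "i \<le> N"
      then have "N + 2 = Suc (N - i) + Suc i" by simp
      then have "P / \<tau> ^ Suc (N - i) = \<tau> ^ Suc i * (P / \<tau> ^ (N + 2))"
        using \<tau> by (simp only: power_add) (simp add: field_simps)
      then show "P / \<tau> ^ Suc (N - i) \<in> \<mm>" using nonunits_mult[OF V \<tau>k a] by metis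
    next
      fix i j :: nat assume ij: "i < j" "j \<le> N"
      then have "Suc (N - i) = Suc (N - j) + Suc (j - i - 1)" by simp
      then have "\<tau> ^ Suc (N - i) / \<tau> ^ Suc (N - j) = \<tau> ^ Suc (j - i - 1)"
        using \<tau> by (simp only: power_add) simp
      then show "\<tau> ^ Suc (N - i) / \<tau> ^ Suc (N - j) \<in> \<mm>" using \<tau>k by metis
    qed
  qed
  define n where "n = N + 2"
  define c where "c = \<tau> ^ n / P"
  have "c \<in> V"
    using nonunitsD[OF V not_in_vring[OF V e]] by (simp add: c_def n_def)
  obtain M where M: "P ^ M * inverse g \<in> V" using bounded_denominator by blast
  \<comment> \<open>The exponent \<open>n * M + 1\<close> is chosen so that \<open>c^M\<close>
    cancels \<open>P^M\<close> and all but one factor \<open>\<tau>\<close>.\<close>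
  have "(P ^ M * inverse g) * (g / \<tau> ^ (n * M + 1)) * c ^ M \<in> V"
    by (rule cl(5)[OF cl(5)[OF M div] cl(7)[OF \<open>c \<in> V\<close>]])
  also have "(P ^ M * inverse g) * (g / \<tau> ^ (n * M + 1)) * c ^ M = inverse \<tau>"
    using g \<tau>(2) P(3) by (simp add: c_def power_divide power_add field_simps flip: power_mult)
  finally show False using \<tau> by (simp add: nonunits_def[OF V])
qed

lemma uniformizer_factorisation:
  assumes \<tau>: "\<tau> \<in> \<mm>" "\<tau> \<noteq> 0" "\<And>f. f \<in> \<mm> \<Longrightarrow> f / \<tau> \<in> V" and g: "g \<noteq> 0"
  shows "\<exists>k::int. \<exists>u\<in>\<uu>. g = \<tau> powi k * u \<and> (g \<in> V \<longleftrightarrow> k \<ge> 0)"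
proof -
  have main: "\<exists>k::nat. \<exists>u\<in>\<uu>. g = \<tau> ^ k * u" if g: "g \<in> V" "g \<noteq> 0" for g
  proof -
    define k where "k = (LEAST k. g / \<tau> ^ k \<notin> V)"
    have k: "g / \<tau> ^ k \<notin> V"
      unfolding k_def by (rule LeastI_ex[OF bounded_exponent[OF \<tau>(1,2) g(2)]])
    have "k \<noteq> 0" using k g by (intro notI) simp
    then obtain n where n: "k = Suc n" using not0_implies_Suc by blast
    then have gn: "g / \<tau> ^ n \<in> V"
      using not_less_Least[of n "\<lambda>k. g / \<tau> ^ k \<notin> V"] by (auto simp: k_def)
    have "g / \<tau> ^ n \<notin> \<mm>"
      using \<tau>(3)[of "g / \<tau> ^ n"] k n by (auto simp: mult.commute)
    then have "g / \<tau> ^ n \<in> \<uu>" using vring_dichotomy[OF V gn] by blast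
    moreover have "g = \<tau> ^ n * (g / \<tau> ^ n)" using \<tau>(2) by simp
    ultimately show ?thesis by blast
  qed
  show ?thesis
  proof (cases "g \<in> V")
    case True
    from main[OF True g] obtain k u where "u \<in> \<uu>" "g = \<tau> ^ k * u" by blast
    then show ?thesis using True by (intro exI[of _ "int k"] bexI[of _ u]) auto
  next
    case False
    have ig: "inverse g \<in> \<mm>" by (rule not_in_vring[OF V False])
    from main[OF nonunitsD[OF V ig]] g obtain k u where ku: "u \<in> \<uu>" "inverse g = \<tau> ^ k * u" by auto
    have "k \<noteq> 0" using ku ig units_not_nonunits[OF V] by (intro notI) auto
    moreover have "g = \<tau> powi (- int k) * inverse u"
      using arg_cong[OF ku(2), of inverse] by (simp add: power_int_minus)
    ultimately show ?thesis using False units_inverse[OF V ku(1)]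
      by (intro exI[of _ "- int k"] bexI[of _ "inverse u"]) auto
  qed
qed

text \<open>The value is the exponent of the uniformizer. The axioms follow from its uniqueness,
  which holds because no nonzero power of \<open>\<tau>\<close> is a unit.\<close>

theorem exists_place: "\<exists>w. place_val K w \<and> (\<forall>f. f \<noteq> 0 \<longrightarrow> (w f \<ge> 0 \<longleftrightarrow> f \<in> V))"
proof -
  obtain \<tau> where \<tau>: "\<tau> \<in> \<mm>" "\<tau> \<noteq> 0" "\<And>f. f \<in> \<mm> \<Longrightarrow> f / \<tau> \<in> V"
    using exists_uniformizer by blast
  have "\<forall>g. \<exists>k::int. g \<noteq> 0 \<longrightarrow> (\<exists>u\<in>\<uu>. g = \<tau> powi k * u) \<and> (g \<in> V \<longleftrightarrow> k \<ge> 0)"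
    using uniformizer_factorisation[OF \<tau>] by blast
  then obtain w where w: "\<And>g. g \<noteq> 0 \<Longrightarrow> \<exists>u\<in>\<uu>. g = \<tau> powi w g * u"
    "\<And>g. g \<noteq> 0 \<Longrightarrow> (g \<in> V \<longleftrightarrow> w g \<ge> 0)" by metis
  have powi_unit: "k = 0" if "\<tau> powi k \<in> \<uu>" for k :: int
  proof -
    have neg: "\<not> k > 0" if "\<tau> powi k \<in> \<uu>" for k :: int
    proof
      assume k: "k > 0"
      then have "k = 1 + int (nat (k - 1))" by simp
      then have "\<tau> powi k = \<tau> * \<tau> ^ nat (k - 1)"
        using \<tau>(2) by (metis power_int_add power_int_1_right power_int_of_nat)
      moreover have "\<tau> * \<tau> ^ nat (k - 1) \<in> \<mm>"
        using nonunitsD[OF V \<tau>(1)] by (intro nonunits_mult[OF V \<tau>(1)] cl)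
      ultimately show False using that units_not_nonunits[OF V] by metis
    qed
    have "\<tau> powi (- k) \<in> \<uu>"
      using units_inverse[OF V that] by (simp add: power_int_minus)
    then show ?thesis using neg[OF that] neg[of "- k"] by simp
  qed
  have unique: "w g = k" if "g = \<tau> powi k * u" "u \<in> \<uu>" for g k u
  proof -
    have "g \<noteq> 0" using that \<tau>(2) unitsD(2)[OF V] by auto
    then obtain u' where u': "u' \<in> \<uu>" "g = \<tau> powi w g * u'" using w by blast
    have "\<tau> powi (w g - k) = u / u'"
      using that(1) u'(2) unitsD(2)[OF V u'(1)] \<tau>(2) by (simp add: power_int_diff field_simps)
    then have "\<tau> powi (w g - k) \<in> \<uu>"
      using units_divide[OF V that(2) u'(1)] by simp
    then show ?thesis using powi_unit[of "w g - k"] by simp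
  qed
  have "place_val K w"
    unfolding place_val_def
  proof (intro conjI allI impI ballI)
    fix a b :: 'a assume ab: "a \<noteq> 0 \<and> b \<noteq> 0"
    obtain u where u: "u \<in> \<uu>" "a = \<tau> powi w a * u" using w ab by blast
    obtain u' where u': "u' \<in> \<uu>" "b = \<tau> powi w b * u'" using w ab by blast
    have "a * b = \<tau> powi (w a + w b) * (u * u')"
      using arg_cong2[OF u(2) u'(2), of "(*)"] \<tau>(2) by (simp add: power_int_add mult_ac)
    then show "w (a * b) = w a + w b"
      using unique units_mult[OF V u(1) u'(1)] by blast
  next
    fix a b :: 'a assume ab: "a \<noteq> 0 \<and> b \<noteq> 0 \<and> a + b \<noteq> 0"
    have main: "min (w a) (w b) \<le> w (a + b)"
      if ab: "a \<noteq> 0" "b \<noteq> 0" "a + b \<noteq> 0" and le: "w a \<le> w b" for a b :: 'a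
    proof -
      obtain u where u: "u \<in> \<uu>" "a = \<tau> powi w a * u" using w ab by blast
      obtain u' where u': "u' \<in> \<uu>" "b = \<tau> powi w b * u'" using w ab by blast
      define h where "h = u + \<tau> ^ nat (w b - w a) * u'"
      have "w b = w a + int (nat (w b - w a))" using le by simp
      then have "\<tau> powi w b = \<tau> powi w a * \<tau> ^ nat (w b - w a)"
        using \<tau>(2) by (metis power_int_add power_int_of_nat)
      then have ah: "a + b = \<tau> powi w a * h"
        using arg_cong2[OF u(2) u'(2), of "(+)"] by (simp add: h_def algebra_simps)
      have hV: "h \<in> V"
        unfolding h_def using u(1) u'(1) unitsD(1)[OF V] nonunitsD[OF V \<tau>(1)] by (intro cl)
      have h0: "h \<noteq> 0" using ah ab(3) by auto
      obtain u'' where u'': "u'' \<in> \<uu>" "h = \<tau> powi w h * u''" using w(1)[OF h0] by blast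
      have "\<tau> powi w a * h = \<tau> powi (w a + w h) * u''"
        using arg_cong[OF u''(2), of "(*) (\<tau> powi w a)"] \<tau>(2) by (simp add: power_int_add)
      then have "w (a + b) = w a + w h" unfolding ah by (rule unique) (rule u''(1))
      moreover have "w h \<ge> 0" using w(2)[OF h0] hV by simp
      ultimately show ?thesis by simp
    qed
    show "min (w a) (w b) \<le> w (a + b)"
    proof (cases "w a \<le> w b")
      case True
      then show ?thesis using main[of a b] ab by blast
    next
      case False
      then show ?thesis using main[of b a] ab by (simp add: add.commute min.commute)
    qed
  next
    fix c assume "c \<in> K" "c \<noteq> 0"
    then have "c \<in> \<uu>"
      using KV subfield_inverse[OF K] by (auto simp: units_def[OF V])
    then show "w c = 0" using unique[of c 0 c] by simp
  next
    have "w \<tau> = 1" using unique[of \<tau> 1 1] one_unit[OF V] by simp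
    then show "\<exists>t. t \<noteq> 0 \<and> w t = 1" using \<tau>(2) by blast
  qed
  then show ?thesis using w(2) by blast
qed

end

section \<open>Calculus of values and residues at a place\<close>

text \<open>Encodes the convention that 0 has infinite value, since a place says nothing about its
  value at 0.\<close>

definition vge :: "('a::field \<Rightarrow> int) \<Rightarrow> int \<Rightarrow> 'a \<Rightarrow> bool" where
  "vge w k f \<longleftrightarrow> f = 0 \<or> k \<le> w f"

lemma vge_0 [simp]: "vge w k 0"
  by (simp add: vge_def)

lemma vge_mono: "vge w k f \<Longrightarrow> l \<le> k \<Longrightarrow> vge w l f"
  by (auto simp: vge_def)

lemma vgeD: "vge w k f \<Longrightarrow> f \<noteq> 0 \<Longrightarrow> k \<le> w f"
  by (simp add: vge_def)

text \<open>Reduction modulo the place, restricted to residues in \<open>K\<close>; this suffices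
  because the point is rational over \<open>K\<close>.\<close>

definition res :: "'a::field set \<Rightarrow> ('a \<Rightarrow> int) \<Rightarrow> 'a \<Rightarrow> 'a \<Rightarrow> bool" where
  "res K w f c \<longleftrightarrow> c \<in> K \<and> vge w 1 (f - c)"

context
  fixes K :: "'a::field set" and w :: "'a \<Rightarrow> int"
  assumes K: "is_subfield K" and w: "place_val K w"
begin

lemma place_mult: "f \<noteq> 0 \<Longrightarrow> g \<noteq> 0 \<Longrightarrow> w (f * g) = w f + w g"
  and place_add: "f \<noteq> 0 \<Longrightarrow> g \<noteq> 0 \<Longrightarrow> f + g \<noteq> 0 \<Longrightarrow> min (w f) (w g) \<le> w (f + g)"
  and place_const: "c \<in> K \<Longrightarrow> c \<noteq> 0 \<Longrightarrow> w c = 0"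
  using w by (auto simp: place_val_def)

lemma place_1 [simp]: "w 1 = 0"
  using place_mult[of 1 1] by simp

lemma place_uminus: "w (- f) = w f"
proof (cases "f = 0")
  case False
  have "- 1 \<in> K" using K by (metis subfield_subring subring_1 subring_uminus)
  then show ?thesis using place_mult[of "- 1" f] place_const[of "- 1"] False by simp
qed simp

lemma place_inverse: "f \<noteq> 0 \<Longrightarrow> w (inverse f) = - w f"
  using place_mult[of f "inverse f"] by simp

lemma place_divide: "f \<noteq> 0 \<Longrightarrow> g \<noteq> 0 \<Longrightarrow> w (f / g) = w f - w g"
  by (simp add: divide_inverse place_mult place_inverse)

lemma place_power: "f \<noteq> 0 \<Longrightarrow> w (f ^ n) = int n * w f"
  by (induction n) (auto simp: place_mult algebra_simps)

lemma vge_add: "vge w k f \<Longrightarrow> vge w k g \<Longrightarrow> vge w k (f + g)"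
  using place_add[of f g] unfolding vge_def
  by (metis add.left_neutral add.right_neutral min.boundedI order.trans)

lemma vge_uminus: "vge w k f \<Longrightarrow> vge w k (- f)"
  by (simp add: vge_def place_uminus)

lemma vge_diff: "vge w k f \<Longrightarrow> vge w k g \<Longrightarrow> vge w k (f - g)"
  using vge_add[of k f "- g"] vge_uminus by simp

lemma vge_mult: "vge w k f \<Longrightarrow> vge w l g \<Longrightarrow> vge w (k + l) (f * g)"
  by (cases "f = 0"; cases "g = 0") (auto simp: vge_def place_mult)

lemma vge_mult_0: "vge w k f \<Longrightarrow> vge w 0 g \<Longrightarrow> vge w k (f * g)"
  using vge_mult[of k f 0 g] by simp

lemma vge_mult_0': "vge w 0 f \<Longrightarrow> vge w k g \<Longrightarrow> vge w k (f * g)"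
  using vge_mult[of 0 f k g] by simp

lemma vge_const: "c \<in> K \<Longrightarrow> vge w 0 c"
  using place_const[of c] unfolding vge_def by (metis order.refl)

lemma vge_power: "vge w k f \<Longrightarrow> vge w (int n * k) (f ^ n)"
  by (cases "f = 0"; cases "n = 0") (auto simp: vge_def place_power mult_left_mono)

lemma vge_power_0: "vge w 0 f \<Longrightarrow> vge w 0 (f ^ n)"
  using vge_power[of 0 f n] by simp

lemma vge_sum: "(\<And>i. i \<in> I \<Longrightarrow> vge w k (f i)) \<Longrightarrow> vge w k (sum f I)"
  by (induction I rule: infinite_finite_induct) (auto intro: vge_add)

lemma vge_unit_inverse: "f \<noteq> 0 \<Longrightarrow> w f = 0 \<Longrightarrow> vge w 0 (inverse f)"
  by (simp add: vge_def place_inverse)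

lemma vge_poly: "p \<in> polys_over K \<Longrightarrow> vge w 0 s \<Longrightarrow> vge w 0 (poly p s)"
  unfolding poly_altdef
  by (rule vge_sum, rule vge_mult_0)
    (auto intro: vge_power_0 vge_const polys_over_coeff[OF subfield_subring[OF K]])

lemma place_dominant:
  assumes f: "f \<noteq> 0" and g: "vge w (w f + 1) g"
  shows "f + g \<noteq> 0" "w (f + g) = w f"
proof -
  show nz: "f + g \<noteq> 0"
  proof
    assume "f + g = 0"
    then have "g = - f" by (simp add: eq_neg_iff_add_eq_0 add.commute)
    then show False using f g by (simp add: vge_def place_uminus)
  qed
  show "w (f + g) = w f"
  proof (cases "g = 0")
    case False
    then have "w f < w g" using g by (simp add: vge_def)
    moreover have "min (w f) (w g) \<le> w (f + g)" using place_add f False nz by blast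
    moreover have "min (w (f + g)) (w (- g)) \<le> w f"
      using place_add[of "f + g" "- g"] nz False f by simp
    ultimately show ?thesis by (simp add: place_uminus)
  qed simp
qed

lemma res_vge: "res K w f c \<Longrightarrow> vge w 0 f"
  using vge_add[of 0 "f - c" c] vge_const[of c] vge_mono[of w 1 "f - c" 0] by (simp add: res_def)

lemma res_const: "c \<in> K \<Longrightarrow> res K w c c"
  by (simp add: res_def)

lemma res_add: "res K w f c \<Longrightarrow> res K w g d \<Longrightarrow> res K w (f + g) (c + d)"
  using vge_add[of 1 "f - c" "g - d"] subring_add[OF subfield_subring[OF K]]
  by (simp add: res_def algebra_simps)

lemma res_diff: "res K w f c \<Longrightarrow> res K w g d \<Longrightarrow> res K w (f - g) (c - d)"
  using vge_diff[of 1 "f - c" "g - d"] subring_diff[OF subfield_subring[OF K]]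
  by (simp add: res_def algebra_simps)

lemma res_uminus: "res K w f c \<Longrightarrow> res K w (- f) (- c)"
  using vge_uminus[of 1 "f - c"] subring_uminus[OF subfield_subring[OF K]]
  by (simp add: res_def algebra_simps)

lemma res_mult: assumes "res K w f c" "res K w g d" shows "res K w (f * g) (c * d)"
proof -
  have "vge w 1 ((f - c) * g)" "vge w 1 (c * (g - d))"
    using assms res_vge by (auto simp: res_def intro: vge_mult_0 vge_mult_0' vge_const)
  from vge_add[OF this] show ?thesis
    using assms subring_mult[OF subfield_subring[OF K]] by (simp add: res_def algebra_simps)
qed

lemma res_power: "res K w f c \<Longrightarrow> res K w (f ^ n) (c ^ n)"
  by (induction n) (auto intro: res_mult res_const subring_1[OF subfield_subring[OF K]])

lemma res_sum: "(\<And>i. i \<in> I \<Longrightarrow> res K w (f i) (c i)) \<Longrightarrow> res K w (sum f I) (sum c I)"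
  by (induction I rule: infinite_finite_induct)
    (auto intro: res_add res_const subring_0[OF subfield_subring[OF K]])

lemma res_numeral: "res K w (numeral n) (numeral n)"
  by (rule res_const[OF subring_numeral[OF subfield_subring[OF K]]])

lemma res_1: "res K w 1 1"
  by (rule res_const[OF subring_1[OF subfield_subring[OF K]]])

lemma res_unit: assumes "res K w f c" "c \<noteq> 0" shows "f \<noteq> 0" "w f = 0"
proof -
  have c: "w c = 0" "vge w (w c + 1) (f - c)"
    using assms place_const by (auto simp: res_def)
  show "f \<noteq> 0" "w f = 0"
    using place_dominant[OF assms(2) c(2)] c(1) by auto
qed

lemma res_inverse: assumes "res K w f c" "c \<noteq> 0" shows "res K w (inverse f) (inverse c)"
proof -
  note u = res_unit[OF assms]
  have c: "c \<in> K" "inverse c \<in> K" using assms subfield_inverse[OF K] by (auto simp: res_def)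
  have "vge w 1 ((f - c) * (inverse f * - inverse c))"
  proof (rule vge_mult_0)
    show "vge w 1 (f - c)" using assms by (simp add: res_def)
    show "vge w 0 (inverse f * - inverse c)"
      using u c by (intro vge_mult_0 vge_unit_inverse vge_uminus vge_const)
  qed
  also have "(f - c) * (inverse f * - inverse c) = inverse f - inverse c"
    using u assms by (simp add: field_simps)
  finally show ?thesis using c by (simp add: res_def)
qed

lemma res_divide: "res K w f c \<Longrightarrow> res K w g d \<Longrightarrow> d \<noteq> 0 \<Longrightarrow> res K w (f / g) (c / d)"
  by (simp add: divide_inverse res_mult res_inverse)

lemma res_unique: assumes "res K w f c" "res K w f d" shows "c = d"
proof -
  have "vge w 1 (c - d)" "c - d \<in> K"
    using vge_diff[of 1 "f - d" "f - c"] assms subring_diff[OF subfield_subring[OF K]]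
    by (auto simp: res_def)
  then show ?thesis using place_const[of "c - d"] by (cases "c = d") (auto simp: vge_def)
qed

lemma res_0_iff: "res K w f 0 \<longleftrightarrow> vge w 1 f"
  by (simp add: res_def subring_0[OF subfield_subring[OF K]])

end

section \<open>Places above polynomials, and rational functions regular outside the poles of
  \<open>s\<close>\<close>

context function_field
begin

text \<open>By degrees \<open>1/p(s)\<close> is not in \<open>K[s]\<close>, so some valuation ring
  contains \<open>K[s]\<close> but not \<open>1/p(s)\<close>; its place is positive at
  \<open>p(s)\<close>.\<close>

lemma exists_place_over:
  assumes p: "p \<in> polys_over K" "degree p > 0"
  shows "\<exists>w. place_val K w \<and> w s \<ge> 0 \<and> w (poly p s) > 0"
proof -
  let ?t = "poly p s"
  have "p \<noteq> 0" using p(2) by auto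
  then have t0: "?t \<noteq> 0" by (rule poly_nonzero[OF p(1)])
  have "inverse ?t \<notin> adjoin K s"
  proof
    assume "inverse ?t \<in> adjoin K s"
    then obtain r where r: "r \<in> polys_over K" "inverse ?t = poly r s"
      unfolding adjoin_def[OF K_ring] by blast
    have "poly (p * r) s = poly 1 s" using r(2) t0 by (simp flip: r(2))
    then have "p * r = 1"
      by (intro poly_inj polys_over_mult[OF K_ring] polys_over_1[OF K_ring] p r)
    then have "degree (p * r) = 0" "r \<noteq> 0" by auto
    then show False using p(2) \<open>p \<noteq> 0\<close> by (simp add: degree_mult_eq)
  qed
  moreover have "?t \<in> adjoin K s" using p by (auto simp: adjoin_def[OF K_ring])
  ultimately obtain V where VO: "valuation_ring V" "adjoin K s \<subseteq> V" "inverse ?t \<notin> V"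
    using exists_valuation_ring[OF adjoin_subring[OF K_ring] _ t0] by blast
  interpret function_field_vring K s e N V
    using VO adjoin_superset[OF K_ring] adjoin_self[OF K_ring]
    by unfold_locales auto
  obtain w where w: "place_val K w" "\<And>f. f \<noteq> 0 \<Longrightarrow> (w f \<ge> 0 \<longleftrightarrow> f \<in> V)"
    using exists_place by blast
  have "w s \<ge> 0" using w(2)[OF s_nonzero] sV by simp
  moreover have "w ?t > 0"
    using w(2)[of "inverse ?t"] VO(3) t0 place_inverse[OF K w(1) t0] by simp
  ultimately show ?thesis using w(1) by blast
qed

text \<open>The hypotheses are symmetric in \<open>s\<close> and \<open>1/s\<close>, so a pole of
  \<open>s\<close> is obtained as a place above the polynomial \<open>1/s\<close>.\<close>

lemma inverse_function_field: "function_field K (inverse s) e N"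
proof
  show "transcendental_over K (inverse s)"
    unfolding transcendental_over_def
  proof (intro allI impI notI)
    fix p assume p: "p \<noteq> 0 \<and> (\<forall>i. coeff p i \<in> K)" "poly p (inverse s) = 0"
    have "reflect_poly p \<in> polys_over K"
      using p subring_0[OF K_ring] by (auto simp: polys_over_def coeff_reflect_poly)
    moreover have "poly (reflect_poly p) s = 0"
      using p s_nonzero by (simp add: poly_reflect_poly_nz)
    ultimately show False using poly_nonzero p by auto
  qed
  show "f \<in> span_upto (ratfun K (inverse s)) e N" for f
    using span by (simp add: ratfun_inverse[OF K])
qed (rule K)

lemma exists_place_infinity: "\<exists>w. place_val K w \<and> w s < 0"
proof -
  interpret inv: function_field K "inverse s" e N by (rule inverse_function_field)
  have "[:0, 1:] \<in> polys_over K"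
    by (intro polys_over_closed[OF K_ring] subring_closed[OF K_ring])
  from inv.exists_place_over[OF this] obtain w where "place_val K w" "w (inverse s) > 0" by auto
  then show ?thesis using place_inverse[OF K _ s_nonzero] by fastforce
qed

lemma place_pole:
  assumes w: "place_val K w" "w s < 0" and p: "p \<in> polys_over K" "p \<noteq> 0"
  shows "w (poly p s) = int (degree p) * w s"
  using p
proof (induction p rule: pCons_induct)
  case 0
  then show ?case by simp
next
  case (pCons a p)
  have a: "a \<in> K" and p: "p \<in> polys_over K"
    using polys_over_coeff[OF K_ring pCons.prems(1), of 0]
      polys_over_coeff[OF K_ring pCons.prems(1), of "Suc i" for i] by (auto simp: polys_over_def)
  show ?case
  proof (cases "p = 0")
    case True
    then show ?thesis using place_const[OF K w(1) a] pCons by auto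
  next
    case False
    have nz: "s * poly p s \<noteq> 0" using poly_nonzero[OF p False] s_nonzero by simp
    have v: "w (s * poly p s) = int (Suc (degree p)) * w s"
      using place_mult[OF K w(1) s_nonzero poly_nonzero[OF p False]] pCons.IH[OF p False]
      by (simp add: algebra_simps)
    have "vge w (w (s * poly p s) + 1) a"
      using vge_const[OF K w(1) a] by (rule vge_mono) (use v w(2) mult_pos_neg[of "int (Suc (degree p))" "w s"] in simp)
    then have "w (s * poly p s + a) = w (s * poly p s)"
      by (rule place_dominant(2)[OF K w(1) nz])
    then show ?thesis using v False by (simp add: add.commute)
  qed
qed

text \<open>The prime \<open>\<pi>\<close> of \<open>K[s]\<close> below \<open>w\<close> divides
  \<open>B\<close> exactly once, as a double factor would divide the derivative. So
  \<open>w(B)\<close> is the ramification index \<open>w(\<pi>)\<close>, which divides all values on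
  \<open>K(s)\<close>.\<close>

lemma place_ratfun_dvd:
  assumes w: "place_val K w" "w s \<ge> 0" and B: "B \<in> polys_over K" "B \<noteq> 0" "w (poly B s) > 0"
    and B': "poly (pderiv B) s \<noteq> 0" "w (poly (pderiv B) s) = 0"
    and f: "f \<in> ratfun K s" "f \<noteq> 0"
  shows "w (poly B s) dvd w f"
proof -
  note pm = place_mult[OF K w(1)]
  have s0: "vge w 0 s" using w by (simp add: vge_def)
  have vp: "vge w 0 (poly p s)" if "p \<in> polys_over K" for p
    by (rule vge_poly[OF K w(1) that s0])
  define S where "S = {p. p \<in> polys_over K \<and> p \<noteq> 0 \<and> w (poly p s) > 0}"
  have "B \<in> S" using B by (simp add: S_def)
  then obtain \<pi> where \<pi>: "\<pi> \<in> S" "\<And>p. p \<in> S \<Longrightarrow> degree \<pi> \<le> degree p"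
    using ex_has_least_nat[of "\<lambda>p. p \<in> S" B degree] by blast
  let ?P = "poly \<pi> s"
  have \<pi>K: "\<pi> \<in> polys_over K" "\<pi> \<noteq> 0" "w ?P > 0" using \<pi> by (auto simp: S_def)
  have P0: "?P \<noteq> 0" by (rule poly_nonzero[OF \<pi>K(1,2)])
  have factor: "\<exists>g\<in>polys_over K. p = g * \<pi>" if p: "p \<in> S" for p
  proof -
    have pK: "p \<in> polys_over K" "p \<noteq> 0" "w (poly p s) > 0" using p by (auto simp: S_def)
    obtain g r where gr: "g \<in> polys_over K" "r \<in> polys_over K" "p = g * \<pi> + r"
      "r = 0 \<or> degree r < degree \<pi>"
      using polys_over_division[OF K \<pi>K(1,2) pK(1)] by blast
    have "r = 0"
    proof (rule ccontr)
      assume r: "r \<noteq> 0"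
      have "vge w 1 (poly p s)" using pK by (simp add: vge_def)
      moreover have "vge w 1 (poly g s * ?P)"
        using \<pi>K(3) by (intro vge_mult_0'[OF K w(1) vp[OF gr(1)]]) (simp add: vge_def)
      ultimately have "vge w 1 (poly p s - poly g s * ?P)" by (rule vge_diff[OF K w(1)])
      then have "w (poly r s) > 0" using gr(3) poly_nonzero[OF gr(2) r] by (simp add: vge_def)
      then have "r \<in> S" using gr(2) r by (simp add: S_def)
      then show False using \<pi>(2) gr(4) r by fastforce
    qed
    then show ?thesis using gr by auto
  qed
  obtain g where g: "g \<in> polys_over K" "B = g * \<pi>" using factor[OF \<open>B \<in> S\<close>] by blast
  have g0: "g \<noteq> 0" using g B by auto
  have "w (poly g s) = 0"
  proof (rule ccontr)
    assume "w (poly g s) \<noteq> 0"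
    then have "w (poly g s) > 0"
      using vp[OF g(1)] poly_nonzero[OF g(1) g0] by (simp add: vge_def)
    then obtain h where h: "h \<in> polys_over K" "g = h * \<pi>"
      using factor[of g] g g0 by (auto simp: S_def)
    \<comment> \<open>Here \<open>B = h * \<pi>^2\<close>, so a factor \<open>\<pi>\<close> survives
      in the derivative.\<close>
    have "pderiv B = \<pi> * (\<pi> * pderiv h + 2 * h * pderiv \<pi>)"
      unfolding g(2) h(2) by (simp add: pderiv_mult algebra_simps)
    then have "poly (pderiv B) s = ?P * (?P * poly (pderiv h) s + 2 * poly h s * poly (pderiv \<pi>) s)"
      by simp
    moreover have "vge w 1 (?P * (?P * poly (pderiv h) s + 2 * poly h s * poly (pderiv \<pi>) s))"
    proof -
      note m0 = vge_mult_0[OF K w(1)]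
      have "vge w 1 ?P" using \<pi>K(3) by (simp add: vge_def)
      moreover have "vge w 0 (2 :: 'a)"
        by (rule vge_const[OF K w(1) subring_numeral[OF K_ring]])
      ultimately show ?thesis
        using m0 vge_add[OF K w(1)] vp[OF \<pi>K(1)] vp[OF h(1)]
          vp[OF polys_over_pderiv[OF K_ring h(1)]] vp[OF polys_over_pderiv[OF K_ring \<pi>K(1)]]
        by metis
    qed
    ultimately show False using B' by (simp add: vge_def)
  qed
  then have wB: "w (poly B s) = w ?P"
    using g pm[OF poly_nonzero[OF g(1) g0] P0] by simp
  have dvd: "w ?P dvd w (poly p s)" if "p \<in> polys_over K" "p \<noteq> 0" for p
    using that
  proof (induction "degree p" arbitrary: p rule: less_induct)
    case (less p)
    show ?case
    proof (cases "p \<in> S")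
      case False
      then have "w (poly p s) = 0"
        using less.prems vp[OF less.prems(1)] poly_nonzero by (auto simp: S_def vge_def)
      then show ?thesis by simp
    next
      case True
      then obtain h where h: "h \<in> polys_over K" "p = h * \<pi>" using factor by blast
      have h0: "h \<noteq> 0" using h less.prems by auto
      have "degree \<pi> > 0"
      proof (rule ccontr)
        assume "\<not> degree \<pi> > 0"
        then have "degree \<pi> = 0" by simp
        then obtain c where c: "\<pi> = [:c:]" by (rule degree_eq_zeroE)
        then have "c \<in> K" using polys_over_coeff[OF K_ring \<pi>K(1), of 0] by simp
        then show False using \<pi>K c place_const[OF K w(1), of c] by auto
      qed
      then have "degree h < degree p" using h h0 \<pi>K by (simp add: degree_mult_eq)
      then show ?thesis
        using less.hyps[OF _ h(1) h0] pm[OF poly_nonzero[OF h(1) h0] P0] h by simp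
    qed
  qed
  obtain p r where pr: "p \<in> polys_over K" "r \<in> polys_over K" "p \<noteq> 0" "r \<noteq> 0" "f = poly p s / poly r s"
    using ratfun_cases[OF f] by metis
  then show ?thesis
    using dvd poly_nonzero by (simp add: wB place_divide[OF K w(1)])
qed

text \<open>Take a denominator \<open>B\<close> of least degree. At a place above a nonconstant
  \<open>B\<close> regularity forces the numerator \<open>A\<close> to vanish too, while
  \<open>A\<close> and \<open>B\<close> are coprime by minimality: a Bezout identity contradicts
  this.\<close>

lemma regular_ratfun:
  assumes f: "f \<in> ratfun K s" and reg: "\<And>w. place_val K w \<Longrightarrow> w s \<ge> 0 \<Longrightarrow> vge w 0 f"
  shows "\<exists>p\<in>polys_over K. f = poly p s"
proof (cases "f = 0")
  case True
  then show ?thesis using polys_over_0[OF K_ring] by force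
next
  case False
  define S where "S = {r. r \<in> polys_over K \<and> r \<noteq> 0 \<and> (\<exists>p\<in>polys_over K. poly r s * f = poly p s)}"
  obtain p r where "p \<in> polys_over K" "r \<in> polys_over K" "p \<noteq> 0" "r \<noteq> 0" "f = poly p s / poly r s"
    using ratfun_cases[OF f False] by metis
  then have "r \<in> S" using poly_nonzero by (auto simp: S_def)
  then obtain B where B: "B \<in> S" "\<And>r. r \<in> S \<Longrightarrow> degree B \<le> degree r"
    using ex_has_least_nat[of "\<lambda>p. p \<in> S" r degree] by blast
  then obtain A where A: "A \<in> polys_over K" "poly B s * f = poly A s" by (auto simp: S_def)
  have BK: "B \<in> polys_over K" "B \<noteq> 0" using B by (auto simp: S_def)
  have B0: "poly B s \<noteq> 0" by (rule poly_nonzero[OF BK])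
  have A0: "poly A s \<noteq> 0" using A B0 False by auto
  have "degree B = 0"
  proof (rule ccontr)
    assume "degree B \<noteq> 0"
    then obtain w where w: "place_val K w" "w s \<ge> 0" "w (poly B s) > 0"
      using exists_place_over[OF BK(1)] by auto
    have wA: "w (poly A s) > 0"
      using reg[OF w(1,2)] w(3) place_mult[OF K w(1) B0 False] A(2) False by (simp add: vge_def)
    have s0: "vge w 0 s" using w by (simp add: vge_def)
    \<comment> \<open>The ideal generated by \<open>A\<close> and \<open>B\<close>; its member
      \<open>D\<close> of least degree serves as the gcd and comes with Bezout coefficients.\<close>
    define J where "J = {U * A + W * B | U W. U \<in> polys_over K \<and> W \<in> polys_over K}"
    have J: "U * A + W * B \<in> J" if "U \<in> polys_over K" "W \<in> polys_over K" for U W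
      using that by (auto simp: J_def)
    have JK: "D \<in> polys_over K" if "D \<in> J" for D
      using that A BK by (auto simp: J_def intro!: polys_over_closed[OF K_ring])
    have "A \<in> J" "B \<in> J"
      using J[OF polys_over_1[OF K_ring] polys_over_0[OF K_ring]]
        J[OF polys_over_0[OF K_ring] polys_over_1[OF K_ring]] by auto
    obtain D where D: "D \<in> J" "D \<noteq> 0" "\<And>E. E \<in> J \<Longrightarrow> E \<noteq> 0 \<Longrightarrow> degree D \<le> degree E"
      using ex_has_least_nat[of "\<lambda>D. D \<in> J \<and> D \<noteq> 0" B degree] \<open>B \<in> J\<close> BK(2) by blast
    obtain U W where UW: "U \<in> polys_over K" "W \<in> polys_over K" "D = U * A + W * B"
      using D(1) by (auto simp: J_def)
    have factor: "\<exists>g\<in>polys_over K. E = g * D" if E: "E \<in> J" for E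
    proof -
      obtain g r where gr: "g \<in> polys_over K" "r \<in> polys_over K" "E = g * D + r"
        "r = 0 \<or> degree r < degree D"
        using polys_over_division[OF K JK[OF D(1)] D(2) JK[OF E]] by blast
      obtain U' W' where E': "U' \<in> polys_over K" "W' \<in> polys_over K" "E = U' * A + W' * B"
        using E by (auto simp: J_def)
      have "r = (U' - g * U) * A + (W' - g * W) * B"
        using gr(3) E'(3) UW(3) by (simp add: algebra_simps)
      moreover have "U' - g * U \<in> polys_over K" "W' - g * W \<in> polys_over K"
        using E' UW gr by (auto intro!: polys_over_closed[OF K_ring])
      ultimately have "r \<in> J" using J by blast
      then have "r = 0" using D(3)[of r] gr(4) by fastforce
      then show ?thesis using gr by auto
    qed
    obtain A' where A': "A' \<in> polys_over K" "A = A' * D" using factor[OF \<open>A \<in> J\<close>] by blast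
    obtain B' where B': "B' \<in> polys_over K" "B = B' * D" using factor[OF \<open>B \<in> J\<close>] by blast
    have "poly B' s * f = poly A' s"
      using A(2) A' B' poly_nonzero[OF JK[OF D(1)] D(2)] by simp
    then have "B' \<in> S" using A' B' BK by (auto simp: S_def)
    \<comment> \<open>Cancelling \<open>D\<close> gives the denominator \<open>B'\<close>, which
      cannot have smaller degree than \<open>B\<close>.\<close>
    then have "degree D = 0"
      using B(2)[of B'] B' BK(2) D(2) by (auto simp: degree_mult_eq)
    then obtain c where c: "D = [:c:]" by (rule degree_eq_zeroE)
    then have cK: "c \<in> K" "c \<noteq> 0" using polys_over_coeff[OF K_ring JK[OF D(1)], of 0] D(2) by auto
    have "vge w 1 (poly U s * poly A s + poly W s * poly B s)"
      using vge_poly[OF K w(1) _ s0] UW wA w(3)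
      by (intro vge_add[OF K w(1)] vge_mult_0'[OF K w(1)]) (auto simp: vge_def)
    moreover have "poly U s * poly A s + poly W s * poly B s = c"
      using arg_cong[OF UW(3), of "\<lambda>p. poly p s"] c by simp
    ultimately show False using cK place_const[OF K w(1)] by (auto simp: vge_def)
  qed
  then obtain c where c: "B = [:c:]" by (rule degree_eq_zeroE)
  then have cK: "c \<in> K" "c \<noteq> 0" using polys_over_coeff[OF K_ring BK(1), of 0] BK(2) by auto
  have "f = poly (smult (inverse c) A) s"
    using A(2) c cK(2) by (simp add: field_simps)
  moreover have "smult (inverse c) A \<in> polys_over K"
    using A(1) cK(1) subfield_inverse[OF K] by (intro polys_over_smult[OF K_ring])
  ultimately show ?thesis by blast
qed

end

section \<open>The Kummer extension\<close>

lemma place_sum_distinct: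
  assumes K: "is_subfield K" and w: "place_val K w"
    and "finite I" "I \<noteq> {}" "\<And>i. i \<in> I \<Longrightarrow> f i \<noteq> 0" "inj_on (\<lambda>i. w (f i)) I"
  shows "sum f I \<noteq> 0 \<and> (\<exists>k\<in>I. w (sum f I) = w (f k))"
  using assms(3-6)
proof (induction I rule: finite_ne_induct)
  case (singleton i)
  then show ?case by simp
next
  case (insert j I)
  then obtain k where k: "k \<in> I" "sum f I \<noteq> 0" "w (sum f I) = w (f k)" by auto
  have "w (f j) \<noteq> w (f k)" using insert k by (auto simp: inj_on_def)
  then consider "w (f j) < w (sum f I)" | "w (sum f I) < w (f j)" using k by fastforce
  then show ?case
  proof cases
    case 1
    then have "f j + sum f I \<noteq> 0" "w (f j + sum f I) = w (f j)"
      using place_dominant[OF K w, of "f j" "sum f I"] insert by (auto simp: vge_def)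
    then show ?thesis using insert by auto
  next
    case 2
    then have "sum f I + f j \<noteq> 0" "w (sum f I + f j) = w (sum f I)"
      using place_dominant[OF K w, of "sum f I" "f j"] k by (auto simp: vge_def)
    then show ?thesis using insert k by (auto simp: add.commute)
  qed
qed

lemma span_upto_scale:
  assumes F: "is_subfield F" and r: "r \<in> F" and "f \<in> span_upto F e N"
  shows "r * f \<in> span_upto F e N"
proof -
  obtain s where "f = (\<Sum>j<N. s j * e j)" "\<forall>j<N. s j \<in> F"
    using assms(3) unfolding span_upto_def by auto
  then show ?thesis
    unfolding span_upto_def
    by (intro CollectI exI[of _ "\<lambda>j. r * s j"])
      (auto simp: sum_distrib_left mult.assoc intro: subring_mult[OF subfield_subring[OF F] r])
qed

lemma span_upto_add:
  assumes F: "is_subfield F" and "f \<in> span_upto F e N" "g \<in> span_upto F e N"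
  shows "f + g \<in> span_upto F e N"
proof -
  obtain r s where "f = (\<Sum>j<N. r j * e j)" "\<forall>j<N. r j \<in> F" "g = (\<Sum>j<N. s j * e j)" "\<forall>j<N. s j \<in> F"
    using assms(2,3) unfolding span_upto_def by auto
  then show ?thesis
    unfolding span_upto_def
    by (intro CollectI exI[of _ "\<lambda>j. r j + s j"])
      (auto simp: sum.distrib algebra_simps intro: subring_add[OF subfield_subring[OF F]])
qed

lemma span_upto_zero: "is_subfield F \<Longrightarrow> 0 \<in> span_upto F e N"
  unfolding span_upto_def
  by (intro CollectI exI[of _ "\<lambda>_. 0"]) (auto intro: subring_0 subfield_subring)

lemma span_upto_sum:
  "is_subfield F \<Longrightarrow> (\<And>i. i \<in> I \<Longrightarrow> f i \<in> span_upto F e N) \<Longrightarrow> sum f I \<in> span_upto F e N"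
  by (induction I rule: infinite_finite_induct) (auto intro: span_upto_add span_upto_zero)

lemma span_upto_basis:
  assumes F: "is_subfield F" and "j < N" shows "e j \<in> span_upto F e N"
  unfolding span_upto_def
proof (intro CollectI exI conjI)
  show "e j = (\<Sum>i<N. (if i = j then 1 else 0) * e i)"
    using \<open>j < N\<close> by (simp add: if_distrib[of "\<lambda>x. x * _"] sum.delta cong: if_cong)
  show "\<forall>i<N. (if i = j then 1 else 0) \<in> F"
    using subring_0[OF subfield_subring[OF F]] subring_1[OF subfield_subring[OF F]] by auto
qed

text \<open>A nonzero \<open>f\<close> satisfies a polynomial relation over \<open>F\<close>. After
  cancelling the lowest power of \<open>f\<close> its constant term is nonzero, which exhibits
  \<open>1/f\<close> as a polynomial in \<open>f\<close>.\<close>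

lemma finite_dim_subfield:
  assumes F: "is_subfield F" and S: "is_subring S" "F \<subseteq> S" "S \<subseteq> span_upto F e N"
  shows "is_subfield S"
proof -
  have "inverse f \<in> S" if f: "f \<in> S" for f
  proof (cases "f = 0")
    case True
    then show ?thesis using f by simp
  next
    case False
    have "f ^ i \<in> span_upto F e N" for i
      using subring_power[OF S(1) f] S(3) by blast
    then obtain c where c: "\<forall>i\<le>N. c i \<in> F" "\<exists>i\<le>N. c i \<noteq> 0" "(\<Sum>i\<le>N. c i * f ^ i) = 0"
      using span_upto_dependent[OF F, of "{..N}" N "\<lambda>i. f ^ i" e] by auto
    define l where "l = (LEAST i. i \<le> N \<and> c i \<noteq> 0)"
    have l: "l \<le> N" "c l \<noteq> 0" using LeastI_ex[OF c(2)] by (auto simp: l_def)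
    have least: "c i = 0" if "i < l" "i \<le> N" for i
      using not_less_Least[of i "\<lambda>i. i \<le> N \<and> c i \<noteq> 0"] that by (auto simp: l_def)
    have "(\<Sum>i\<le>N. c i * f ^ i) = (\<Sum>i\<in>insert l {l<..N}. c i * f ^ i)"
    proof (rule sum.mono_neutral_right)
      show "\<forall>i\<in>{..N} - insert l {l<..N}. c i * f ^ i = 0"
      proof
        fix i assume "i \<in> {..N} - insert l {l<..N}"
        then have "i < l" "i \<le> N" by auto
        then show "c i * f ^ i = 0" using least by simp
      qed
    qed (use l in auto)
    also have "\<dots> = c l * f ^ l + (\<Sum>i\<in>{l<..N}. c i * f ^ i)" by simp
    also have "(\<Sum>i\<in>{l<..N}. c i * f ^ i) = f ^ l * (f * (\<Sum>i\<in>{l<..N}. c i * f ^ (i - l - 1)))"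
      unfolding sum_distrib_left
    proof (rule sum.cong)
      fix i assume "i \<in> {l<..N}"
      then have "i = l + Suc (i - l - 1)" by auto
      then have "f ^ i = f ^ l * (f * f ^ (i - l - 1))" by (metis power_Suc power_add)
      then show "c i * f ^ i = f ^ l * (f * (c i * f ^ (i - l - 1)))" by simp
    qed simp
    finally have "f ^ l * (c l + f * (\<Sum>i\<in>{l<..N}. c i * f ^ (i - l - 1))) = 0"
      using c(3) by (simp add: algebra_simps)
    then have "c l + f * (\<Sum>i\<in>{l<..N}. c i * f ^ (i - l - 1)) = 0"
      using False by simp
    then have "f * (\<Sum>i\<in>{l<..N}. c i * f ^ (i - l - 1)) = - c l"
      by (simp add: eq_neg_iff_add_eq_0 add.commute)
    then have "f * (- (\<Sum>i\<in>{l<..N}. c i * f ^ (i - l - 1)) * inverse (c l)) = 1"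
      using l(2) by (simp flip: mult.assoc)
    then have "inverse f = - (\<Sum>i\<in>{l<..N}. c i * f ^ (i - l - 1)) * inverse (c l)"
      by (rule inverse_unique)
    also have "\<dots> \<in> S"
    proof (intro subring_mult[OF S(1)] subring_uminus[OF S(1)] subring_sum[OF S(1)]
        subring_power[OF S(1)] f)
      show "inverse (c l) \<in> S" using c(1) l(1) subfield_inverse[OF F] S(2) by blast
      show "c i \<in> S" if "i \<in> {l<..N}" for i using c(1) S(2) that by auto
    qed
    finally show ?thesis .
  qed
  then show ?thesis
    using S(1) unfolding is_subfield_def is_subring_def by simp
qed

text \<open>The curve in rescaled coordinates, with constants \<open>c\<close> and \<open>e\<close>
  kept general. \<open>roots\<close> puts all \<open>3 m\<close>-th roots of unity into
  \<open>K\<close>, so that the field is a Kummer extension of \<open>K(X)\<close>.\<close>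

locale kummer_curve =
  fixes K :: "'a::field set" and X Y c e :: 'a and m :: nat
  assumes K: "is_subfield K" and fin: "finite K" and trans: "transcendental_over K X"
    and gen: "\<And>F. is_subfield F \<Longrightarrow> K \<subseteq> F \<Longrightarrow> X \<in> F \<Longrightarrow> Y \<in> F \<Longrightarrow> F = UNIV"
    and m: "of_nat (3 * m) \<noteq> (0 :: 'a)"
    and ce: "c \<in> K" "c \<noteq> 0" "e \<in> K" "e \<noteq> 0"
    and Y_power: "Y ^ (3 * m) = c * X ^ m * (X ^ m + e)"
    and roots: "card {\<eta> \<in> K. \<eta> ^ (3 * m) = 1} = 3 * m"
begin

abbreviation "F \<equiv> ratfun K X"
abbreviation "n \<equiv> 3 * m"

lemmas F = ratfun_subfield[OF K, of X]
lemmas Fcl = subring_closed[OF subfield_subring[OF F]]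

lemma m_pos: "m > 0"
  using m by (cases m) auto

lemma m_nonzero: "of_nat m \<noteq> (0 :: 'a)"
  using m by auto

lemma KF: "a \<in> K \<Longrightarrow> a \<in> F"
  using K_ratfun[OF K] by blast

lemma XF: "X \<in> F"
  by (rule self_ratfun[OF K])

definition D :: 'a where "D = c * X ^ m * (X ^ m + e)"

lemma DF: "D \<in> F"
  unfolding D_def by (intro Fcl KF ce XF)

lemma Y_reduce: "n \<le> k \<Longrightarrow> Y ^ k = D * Y ^ (k - n)"
  by (metis D_def Y_power le_add_diff_inverse power_add)

lemma Y_power_span: "Y ^ k \<in> span_upto F (\<lambda>j. Y ^ j) n"
proof (induction k rule: less_induct)
  case (less k)
  show ?case
  proof (cases "k < n")
    case True
    then show ?thesis using span_upto_basis[OF F, of k n "\<lambda>j. Y ^ j"] by simp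
  next
    case False
    then show ?thesis
      using span_upto_scale[OF F DF less.IH[of "k - n"]] Y_reduce[of k] m_pos by simp
  qed
qed

text \<open>The span of the powers of \<open>Y\<close> is a ring of finite dimension over
  \<open>K(X)\<close>, hence a field, and it contains the generators.\<close>

lemma span_all: "f \<in> span_upto F (\<lambda>j. Y ^ j) n"
proof -
  let ?S = "span_upto F (\<lambda>j. Y ^ j) n"
  have FS: "F \<subseteq> ?S"
    using span_upto_scale[OF F _ Y_power_span[of 0]] by auto
  have "is_subring ?S"
  proof (rule is_subringI)
    show "0 \<in> ?S" "1 \<in> ?S" using FS Fcl(1,2) by auto
    show "f + g \<in> ?S" if "f \<in> ?S" "g \<in> ?S" for f g using span_upto_add[OF F that] .
    show "- f \<in> ?S" if "f \<in> ?S" for f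
      using span_upto_scale[OF F Fcl(6)[OF Fcl(2)] that] by simp
    show "f * g \<in> ?S" if f: "f \<in> ?S" and g: "g \<in> ?S" for f g
    proof -
      obtain r where r: "f = (\<Sum>j<n. r j * Y ^ j)" "\<And>j. j < n \<Longrightarrow> r j \<in> F"
        using f unfolding span_upto_def by auto
      obtain s where s: "g = (\<Sum>j<n. s j * Y ^ j)" "\<And>j. j < n \<Longrightarrow> s j \<in> F"
        using g unfolding span_upto_def by auto
      have "f * g = (\<Sum>i<n. \<Sum>j<n. (r i * s j) * Y ^ (i + j))"
        by (simp add: r(1) s(1) sum_product power_add mult_ac)
      also have "\<dots> \<in> ?S"
        using r(2) s(2) by (intro span_upto_sum[OF F] span_upto_scale[OF F] Y_power_span Fcl) auto
      finally show ?thesis .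
    qed
  qed
  then have "is_subfield ?S"
    by (rule finite_dim_subfield[OF F _ FS order.refl])
  then have "?S = UNIV"
    using gen[of ?S] FS K_ratfun[OF K, of X] XF Y_power_span[of 1] by auto
  then show ?thesis by simp
qed

sublocale function_field K X "\<lambda>j. Y ^ j" n
  by unfold_locales (use K trans span_all in auto)

text \<open>The factor of \<open>Y^n\<close> over whose zeros the extension is totally
  ramified.\<close>

definition Bp :: "'a poly" where "Bp = monom 1 m + [:e:]"

lemma Bp: "Bp \<in> polys_over K" "degree Bp = m" "poly Bp X = X ^ m + e"
  "pderiv Bp = monom (of_nat m) (m - 1)" "Bp \<noteq> 0"
proof -
  show "Bp \<in> polys_over K"
    unfolding Bp_def by (intro polys_over_closed[OF K_ring] ce subring_closed[OF K_ring])
  show deg: "degree Bp = m"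
    using m_pos by (simp add: Bp_def degree_add_eq_left degree_monom_eq)
  show "poly Bp X = X ^ m + e" by (simp add: Bp_def poly_monom)
  show "pderiv Bp = monom (of_nat m) (m - 1)"
    by (simp add: Bp_def pderiv_add pderiv_monom pderiv_pCons)
  show "Bp \<noteq> 0" using deg m_pos by auto
qed

lemma B_nonzero: "X ^ m + e \<noteq> 0"
  using poly_nonzero[OF Bp(1,5)] Bp(3) by simp

lemma Y_nonzero: "Y \<noteq> 0"
proof
  assume "Y = 0"
  then have "c * X ^ m * (X ^ m + e) = 0"
    using Y_power m_pos by (simp add: power_0_left)
  then show False using ce(2) s_nonzero B_nonzero by simp
qed

lemma place_Y:
  assumes w: "place_val K w"
  shows "int n * w Y = int m * w X + w (X ^ m + e)"
proof -
  have "w (Y ^ n) = w (c * X ^ m) + w (X ^ m + e)"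
    unfolding Y_power by (rule place_mult[OF K w]) (use ce s_nonzero B_nonzero in auto)
  also have "w (c * X ^ m) = w c + w (X ^ m)"
    by (rule place_mult[OF K w]) (use ce s_nonzero in auto)
  finally show ?thesis
    using place_power[OF K w Y_nonzero, of n] place_power[OF K w s_nonzero, of m]
      place_const[OF K w ce(1,2)] by simp
qed

text \<open>At a zero of \<open>X\<close> the factor \<open>X^m + e\<close> has residue
  \<open>e\<close> and drops out of \<open>place_Y\<close>.\<close>

lemma place_Y_zero:
  assumes w: "place_val K w" "w X > 0"
  shows "3 * w Y = w X"
proof -
  have "vge w 1 (X ^ m)"
    using place_power[OF K w(1) s_nonzero, of m] w(2) m_pos by (simp add: vge_def int_one_le_iff_zero_less)
  then have "res K w (X ^ m + e) e" using ce by (simp add: res_def)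
  then have "w (X ^ m + e) = 0" by (rule res_unit(2)[OF K w(1) _ ce(4)])
  then have "int m * (3 * w Y) = int m * w X" using place_Y[OF w(1)] by simp
  then show ?thesis using m_pos by simp
qed

lemma place_Y_pole:
  assumes w: "place_val K w" "w X < 0"
  shows "3 * w Y = 2 * w X"
proof -
  have "w (X ^ m + e) = int m * w X"
    using place_pole[OF w Bp(1,5)] Bp(2,3) by simp
  then have "int m * (3 * w Y) = int m * (2 * w X)" using place_Y[OF w(1)] by simp
  then show ?thesis using m_pos by simp
qed

text \<open>Total ramification: at a zero of \<open>X^m + e\<close> the derivative of
  \<open>Bp\<close> is a unit, so \<open>place_ratfun_dvd\<close> makes \<open>n * w Y\<close> a
  divisor of all values on \<open>K(X)\<close>.\<close>

lemma place_B:
  assumes w: "place_val K w" "w X \<ge> 0" "w (X ^ m + e) > 0" and f: "f \<in> F" "f \<noteq> 0"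
  shows "w X = 0" "w (X ^ m + e) = int n * w Y" "w (X ^ m + e) dvd w f"
proof -
  have nz: "\<not> w X > 0"
  proof
    assume "w X > 0"
    then have "vge w 1 (X ^ m)"
      using place_power[OF K w(1) s_nonzero, of m] m_pos by (simp add: vge_def int_one_le_iff_zero_less)
    then have "res K w (X ^ m + e) e" using ce by (simp add: res_def)
    then show False using res_unit(2)[OF K w(1) _ ce(4)] w(3) by simp
  qed
  then show X0: "w X = 0" using w(2) by simp
  then show "w (X ^ m + e) = int n * w Y" using place_Y[OF w(1)] by simp
  have d: "poly (pderiv Bp) X = of_nat m * X ^ (m - 1)" by (simp add: Bp(4) poly_monom)
  have d0: "poly (pderiv Bp) X \<noteq> 0" using m_nonzero s_nonzero by (simp add: d)
  have "w (poly (pderiv Bp) X) = 0"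
    unfolding d
    using place_mult[OF K w(1) m_nonzero, of "X ^ (m - 1)"] place_const[OF K w(1) _ m_nonzero]
      subring_of_nat[OF K_ring, of m] place_power[OF K w(1) s_nonzero, of "m - 1"] X0 s_nonzero
    by simp
  then show "w (X ^ m + e) dvd w f"
    using place_ratfun_dvd[OF w(1,2) Bp(1,5) _ d0 _ f] w(3) Bp(3) by simp
qed

text \<open>At a totally ramified place the values of the nonzero terms, divided by
  \<open>w Y\<close>, are distinct modulo \<open>n\<close>, so they cannot cancel. This replaces a
  proof that the equation for \<open>Y\<close> is irreducible.\<close>

lemma independent:
  assumes r: "\<And>j. j < n \<Longrightarrow> r j \<in> F" and zero: "(\<Sum>j<n. r j * Y ^ j) = 0" and j: "j < n"
  shows "r j = 0"
proof (rule ccontr)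
  assume rj: "r j \<noteq> 0"
  define I where "I = {j. j < n \<and> r j \<noteq> 0}"
  obtain w where w: "place_val K w" "w X \<ge> 0" "w (X ^ m + e) > 0"
    using exists_place_over[OF Bp(1)] Bp(2,3) m_pos by auto
  have wB: "w (X ^ m + e) = int n * w Y" by (rule place_B(2)[OF w XF s_nonzero])
  then have wY: "w Y > 0" using w(3) by (simp add: zero_less_mult_iff)
  have val: "\<exists>t. w (r i * Y ^ i) = w Y * (int n * t + int i)" if "i \<in> I" for i
  proof -
    have "r i \<in> F" "r i \<noteq> 0" using that r by (auto simp: I_def)
    then obtain t where "w (r i) = int n * w Y * t" using place_B(3)[OF w] wB by (metis dvdE)
    then show ?thesis
      using \<open>r i \<noteq> 0\<close> Y_nonzero place_mult[OF K w(1), of "r i" "Y ^ i"]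
        place_power[OF K w(1) Y_nonzero, of i]
      by (intro exI[of _ t]) (simp add: algebra_simps)
  qed
  have "inj_on (\<lambda>i. w (r i * Y ^ i)) I"
  proof (rule inj_onI)
    fix i k assume ik: "i \<in> I" "k \<in> I" "w (r i * Y ^ i) = w (r k * Y ^ k)"
    obtain t t' where "w Y * (int n * t + int i) = w Y * (int n * t' + int k)"
      using val[OF ik(1)] val[OF ik(2)] ik(3) by metis
    then have "int n * t + int i = int n * t' + int k" using wY by simp
    then have "(int n * t + int i) mod int n = (int n * t' + int k) mod int n" by simp
    then show "i = k" using ik by (simp add: I_def)
  qed
  moreover have "finite I" "I \<noteq> {}" using j rj by (auto simp: I_def)
  moreover have "r i * Y ^ i \<noteq> 0" if "i \<in> I" for i using that Y_nonzero by (simp add: I_def)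
  ultimately have "(\<Sum>i\<in>I. r i * Y ^ i) \<noteq> 0"
    using place_sum_distinct[OF K w(1), of I "\<lambda>i. r i * Y ^ i"] by blast
  moreover have "(\<Sum>i\<in>I. r i * Y ^ i) = (\<Sum>j<n. r j * Y ^ j)"
    by (rule sum.mono_neutral_left) (auto simp: I_def)
  ultimately show False using zero by simp
qed

section \<open>Kummer automorphisms and projection to components\<close>

definition co :: "'a \<Rightarrow> nat \<Rightarrow> 'a" where
  "co f = (SOME r. (\<forall>j<n. r j \<in> F) \<and> f = (\<Sum>j<n. r j * Y ^ j))"

lemma co: "j < n \<Longrightarrow> co f j \<in> F" "f = (\<Sum>j<n. co f j * Y ^ j)"
proof -
  have "\<exists>r. (\<forall>j<n. r j \<in> F) \<and> f = (\<Sum>j<n. r j * Y ^ j)"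
    using span_all[of f] unfolding span_upto_def by blast
  from someI_ex[OF this, folded co_def]
  show "j < n \<Longrightarrow> co f j \<in> F" "f = (\<Sum>j<n. co f j * Y ^ j)" by blast+
qed

lemma co_unique:
  assumes "\<And>j. j < n \<Longrightarrow> r j \<in> F" "f = (\<Sum>j<n. r j * Y ^ j)" "j < n"
  shows "co f j = r j"
proof -
  have "co f j - r j = 0"
  proof (rule independent[OF _ _ assms(3)])
    show "co f j - r j \<in> F" if "j < n" for j
      using that co(1) assms(1) by (intro Fcl)
    show "(\<Sum>j<n. (co f j - r j) * Y ^ j) = 0"
      using co(2)[of f] assms(2) by (simp add: left_diff_distrib sum_subtractf)
  qed
  then show ?thesis by simp
qed

text \<open>The \<open>F\<close>-linear map with \<open>Y \<mapsto> \<eta> Y\<close>. For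
  \<open>\<eta>\<close> in \<open>\<mu>\<close> it is multiplicative, as it is then compatible with
  the reduction \<open>Y^n = D\<close>.\<close>

definition \<sigma> :: "'a \<Rightarrow> 'a \<Rightarrow> 'a" where
  "\<sigma> \<eta> f = (\<Sum>j<n. co f j * \<eta> ^ j * Y ^ j)"

abbreviation "\<mu> \<equiv> {\<eta> \<in> K. \<eta> ^ n = 1}"

lemma \<sigma>_eq:
  assumes "\<And>j. j < n \<Longrightarrow> r j \<in> F" "f = (\<Sum>j<n. r j * Y ^ j)"
  shows "\<sigma> \<eta> f = (\<Sum>j<n. r j * \<eta> ^ j * Y ^ j)"
  unfolding \<sigma>_def by (rule sum.cong) (use co_unique[OF assms] in auto)

lemma \<sigma>_add: "\<sigma> \<eta> (f + g) = \<sigma> \<eta> f + \<sigma> \<eta> g"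
proof -
  have "\<sigma> \<eta> (f + g) = (\<Sum>j<n. (co f j + co g j) * \<eta> ^ j * Y ^ j)"
  proof (rule \<sigma>_eq)
    show "co f j + co g j \<in> F" if "j < n" for j using that co(1) by (intro Fcl)
    show "f + g = (\<Sum>j<n. (co f j + co g j) * Y ^ j)"
      using co(2)[of f] co(2)[of g] by (simp add: distrib_right sum.distrib)
  qed
  then show ?thesis by (simp add: \<sigma>_def distrib_right sum.distrib)
qed

lemma \<sigma>_zero: "\<sigma> \<eta> 0 = 0"
  using \<sigma>_add[of \<eta> 0 0] by (metis add.right_neutral add_left_cancel)

lemma \<sigma>_sum: "\<sigma> \<eta> (sum f I) = (\<Sum>i\<in>I. \<sigma> \<eta> (f i))"
  by (induction I rule: infinite_finite_induct) (auto simp: \<sigma>_zero \<sigma>_add)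

lemma \<sigma>_monomial:
  assumes "\<eta> \<in> \<mu>" "r \<in> F"
  shows "\<sigma> \<eta> (r * Y ^ k) = r * \<eta> ^ k * Y ^ k"
  using assms(2)
proof (induction k arbitrary: r rule: less_induct)
  case (less k)
  show ?case
  proof (cases "k < n")
    case True
    have "\<sigma> \<eta> (r * Y ^ k) = (\<Sum>j<n. (if j = k then r else 0) * \<eta> ^ j * Y ^ j)"
    proof (rule \<sigma>_eq)
      show "(if j = k then r else 0) \<in> F" for j using less.prems Fcl(1) by simp
      show "r * Y ^ k = (\<Sum>j<n. (if j = k then r else 0) * Y ^ j)"
        using True by (simp add: if_distrib[of "\<lambda>x. x * _"] cong: if_cong)
    qed
    also have "\<dots> = r * \<eta> ^ k * Y ^ k"
      using True by (simp add: if_distrib[of "\<lambda>x. x * _"] cong: if_cong)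
    finally show ?thesis .
  next
    case False
    then have k: "k = n + (k - n)" by simp
    have "\<eta> ^ k = \<eta> ^ (k - n)"
      using assms(1) by (subst k, simp only: power_add) simp
    moreover have "\<sigma> \<eta> ((r * D) * Y ^ (k - n)) = (r * D) * \<eta> ^ (k - n) * Y ^ (k - n)"
      using False m_pos less.prems DF by (intro less.IH Fcl) auto
    ultimately show ?thesis using Y_reduce[of k] False by (simp add: mult_ac)
  qed
qed

lemma \<sigma>_ratfun: "\<eta> \<in> \<mu> \<Longrightarrow> r \<in> F \<Longrightarrow> \<sigma> \<eta> r = r"
  using \<sigma>_monomial[of \<eta> r 0] by simp

lemma \<sigma>_mult: assumes "\<eta> \<in> \<mu>" shows "\<sigma> \<eta> (f * g) = \<sigma> \<eta> f * \<sigma> \<eta> g"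
proof -
  have "f * g = (\<Sum>i<n. co f i * Y ^ i) * (\<Sum>j<n. co g j * Y ^ j)"
    using co(2) by metis
  also have "\<dots> = (\<Sum>i<n. \<Sum>j<n. (co f i * co g j) * Y ^ (i + j))"
    by (simp add: sum_product power_add mult_ac)
  finally have "\<sigma> \<eta> (f * g) = (\<Sum>i<n. \<Sum>j<n. \<sigma> \<eta> ((co f i * co g j) * Y ^ (i + j)))"
    by (simp add: \<sigma>_sum)
  also have "\<dots> = (\<Sum>i<n. \<Sum>j<n. (co f i * co g j) * \<eta> ^ (i + j) * Y ^ (i + j))"
    by (intro sum.cong refl \<sigma>_monomial[OF assms] Fcl(5) co(1)) auto
  also have "\<dots> = \<sigma> \<eta> f * \<sigma> \<eta> g"
    by (simp add: \<sigma>_def sum_product power_add mult_ac)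
  finally show ?thesis .
qed

lemma \<sigma>_inverse: assumes "\<eta> \<in> \<mu>" shows "\<sigma> \<eta> (\<sigma> (inverse \<eta>) f) = f"
proof -
  have \<eta>: "\<eta> \<in> K" "\<eta> \<noteq> 0" using assms m_pos by (auto simp: power_0_left)
  have "\<sigma> \<eta> (\<sigma> (inverse \<eta>) f) = (\<Sum>j<n. (co f j * inverse \<eta> ^ j) * \<eta> ^ j * Y ^ j)"
  proof (rule \<sigma>_eq)
    show "co f j * inverse \<eta> ^ j \<in> F" if "j < n" for j
      by (rule Fcl(5)[OF co(1)[OF that] Fcl(7)[OF KF[OF subfield_inverse[OF K \<eta>(1)]]]])
    show "\<sigma> (inverse \<eta>) f = (\<Sum>j<n. co f j * inverse \<eta> ^ j * Y ^ j)" by (rule \<sigma>_def)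
  qed
  also have "\<dots> = (\<Sum>j<n. co f j * Y ^ j)"
    using \<eta>(2) by (intro sum.cong) (auto simp: field_simps)
  finally show ?thesis using co(2)[of f] by metis
qed

lemma \<sigma>_nonzero: assumes "\<eta> \<in> \<mu>" "f \<noteq> 0" shows "\<sigma> \<eta> f \<noteq> 0"
proof
  assume "\<sigma> \<eta> f = 0"
  moreover have "inverse \<eta> \<in> \<mu>" using assms(1) subfield_inverse[OF K] by (auto simp: power_inverse)
  ultimately have "\<sigma> (inverse \<eta>) 0 = f" using \<sigma>_inverse[of "inverse \<eta>" f] by simp
  then show False using assms(2) \<sigma>_zero by simp
qed

text \<open>Automorphisms over \<open>K\<close> permute the places, and they fix \<open>X\<close>;
  hence conditions at all places in terms of \<open>X\<close> are stable under them.\<close>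

lemma place_\<sigma>: assumes w: "place_val K w" and \<eta>: "\<eta> \<in> \<mu>" shows "place_val K (\<lambda>f. w (\<sigma> \<eta> f))"
  unfolding place_val_def
proof (intro conjI allI impI ballI)
  show "w (\<sigma> \<eta> (a * b)) = w (\<sigma> \<eta> a) + w (\<sigma> \<eta> b)" if "a \<noteq> 0 \<and> b \<noteq> 0" for a b
    using that \<sigma>_nonzero[OF \<eta>] by (simp add: \<sigma>_mult[OF \<eta>] place_mult[OF K w])
  show "min (w (\<sigma> \<eta> a)) (w (\<sigma> \<eta> b)) \<le> w (\<sigma> \<eta> (a + b))" if "a \<noteq> 0 \<and> b \<noteq> 0 \<and> a + b \<noteq> 0" for a b
    using that \<sigma>_nonzero[OF \<eta>] place_add[OF K w, of "\<sigma> \<eta> a" "\<sigma> \<eta> b"] by (metis \<sigma>_add)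
  show "w (\<sigma> \<eta> a) = 0" if "a \<in> K" "a \<noteq> 0" for a
    using that place_const[OF K w] by (simp add: \<sigma>_ratfun[OF \<eta>] KF)
  obtain t where t: "t \<noteq> 0" "w t = 1" using w by (auto simp: place_val_def)
  have "w (\<sigma> \<eta> (\<sigma> (inverse \<eta>) t)) = 1" using t \<sigma>_inverse[OF \<eta>] by simp
  moreover have "\<sigma> (inverse \<eta>) t \<noteq> 0" using t \<sigma>_inverse[OF \<eta>, of t] \<sigma>_zero by auto
  ultimately show "\<exists>t. t \<noteq> 0 \<and> w (\<sigma> \<eta> t) = 1" by blast
qed

text \<open>Multiplication by some \<open>\<eta>0\<close> in \<open>\<mu>\<close> with
  \<open>\<eta>0^k \<noteq> 1\<close> permutes \<open>\<mu>\<close>. It exists because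
  \<open>x^l - 1\<close> has at most \<open>l < n\<close> roots.\<close>

lemma roots_orthogonality:
  assumes k: "k mod n \<noteq> 0" shows "(\<Sum>\<eta>\<in>\<mu>. \<eta> ^ k) = 0"
proof -
  define l where "l = k mod n"
  have l: "l > 0" "l < n" using k m_pos by (auto simp: l_def)
  have pk: "\<eta> ^ k = \<eta> ^ l" if "\<eta> \<in> \<mu>" for \<eta>
  proof -
    have "\<eta> ^ k = \<eta> ^ (n * (k div n) + l)" by (simp add: l_def)
    then show ?thesis using that by (simp add: power_add power_mult)
  qed
  have "\<exists>\<eta>\<in>\<mu>. \<eta> ^ l \<noteq> 1"
  proof (rule ccontr)
    assume "\<not> ?thesis"
    then have sub: "\<mu> \<subseteq> {x. poly (monom 1 l + [:- 1:]) x = 0}" by (auto simp: poly_monom)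
    have deg: "degree (monom (1 :: 'a) l + [:- 1:]) = l"
      using l by (simp add: degree_add_eq_left degree_monom_eq)
    then have nz: "monom (1 :: 'a) l + [:- 1:] \<noteq> 0" using l by auto
    have "card \<mu> \<le> card {x. poly (monom (1 :: 'a) l + [:- 1:]) x = 0}"
      by (rule card_mono[OF poly_roots_finite[OF nz] sub])
    also have "\<dots> \<le> l" using card_poly_roots_bound[OF nz] deg by simp
    finally show False using roots l by simp
  qed
  then obtain \<eta>0 where \<eta>0: "\<eta>0 \<in> \<mu>" "\<eta>0 ^ k \<noteq> 1" using pk by auto
  then have \<eta>00: "\<eta>0 \<noteq> 0" using m_pos by (auto simp: power_0_left)
  have "(\<Sum>\<eta>\<in>\<mu>. \<eta> ^ k) = (\<Sum>\<eta>\<in>\<mu>. (\<eta>0 * \<eta>) ^ k)"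
    by (rule sum.reindex_bij_witness[of _ "\<lambda>\<eta>. \<eta>0 * \<eta>" "\<lambda>\<eta>. inverse \<eta>0 * \<eta>"])
      (use \<eta>0(1) \<eta>00 in \<open>auto simp: power_mult_distrib power_inverse mult.assoc[symmetric]
        intro: subring_mult[OF K_ring] subfield_inverse[OF K]\<close>)
  also have "\<dots> = \<eta>0 ^ k * (\<Sum>\<eta>\<in>\<mu>. \<eta> ^ k)"
    by (simp add: power_mult_distrib sum_distrib_left)
  finally have "(1 - \<eta>0 ^ k) * (\<Sum>\<eta>\<in>\<mu>. \<eta> ^ k) = 0" by (simp add: algebra_simps)
  then show ?thesis using \<eta>0 by simp
qed

text \<open>Fourier inversion over \<open>\<mu>\<close>; the exponent \<open>n - j\<close> stands
  for \<open>- j\<close>.\<close>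

lemma projection:
  assumes j: "j < n"
  shows "(\<Sum>\<eta>\<in>\<mu>. \<eta> ^ (n - j) * \<sigma> \<eta> f) = of_nat n * (co f j * Y ^ j)"
proof -
  have "(\<Sum>\<eta>\<in>\<mu>. \<eta> ^ (n - j) * \<sigma> \<eta> f) = (\<Sum>\<eta>\<in>\<mu>. \<Sum>i<n. co f i * Y ^ i * \<eta> ^ (n - j + i))"
    by (simp add: \<sigma>_def sum_distrib_left power_add mult_ac)
  also have "\<dots> = (\<Sum>i<n. co f i * Y ^ i * (\<Sum>\<eta>\<in>\<mu>. \<eta> ^ (n - j + i)))"
    by (subst sum.swap) (simp add: sum_distrib_left)
  also have "\<dots> = (\<Sum>i<n. if i = j then of_nat n * (co f j * Y ^ j) else 0)"
  proof (rule sum.cong)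
    fix i assume i: "i \<in> {..<n}"
    show "co f i * Y ^ i * (\<Sum>\<eta>\<in>\<mu>. \<eta> ^ (n - j + i)) = (if i = j then of_nat n * (co f j * Y ^ j) else 0)"
    proof (cases "i = j")
      case True
      then have "n - j + i = n" using j by simp
      then have "(\<Sum>\<eta>\<in>\<mu>. \<eta> ^ (n - j + i)) = (\<Sum>\<eta>\<in>\<mu>. 1)" by (intro sum.cong) auto
      also have "\<dots> = of_nat n" using roots by simp
      finally show ?thesis using True by simp
    next
      case False
      have "(n - j + i) mod n \<noteq> 0"
      proof
        assume "(n - j + i) mod n = 0"
        then obtain t where t: "n - j + i = n * t" by (auto simp: mod_eq_0_iff_dvd)
        have "0 < n * t" "n * t < n * 2"
          unfolding t[symmetric] using i j by auto
        then have "0 < t" "t < 2" by auto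
        then have "t = 1" by simp
        then show False using t False j by auto
      qed
      then show ?thesis using roots_orthogonality False by simp
    qed
  qed simp
  also have "\<dots> = of_nat n * (co f j * Y ^ j)" using j by simp
  finally show ?thesis .
qed

text \<open>\<open>good d f\<close> says that \<open>f\<close> lies in the Riemann-Roch space of \<open>d\<close> times the pole divisor of \<open>X\<close>.\<close>

definition good :: "nat \<Rightarrow> 'a \<Rightarrow> bool" where
  "good d f \<longleftrightarrow> (\<forall>w. place_val K w \<longrightarrow>
     (w X \<ge> 0 \<longrightarrow> vge w 0 f) \<and> (w X < 0 \<longrightarrow> vge w (int d * w X) f))"

lemma goodD: "good d f \<Longrightarrow> place_val K w \<Longrightarrow> w X \<ge> 0 \<Longrightarrow> vge w 0 f"
  "good d f \<Longrightarrow> place_val K w \<Longrightarrow> w X < 0 \<Longrightarrow> vge w (int d * w X) f"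
  by (auto simp: good_def)

text \<open>Up to the nonzero constant \<open>n\<close>, the component is a \<open>K\<close>-linear
  combination of the conjugates of \<open>f\<close>, each of which obeys the same bounds.\<close>

lemma good_component:
  assumes f: "good d f" and j: "j < n"
  shows "good d (co f j * Y ^ j)"
proof -
  have *: "vge w k (co f j * Y ^ j)"
    if w: "place_val K w" and vg: "\<And>\<eta>. \<eta> \<in> \<mu> \<Longrightarrow> vge w k (\<sigma> \<eta> f)" for w k
  proof -
    have "vge w k (\<Sum>\<eta>\<in>\<mu>. \<eta> ^ (n - j) * \<sigma> \<eta> f)"
      using vg by (intro vge_sum[OF K w] vge_mult_0'[OF K w] vge_power_0[OF K w] vge_const[OF K w]) auto
    then have "vge w k (inverse (of_nat n) * (of_nat n * (co f j * Y ^ j)))"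
      unfolding projection[OF j]
      by (rule vge_mult_0'[OF K w vge_const[OF K w subfield_inverse[OF K subring_of_nat[OF K_ring]]]])
    moreover have "inverse (of_nat n) * (of_nat n * (co f j * Y ^ j)) = co f j * Y ^ j"
      using m by (simp del: of_nat_mult flip: mult.assoc)
    ultimately show ?thesis by simp
  qed
  have X: "\<sigma> \<eta> X = X" if "\<eta> \<in> \<mu>" for \<eta> by (rule \<sigma>_ratfun[OF that XF])
  have \<sigma>: "vge w k (\<sigma> \<eta> f) \<longleftrightarrow> vge (\<lambda>f. w (\<sigma> \<eta> f)) k f" if "\<eta> \<in> \<mu>" for w \<eta> k
    using \<sigma>_nonzero[OF that] \<sigma>_zero by (auto simp: vge_def)
  show ?thesis
    unfolding good_def
  proof (intro allI impI conjI)
    fix w assume w: "place_val K w"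
    {
      assume wX: "w X \<ge> 0"
      show "vge w 0 (co f j * Y ^ j)"
        using goodD(1)[OF f place_\<sigma>[OF w]] wX X by (intro *[OF w]) (simp add: \<sigma>)
    next
      assume wX: "w X < 0"
      show "vge w (int d * w X) (co f j * Y ^ j)"
        using goodD(2)[OF f place_\<sigma>[OF w]] wX X by (intro *[OF w]) (simp add: \<sigma>)
    }
  qed
qed

text \<open>At zeros of \<open>X\<close>, where \<open>w X = 3 * w Y\<close>, the factor
  \<open>Y^j\<close> absorbs a pole of \<open>r\<close> of order at most \<open>j div 3\<close>, and
  \<open>X^(j div 3)\<close> cancels it. At zeros of \<open>X^m + e\<close> total ramification and
  \<open>j < n\<close> forbid poles of \<open>r\<close>. So the product is a polynomial;
  \<open>3 * w Y = 2 * w X\<close> at a pole of \<open>X\<close> bounds its degree.\<close>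

lemma good_monomial:
  assumes r: "r \<in> F" and j: "j < n" and good: "good d (r * Y ^ j)"
  shows "\<exists>p\<in>polys_over K. r * X ^ (j div 3) = poly p X \<and>
    (\<forall>k. coeff p k \<noteq> 0 \<longrightarrow> 3 * k + 2 * j \<le> 3 * d + 3 * (j div 3))"
proof (cases "r = 0")
  case True
  then show ?thesis by (intro bexI[of _ 0]) (auto intro: polys_over_0[OF K_ring])
next
  case False
  let ?r = "r * X ^ (j div 3)"
  have wr: "w (r * Y ^ j) = w r + int j * w Y" "w ?r = w r + int (j div 3) * w X"
    if w: "place_val K w" for w
    using False Y_nonzero s_nonzero
    by (simp_all add: place_mult[OF K w] place_power[OF K w])
  have nz: "r * Y ^ j \<noteq> 0" using False Y_nonzero by simp
  have "\<exists>p\<in>polys_over K. ?r = poly p X"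
  proof (rule regular_ratfun)
    show "?r \<in> F" using r XF by (intro Fcl)
    fix w assume w: "place_val K w" "w X \<ge> 0"
    have ge: "w r + int j * w Y \<ge> 0"
      using vgeD[OF goodD(1)[OF good w] nz] wr(1)[OF w(1)] by simp
    have "w ?r \<ge> 0"
    proof (cases "w X > 0")
      case True
      have "[:0, 1:] \<in> polys_over K"
        by (intro polys_over_closed[OF K_ring] subring_closed[OF K_ring])
      from place_ratfun_dvd[OF w this] True r False place_1[OF K w(1)]
      have "w X dvd w r" by (simp add: pderiv_pCons)
      then obtain t where t: "w r = w X * t" by (rule dvdE)
      have Y3: "w X = 3 * w Y" using place_Y_zero[OF w(1) True] by simp
      then have "w Y * (3 * t + int j) \<ge> 0" using ge t by (simp add: algebra_simps)
      then have "3 * t + int j \<ge> 0" using True Y3 by (simp add: zero_le_mult_iff)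
      then have "t + int (j div 3) \<ge> 0" by presburger
      then have "w X * (t + int (j div 3)) \<ge> 0" using True by simp
      then show ?thesis using wr(2)[OF w(1)] t by (simp add: algebra_simps)
    next
      case nX: False
      then have X0: "w X = 0" using w(2) by simp
      have "w r \<ge> 0"
      proof (cases "w (X ^ m + e) > 0")
        case True
        note B = place_B[OF w True r False]
        obtain t where t: "w r = w Y * int n * t" using B(2,3) by (metis dvdE mult.commute)
        have "w Y > 0" using B(2) True by (simp add: zero_less_mult_iff)
        moreover have "w Y * (int n * t + int j) \<ge> 0" using ge t by (simp add: algebra_simps)
        ultimately have *: "int n * t + int j \<ge> 0" by (simp add: zero_le_mult_iff)
        have "t \<ge> 0"
        proof (rule ccontr)
          assume t: "\<not> t \<ge> 0"
          define M where "M = int n"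
          have "M * t \<le> M * (- 1)" using t by (intro mult_left_mono) (auto simp: M_def)
          moreover have "int j < M" unfolding M_def using j by (rule iffD2[OF of_nat_less_iff])
          ultimately show False using *[folded M_def] by simp
        qed
        then show ?thesis using t \<open>w Y > 0\<close> by simp
      next
        case False
        have "vge w 0 X" using X0 by (simp add: vge_def)
        then have "vge w 0 (X ^ m + e)"
          using vge_poly[OF K w(1) Bp(1)] Bp(3) by metis
        then have "w (X ^ m + e) = 0" using False B_nonzero by (simp add: vge_def)
        then have "w Y = 0" using place_Y[OF w(1)] X0 m_pos by simp
        then show ?thesis using ge by simp
      qed
      then show ?thesis using wr(2)[OF w(1)] X0 by simp
    qed
    then show "vge w 0 ?r" by (simp add: vge_def)
  qed
  then obtain p where p: "p \<in> polys_over K" "?r = poly p X" by blast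
  then have p0: "p \<noteq> 0" using False s_nonzero by auto
  obtain w where w: "place_val K w" "w X < 0" using exists_place_infinity by blast
  have le: "int d * w X \<le> w r + int j * w Y"
    using vgeD[OF goodD(2)[OF good w] nz] wr(1)[OF w(1)] by simp
  have deg: "w r = int (degree p) * w X - int (j div 3) * w X"
    using place_pole[OF w p(1) p0] wr(2)[OF w(1)] p(2) by simp
  have "w X * (3 * int d) = 3 * (int d * w X)" by simp
  also have "\<dots> \<le> 3 * (w r + int j * w Y)" using le by simp
  also have "\<dots> = 3 * w r + int j * (3 * w Y)" by (simp add: algebra_simps)
  also have "\<dots> = w X * (3 * int (degree p) + 2 * int j - 3 * int (j div 3))"
    unfolding deg place_Y_pole[OF w] by (simp add: algebra_simps)
  finally have "w X * (3 * int d) \<le> w X * (3 * int (degree p) + 2 * int j - 3 * int (j div 3))" .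
  then have "3 * int (degree p) + 2 * int j - 3 * int (j div 3) \<le> 3 * int d"
    using w(2) by (simp add: mult_le_cancel_left)
  then have "3 * degree p + 2 * j \<le> 3 * d + 3 * (j div 3)" by presburger
  moreover have "k \<le> degree p" if "coeff p k \<noteq> 0" for k by (rule le_degree[OF that])
  ultimately show ?thesis using p by fastforce
qed

section \<open>Counting the Riemann-Roch space\<close>

text \<open>Exponents of the monomials \<open>X^(k - j div 3) * Y^j\<close>; the exponent of
  \<open>X\<close> may be negative.\<close>

definition Ind :: "nat \<Rightarrow> (nat \<times> nat) set" where
  "Ind d = {(j, k). j < n \<and> 3 * k + 2 * j \<le> 3 * d + 3 * (j div 3)}"

lemma finite_Ind: "finite (Ind d)"
proof (rule finite_subset)
  show "Ind d \<subseteq> {..n} \<times> {..d + n}" by (auto simp: Ind_def)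
qed simp

lemma good_expansion:
  assumes "good d f"
  shows "\<exists>b \<in> Ind d \<rightarrow>\<^sub>E K. f = (\<Sum>(j, k)\<in>Ind d. b (j, k) * X ^ k / X ^ (j div 3) * Y ^ j)"
proof -
  have "\<forall>j. \<exists>p. j < n \<longrightarrow> p \<in> polys_over K \<and> co f j * X ^ (j div 3) = poly p X \<and>
    (\<forall>k. coeff p k \<noteq> 0 \<longrightarrow> 3 * k + 2 * j \<le> 3 * d + 3 * (j div 3))"
    using good_monomial[OF co(1) _ good_component[OF assms]] by blast
  then obtain p where p: "\<And>j. j < n \<Longrightarrow> p j \<in> polys_over K"
    "\<And>j. j < n \<Longrightarrow> co f j * X ^ (j div 3) = poly (p j) X"
    "\<And>j k. j < n \<Longrightarrow> coeff (p j) k \<noteq> 0 \<Longrightarrow> 3 * k + 2 * j \<le> 3 * d + 3 * (j div 3)"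
    by metis
  define b where "b = restrict (\<lambda>(j, k). coeff (p j) k) (Ind d)"
  have b: "b \<in> Ind d \<rightarrow>\<^sub>E K"
    using p(1) polys_over_coeff[OF K_ring] by (auto simp: b_def Ind_def)
  define R where "R = (\<lambda>j. {k. 3 * k + 2 * j \<le> 3 * d + 3 * (j div 3)})"
  have Ind: "Ind d = Sigma {..<n} R" by (auto simp: Ind_def R_def)
  have finR: "finite (R j)" for j
    by (rule finite_subset[of _ "{..d + j}"]) (auto simp: R_def)
  have out: "coeff (p j) k = 0" if "j < n" "k \<notin> R j" for j k
    using p(3)[OF that(1), of k] that(2) by (auto simp: R_def)
  have "co f j = (\<Sum>k\<in>R j. coeff (p j) k * X ^ k) / X ^ (j div 3)" if j: "j < n" for j
  proof -
    have "poly (p j) X = (\<Sum>k\<le>degree (p j). coeff (p j) k * X ^ k)" by (rule poly_altdef)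
    also have "\<dots> = (\<Sum>k\<in>R j \<union> {..degree (p j)}. coeff (p j) k * X ^ k)"
      by (rule sum.mono_neutral_left) (auto simp: finR coeff_eq_0 not_le)
    also have "\<dots> = (\<Sum>k\<in>R j. coeff (p j) k * X ^ k)"
      by (rule sum.mono_neutral_right) (use out[OF j] in \<open>auto simp: finR\<close>)
    finally show ?thesis using p(2)[OF j] s_nonzero by (simp add: field_simps)
  qed
  then have "f = (\<Sum>j<n. \<Sum>k\<in>R j. coeff (p j) k * X ^ k / X ^ (j div 3) * Y ^ j)"
    by (subst co(2)[of f]) (auto simp: sum_divide_distrib sum_distrib_right intro!: sum.cong)
  also have "\<dots> = (\<Sum>(j, k)\<in>Ind d. coeff (p j) k * X ^ k / X ^ (j div 3) * Y ^ j)"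
    unfolding Ind by (rule sum.Sigma) (auto simp: finR)
  also have "\<dots> = (\<Sum>(j, k)\<in>Ind d. b (j, k) * X ^ k / X ^ (j div 3) * Y ^ j)"
    by (rule sum.cong) (auto simp: b_def)
  finally show ?thesis using b by blast
qed

text \<open>As \<open>K\<close> is finite, the dimension bound \<open>card (Ind d)\<close> is
  expressed as a bound on the number of elements.\<close>

lemma card_good: "finite {f. good d f}" "card {f. good d f} \<le> card K ^ card (Ind d)"
proof -
  let ?g = "\<lambda>b. \<Sum>(j, k)\<in>Ind d. b (j, k) * X ^ k / X ^ (j div 3) * Y ^ j"
  have sub: "{f. good d f} \<subseteq> ?g ` (Ind d \<rightarrow>\<^sub>E K)"
    using good_expansion by blast
  have fin': "finite (Ind d \<rightarrow>\<^sub>E K)" using fin finite_Ind by (intro finite_PiE) auto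
  then show "finite {f. good d f}" using sub by (meson finite_imageI finite_subset)
  have "card {f. good d f} \<le> card (?g ` (Ind d \<rightarrow>\<^sub>E K))"
    using sub fin' by (intro card_mono) auto
  also have "\<dots> \<le> card (Ind d \<rightarrow>\<^sub>E K)" by (rule card_image_le[OF fin'])
  also have "\<dots> = card K ^ card (Ind d)" by (rule card_funcsetE[OF finite_Ind])
  finally show "card {f. good d f} \<le> card K ^ card (Ind d)" .
qed

lemma card_Ind: "card (Ind m) = (\<Sum>a<m. 3 * (m - a))"
proof -
  define R where "R = (\<lambda>j. {k. 3 * k + 2 * j \<le> 3 * m + 3 * (j div 3)})"
  have Ind: "Ind m = Sigma {..<n} R" by (auto simp: Ind_def R_def)
  have finR: "finite (R j)" for j
    by (rule finite_subset[of _ "{..m + j}"]) (auto simp: R_def)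
  have "card (Ind m) = (\<Sum>j<n. card (R j))"
    unfolding Ind by (rule card_SigmaI) (auto simp: finR)
  also have "\<dots> = (\<Sum>a<m. sum (\<lambda>j. card (R j)) {a * 3..<a * 3 + 3})"
    by (simp add: sum.nat_group mult.commute)
  also have "\<dots> = (\<Sum>a<m. 3 * (m - a))"
  proof (rule sum.cong)
    fix a assume "a \<in> {..<m}"
    then have a: "a < m" by simp
    have div: "3 * a div 3 = a" "(3 * a + 1) div 3 = a" "(3 * a + 2) div 3 = a" by simp_all
    \<comment> \<open>The three residues of \<open>j\<close> modulo 3 allow
      \<open>m - a + 1\<close>, \<open>m - a\<close> and \<open>m - a - 1\<close> exponents, on
      average \<open>m - a\<close>.\<close>
    have R0: "R (3 * a) = {..m - a}" unfolding R_def div using a by auto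
    have R1: "R (3 * a + 1) = {..<m - a}" unfolding R_def div using a by auto
    have R2: "R (3 * a + 2) = {..<m - a - 1}" unfolding R_def div using a by auto
    have "{a * 3..<a * 3 + 3} = {3 * a, 3 * a + 1, 3 * a + 2}" by auto
    then have "sum (\<lambda>j. card (R j)) {a * 3..<a * 3 + 3}
        = card (R (3 * a)) + card (R (3 * a + 1)) + card (R (3 * a + 2))" by simp
    also have "\<dots> = 3 * (m - a)" using a by (simp only: R0 R1 R2) simp
    finally show "sum (\<lambda>j. card (R j)) {a * 3..<a * 3 + 3} = 3 * (m - a)" .
  qed simp
  finally show ?thesis .
qed

end

section \<open>The numerical semigroup\<close>

lemma gen_semigroup_generator: "s \<in> S \<Longrightarrow> s \<in> gen_semigroup S"
  using gen_semigroup.add[OF _ gen_semigroup.zero, of s S] by simp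

lemma gen_semigroup_add: "x \<in> gen_semigroup S \<Longrightarrow> y \<in> gen_semigroup S \<Longrightarrow> x + y \<in> gen_semigroup S"
  by (induction x rule: gen_semigroup.induct) (auto simp: add.assoc intro: gen_semigroup.add)

lemma gen_semigroup_least:
  assumes "S \<subseteq> H" "0 \<in> H" "\<And>x y. x \<in> H \<Longrightarrow> y \<in> H \<Longrightarrow> x + y \<in> H"
  shows "gen_semigroup S \<subseteq> H"
proof
  fix x assume "x \<in> gen_semigroup S"
  then show "x \<in> H"
    by (induction rule: gen_semigroup.induct) (use assms in auto)
qed

text \<open>In the application \<open>n\<close> is one more than the P-order: the least degree in
  which the order \<open>3 n\<close> occurs. For \<open>n = m\<close> the number in
  \<open>top\<close> would be \<open>(m - 1) * (q + 1)\<close>, already a multiple of the generator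
  \<open>q + 1\<close>.\<close>

locale level_semigroup =
  fixes S :: "nat set" and q m n :: nat
  assumes q: "q + 1 = 3 * m" and m: "m \<ge> 2" and n: "2 \<le> n" "n \<le> m"
    and zero: "0 \<in> S" and add: "x \<in> S \<Longrightarrow> y \<in> S \<Longrightarrow> x + y \<in> S"
    and gens: "q \<in> S" "q + 1 \<in> S"
    and low: "\<And>d. 0 < d \<Longrightarrow> d < n \<Longrightarrow> d * (q + 1) - (3 * d - 1) \<in> S"
    and top: "n < m \<Longrightarrow> n * (q + 1) - 3 * n \<in> S"
begin

text \<open>\<open>v \<in> ords d\<close> means that \<open>v\<close> occurs as a vanishing order among the forms of degree \<open>d\<close>.\<close>

definition ords :: "nat \<Rightarrow> nat set" where
  "ords d = {v. v \<le> d * (q + 1) \<and> d * (q + 1) - v \<in> S}"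

lemma ords_add: "u \<in> ords d \<Longrightarrow> v \<in> ords d' \<Longrightarrow> u + v \<in> ords (d + d')"
  using add[of "d * (q + 1) - u" "d' * (q + 1) - v"]
  by (simp add: ords_def algebra_simps)

lemma three_le: "3 * d \<le> d * (q + 1)"
proof -
  have "d * 3 \<le> d * (q + 1)" by (rule mult_le_mono2) (use q m in linarith)
  then show ?thesis by simp
qed

lemma ords_low: "0 < d \<Longrightarrow> d < n \<Longrightarrow> 3 * d - 1 \<in> ords d"
  using low order.trans[OF diff_le_self three_le] unfolding ords_def by blast

lemma ords_top: "n < m \<Longrightarrow> 3 * n \<in> ords n"
  using top three_le unfolding ords_def by blast

lemma ords_1: assumes "v \<le> 2" shows "v \<in> ords 1"
proof -
  consider "v = 0" | "v = 1" | "v = 2" using assms by linarith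
  then show ?thesis
  proof cases
    case 3
    then show ?thesis using ords_low[of 1] n by simp
  qed (use gens in \<open>auto simp: ords_def\<close>)
qed

text \<open>Orders up to \<open>3 d - 2\<close> come from multiplying a form of degree
  \<open>d - 1\<close> by one of degree 1, which has the orders 0, 1, 2. The last order comes from
  multiplying by a form of degree \<open>n\<close> and order \<open>3 n\<close>, hence depends on
  divisibility by \<open>n\<close>. The claims need each other and are proved together.\<close>

lemma ords_all:
  assumes "0 < d" "d \<le> m"
  shows "(\<forall>v. v + 2 \<le> 3 * d \<longrightarrow> v \<in> ords d) \<and> (\<not> n dvd d \<longrightarrow> 3 * d - 1 \<in> ords d) \<and>
    (n < m \<longrightarrow> n dvd d \<longrightarrow> 3 * d \<in> ords d)"
  using assms
proof (induction d rule: less_induct)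
  case (less d)
  have a: "v \<in> ords d" if v: "v + 2 \<le> 3 * d" for v
  proof (cases "d = 1")
    case True
    then show ?thesis using ords_1 v by simp
  next
    case False
    then obtain d' where d': "d = d' + 1" "d' > 0" using less.prems by (metis Suc_eq_plus1 gr0_conv_Suc neq0_conv One_nat_def)
    note IH = less.IH[of d']
    have "\<exists>u\<in>ords d'. \<exists>t\<le>2. v = u + t"
    proof (cases "v + 3 \<le> 3 * d")
      case True
      define u where "u = min v (3 * d' - 2)"
      have "u + 2 \<le> 3 * d'" "u \<le> v" "v - u \<le> 2" using True d' by (auto simp: u_def)
      then show ?thesis using IH d' less.prems
        by (intro bexI[of _ u] exI[of _ "v - u"]) auto
    next
      case F: False
      \<comment> \<open>The critical order: it is \<open>3 d' + 1\<close> or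
        \<open>(3 d' - 1) + 2\<close>, according to the last order available in degree
        \<open>d'\<close>.\<close>
      then have v3: "v = 3 * d' + 1" using v d' by simp
      show ?thesis
      proof (cases "n dvd d'")
        case True
        then have "n < m" using d' less.prems dvd_imp_le[of n d'] by simp
        then show ?thesis using IH d' less.prems True v3
          by (intro bexI[of _ "3 * d'"] exI[of _ 1]) auto
      next
        case False
        then show ?thesis using IH d' less.prems v3
          by (intro bexI[of _ "3 * d' - 1"] exI[of _ 2]) auto
      qed
    qed
    then show ?thesis using ords_add[of _ d' _ 1] ords_1 d' by blast
  qed
  have b: "3 * d - 1 \<in> ords d" if nd: "\<not> n dvd d"
  proof (cases "d < n")
    case True
    then show ?thesis using ords_low less.prems by simp
  next
    case False
    moreover have "d \<noteq> n" using nd by auto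
    ultimately have d: "n < d" by simp
    then have "\<not> n dvd d - n"
      using nd dvd_add[of n "d - n" n] by auto
    then have "3 * (d - n) - 1 \<in> ords (d - n)" using less.IH[of "d - n"] d less.prems n by auto
    moreover have "3 * n \<in> ords n" using ords_top d less.prems by simp
    ultimately have "3 * (d - n) - 1 + 3 * n \<in> ords (d - n + n)" by (rule ords_add)
    then show ?thesis using d by (simp add: algebra_simps)
  qed
  have c: "3 * d \<in> ords d" if nm: "n < m" and nd: "n dvd d"
  proof (cases "d = n")
    case True
    then show ?thesis using ords_top nm by simp
  next
    case False
    then have d: "n < d" using nd less.prems dvd_imp_le[of n d] by simp
    then have "n dvd d - n" using nd by auto
    then have "3 * (d - n) \<in> ords (d - n)" using less.IH[of "d - n"] d less.prems n nm by auto
    moreover have "3 * n \<in> ords n" using ords_top nm by simp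
    ultimately have "3 * (d - n) + 3 * n \<in> ords (d - n + n)" by (rule ords_add)
    then show ?thesis using d by (simp add: algebra_simps)
  qed
  show ?case using a b c by blast
qed

text \<open>The pole numbers with \<open>(d - 1) * (q + 1) < k \<le> d * (q + 1)\<close>, written
  without subtraction; these windows are disjoint.\<close>

definition level :: "nat \<Rightarrow> nat set" where
  "level d = {k \<in> S. k \<le> d * (q + 1) \<and> d * (q + 1) < k + (q + 1)}"

lemma card_level_ge:
  assumes A: "A \<subseteq> ords d" "\<And>v. v \<in> A \<Longrightarrow> v \<le> q"
  shows "card A \<le> card (level d)"
proof (rule card_inj_on_le)
  show "inj_on (\<lambda>v. d * (q + 1) - v) A"
  proof (rule inj_onI)
    fix u v assume uv: "u \<in> A" "v \<in> A" "d * (q + 1) - u = d * (q + 1) - v"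
    then have "u \<le> d * (q + 1)" "v \<le> d * (q + 1)" using A(1) by (auto simp: ords_def)
    then show "u = v" using uv(3) by (metis diff_diff_cancel)
  qed
  show "(\<lambda>v. d * (q + 1) - v) ` A \<subseteq> level d"
    using A by (force simp: level_def ords_def)
  show "finite (level d)"
    by (rule finite_subset[of _ "{..d * (q + 1)}"]) (auto simp: level_def)
qed

text \<open>The orders \<open>0, ..., 3 d - 2\<close> and exactly one more, namely \<open>x\<close>;
  all are at most \<open>q\<close>, so they stay in one window.\<close>

lemma card_level:
  assumes d: "0 < d" "d < m"
  shows "3 * d \<le> card (level d)"
proof -
  define x where "x = (if n dvd d then 3 * d else 3 * d - 1)"
  have "n < m" if "n dvd d" using dvd_imp_le[OF that] d by simp
  then have "insert x {..<3 * d - 1} \<subseteq> ords d"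
    using ords_all[of d] d by (auto simp: x_def)
  moreover have "v \<le> q" if "v \<in> insert x {..<3 * d - 1}" for v
    using that d q by (auto simp: x_def split: if_splits)
  ultimately have "card (insert x {..<3 * d - 1}) \<le> card (level d)" by (rule card_level_ge)
  then show ?thesis using d by (simp add: x_def split: if_splits)
qed

lemma card_level_m: "3 * m - 1 \<le> card (level m)"
proof -
  have "{..<3 * m - 1} \<subseteq> ords m" using ords_all[of m] m by auto
  moreover have "v \<le> q" if "v \<in> {..<3 * m - 1}" for v using that q by auto
  ultimately have "card {..<3 * m - 1} \<le> card (level m)" by (rule card_level_ge)
  then show ?thesis by simp
qed

text \<open>Level \<open>m\<close> is only known to give \<open>3 m - 1\<close> numbers; the pole
  number 0, which lies in no level, makes up for the missing one.\<close>

lemma card_ge: "(\<Sum>a<m. 3 * (m - a)) \<le> card (S \<inter> {..m * (q + 1)})"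
proof -
  have disj: "level d \<inter> level d' = {}" if "d < d'" for d d'
  proof -
    have "Suc d * (q + 1) \<le> d' * (q + 1)" using that by (intro mult_right_mono) auto
    then show ?thesis by (auto simp: level_def)
  qed
  have fin: "finite (level d)" for d
    by (rule finite_subset[of _ "{..d * (q + 1)}"]) (auto simp: level_def)
  have "(\<Sum>a<m. 3 * (m - a)) = (\<Sum>d\<in>{1..m}. 3 * d)"
    by (rule sum.reindex_bij_witness[of _ "\<lambda>d. m - d" "\<lambda>a. m - a"]) auto
  also have "{1..m} = insert m {1..<m}" using m by auto
  also have "(\<Sum>d\<in>insert m {1..<m}. 3 * d) = 1 + (3 * m - 1) + (\<Sum>d\<in>{1..<m}. 3 * d)"
    using m by simp
  also have "\<dots> \<le> 1 + card (level m) + (\<Sum>d\<in>{1..<m}. card (level d))"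
    using card_level card_level_m by (intro add_mono sum_mono) auto
  also have "\<dots> = 1 + (\<Sum>d\<in>insert m {1..<m}. card (level d))" by simp
  also have "insert m {1..<m} = {1..m}" using m by auto
  also have "(\<Sum>d\<in>{1..m}. card (level d)) = card (\<Union>d\<in>{1..m}. level d)"
    by (rule card_UN_disjoint[symmetric])
      (use fin disj in \<open>auto simp: neq_iff Int_commute\<close>)
  also have "1 + card (\<Union>d\<in>{1..m}. level d) = card (insert 0 (\<Union>d\<in>{1..m}. level d))"
  proof -
    have "0 \<notin> level d" if "d \<in> {1..m}" for d
      using that mult_le_mono1[of 1 d "q + 1"] by (simp add: level_def)
    then have "0 \<notin> (\<Union>d\<in>{1..m}. level d)" by blast
    then show ?thesis using fin by simp
  qed
  also have "\<dots> \<le> card (S \<inter> {..m * (q + 1)})"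
  proof (rule card_mono)
    have "k \<le> m * (q + 1)" if "d \<le> m" "k \<le> d * (q + 1)" for d k
      using that by (meson mult_le_mono1 order.trans)
    then show "insert 0 (\<Union>d\<in>{1..m}. level d) \<subseteq> S \<inter> {..m * (q + 1)}"
      using zero unfolding level_def by auto
  qed simp
  finally show ?thesis .
qed

text \<open>The orders \<open>0, ..., 3 m - 2\<close> in degree \<open>m\<close> give
  \<open>q\<close> consecutive pole numbers, and adding \<open>q\<close> repeatedly reaches
  everything above.\<close>

lemma conductor: "(m - 1) * (q + 1) + 2 \<le> k \<Longrightarrow> k \<in> S"
proof (induction k rule: less_induct)
  case (less k)
  obtain m' where m': "m = Suc m'" using m by (cases m) auto
  show ?case
  proof (cases "k \<le> m * (q + 1)")
    case True
    define v where "v = m * (q + 1) - k"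
    have "v + 2 \<le> 3 * m" using less.prems q m' by (simp add: v_def)
    then have "v \<in> ords m" using ords_all[of m] m by simp
    then show ?thesis using True by (simp add: ords_def v_def)
  next
    case False
    then have "(m - 1) * (q + 1) + 2 \<le> k - q" "k - q < k" "k = k - q + q"
      using m' q m by auto
    then show ?thesis using less.IH[of "k - q"] add[OF _ gens(1)] by metis
  qed
qed

lemma eqI:
  assumes H: "S \<subseteq> H" and card: "card (H \<inter> {..m * (q + 1)}) \<le> (\<Sum>a<m. 3 * (m - a))"
  shows "H = S"
proof -
  have "S \<inter> {..m * (q + 1)} = H \<inter> {..m * (q + 1)}"
    using H card card_ge by (intro card_seteq) auto
  moreover have "k \<in> S" if "k > m * (q + 1)" for k
    using that by (intro conductor) (use m q in \<open>cases m; simp\<close>)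
  ultimately show ?thesis using H by (auto simp: set_eq_iff) (metis not_le)
qed

end

section \<open>The finite field of constants\<close>

context
  fixes K :: "'a::field set"
  assumes K: "is_subfield K" "finite K"
begin

text \<open>Translation by 1 permutes \<open>K\<close>, and so leaves the sum of its elements
  unchanged.\<close>

lemma subfield_char: "of_nat (card K) = (0 :: 'a)"
proof -
  note cl = subring_closed[OF subfield_subring[OF K(1)]]
  have "(\<Sum>k\<in>K. k) = (\<Sum>k\<in>K. k + 1)"
    by (rule sum.reindex_bij_witness[of _ "\<lambda>k. k + 1" "\<lambda>k. k - 1"]) (auto intro: cl)
  also have "\<dots> = (\<Sum>k\<in>K. k) + of_nat (card K)" by (simp add: sum.distrib)
  finally show ?thesis by simp
qed

lemma subfield_fermat:
  assumes "a \<in> K" "a \<noteq> 0" shows "a ^ (card K - 1) = 1"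
proof -
  note cl = subring_closed[OF subfield_subring[OF K(1)]]
  have "(\<Prod>k\<in>K - {0}. k) = (\<Prod>k\<in>K - {0}. a * k)"
    by (rule prod.reindex_bij_witness[of _ "\<lambda>k. a * k" "\<lambda>k. inverse a * k"])
      (use assms in \<open>auto intro: cl subfield_inverse[OF K(1)] simp flip: mult.assoc\<close>)
  also have "\<dots> = a ^ card (K - {0}) * (\<Prod>k\<in>K - {0}. k)" by (simp add: prod.distrib)
  finally have "a ^ card (K - {0}) = 1" using K(2) by simp
  moreover have "card (K - {0}) = card K - 1" using cl(1) K(2) by simp
  ultimately show ?thesis by simp
qed

lemma card_power_roots_le:
  assumes "k > 0" shows "card {x \<in> K. x ^ k = c} \<le> k"
proof -
  have deg: "degree (monom (1 :: 'a) k + [:- c:]) = k"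
    using assms by (simp add: degree_add_eq_left degree_monom_eq)
  then have nz: "monom (1 :: 'a) k + [:- c:] \<noteq> 0" using assms by auto
  have "card {x \<in> K. x ^ k = c} \<le> card {x. poly (monom (1 :: 'a) k + [:- c:]) x = 0}"
    by (rule card_mono[OF poly_roots_finite[OF nz]]) (auto simp: poly_monom)
  also have "\<dots> \<le> k" using card_poly_roots_bound[OF nz] deg by simp
  finally show ?thesis .
qed

text \<open>The map \<open>x \<mapsto> x^l\<close> sends the nonzero elements to \<open>k\<close>-th
  roots of unity with fibres of size at most \<open>l\<close>, so there are at least
  \<open>k\<close> such roots.\<close>

lemma card_unit_roots:
  assumes kl: "k * l = card K - 1" "k > 0" "l > 0"
  shows "card {x \<in> K. x ^ k = 1} = k"
proof (rule antisym[OF card_power_roots_le[OF kl(2)]])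
  note cl = subring_closed[OF subfield_subring[OF K(1)]]
  let ?A = "K - {0}" and ?B = "{x \<in> K. x ^ k = 1}"
  have sub: "(\<lambda>x. x ^ l) ` ?A \<subseteq> ?B"
    using subfield_fermat kl by (auto intro: cl simp: mult.commute simp flip: power_mult)
  have finB: "finite ?B" using K(2) by simp
  have "k * l = card ?A" using kl cl(1) K(2) by simp
  also have "?A = (\<Union>y\<in>?B. {x \<in> ?A. x ^ l = y})" using sub by auto
  also have "card \<dots> \<le> (\<Sum>y\<in>?B. card {x \<in> ?A. x ^ l = y})"
    by (rule card_UN_le[OF finB])
  also have "\<dots> \<le> (\<Sum>y\<in>?B. l)"
  proof (rule sum_mono)
    fix y
    have "card {x \<in> ?A. x ^ l = y} \<le> card {x \<in> K. x ^ l = y}"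
      using K(2) by (intro card_mono) auto
    then show "card {x \<in> ?A. x ^ l = y} \<le> l" using card_power_roots_le[OF kl(3), of y] by simp
  qed
  also have "\<dots> = card ?B * l" by simp
  finally show "k \<le> card ?B" using kl(3) by simp
qed

lemma subfield_frobenius:
  assumes q: "prime_power q" and card: "card K = q ^ 2"
  shows "of_nat q = (0 :: 'a)" "\<And>f g :: 'a. (f + g) ^ q = f ^ q + g ^ q"
proof -
  obtain p k where pk: "prime p" "k > 0" "q = p ^ k" using q by (auto simp: prime_power_def)
  have "of_nat p ^ (2 * k) = (0 :: 'a)"
    using subfield_char card pk by (simp add: power_mult mult.commute power_even_eq)
  then have p0: "of_nat p = (0 :: 'a)" by simp
  then have "CHAR('a) dvd p" by (simp add: of_nat_eq_0_iff_char_dvd)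
  then have char: "CHAR('a) = p" using pk(1) by (auto simp: prime_nat_iff)
  show "of_nat q = (0 :: 'a)" using p0 pk by simp
  show "(f + g) ^ q = f ^ q + g ^ q" for f g :: 'a
    using freshmans_dream'[of q k f g] pk char by simp
qed

end

section \<open>Local analysis at the point\<close>

lemma vge_1_of_power:
  assumes "is_subfield K" "place_val K w" "n > 0" "vge w 1 (f ^ n)"
  shows "vge w 1 f"
proof (cases "f = 0")
  case False
  then have "int n * w f \<ge> 1" using assms place_power[OF assms(1,2) False, of n] by (simp add: vge_def)
  then have "w f > 0" using zero_less_mult_pos[of "int n" "w f"] assms(3) by auto
  then show ?thesis by (simp add: vge_def)
qed simp

text \<open>The point has \<open>X = e^3\<close>, \<open>Y = e * be\<close>, and hence
  \<open>Z = be^3\<close>, with \<open>1 + e + be = 0\<close>. The condition \<open>e3\<close> is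
  the hypothesis on \<open>\<alpha>(P)\<close>; geometrically it says that the point is not the
  node.\<close>

locale curve_point = kummer_curve +
  fixes q :: nat and v :: "'a \<Rightarrow> int" and \<zeta> be :: 'a
  assumes q: "q + 1 = 3 * m" and m2: "m \<ge> 2"
    and q0: "of_nat q = (0 :: 'a)" and frobenius: "\<And>f g :: 'a. (f + g) ^ q = f ^ q + g ^ q"
    and sign: "(- 1) ^ m = (1 :: 'a)"
    and e_frob: "e ^ q = e" and be_def: "be = - 1 - e" and be0: "be \<noteq> 0" and e3: "1 + e + e\<^sup>2 \<noteq> 0"
    and c_def: "e * c = - be"
    and v: "place_val K v" and vX: "v (X - e ^ 3) > 0" and vY: "v (Y - e * be) > 0"
    and zeta: "\<zeta> \<in> K" "\<zeta>\<^sup>2 + \<zeta> + 1 = 0"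
begin

lemmas Kcl = subring_closed[OF K_ring]

lemma n_one: "of_nat (3 * m) = (1 :: 'a)"
  using q q0 by (metis add_0 of_nat_1 of_nat_add)

lemma beK: "be \<in> K"
  unfolding be_def by (intro Kcl ce)

lemma be_frob: "be ^ q = be"
proof -
  have "(1 + e) ^ q + be ^ q = (1 + e + be) ^ q" by (simp add: frobenius)
  also have "\<dots> = 0" using q m2 by (simp add: be_def power_0_left)
  finally have "be ^ q = - (1 + e)" using frobenius[of 1 e] e_frob by (simp add: add_eq_0_iff2)
  then show ?thesis by (simp add: be_def)
qed

text \<open>\<open>T\<close> is the section of the cubic surface \<open>X Z = Y^3\<close> by the osculating plane at the point. This section is
  a nodal cubic with node at \<open>X = Y = Z = 1\<close>, and \<open>s\<close> parametrises it by the lines through the node.\<close>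

definition Z :: 'a where "Z = Y ^ 3 / X"
definition T :: 'a where "T = 1 + X + Z - 3 * Y"
definition \<delta> :: 'a where "\<delta> = Y - 1"
definition s :: 'a where "s = 1 - (X - 1) / \<delta>"
definition \<theta> :: 'a where "\<theta> = T * X / \<delta>\<^sup>2"

lemma XZ: "X * Z = Y ^ 3"
  using s_nonzero by (simp add: Z_def)

lemma Z_nonzero: "Z \<noteq> 0"
  using XZ Y_nonzero by auto

lemma Z_power: "Z ^ m = c * (X ^ m + e)"
proof -
  have "X ^ m * Z ^ m = X ^ m * (c * (X ^ m + e))"
    using Y_power by (simp add: XZ mult_ac flip: power_mult_distrib power_mult)
  then show ?thesis using s_nonzero by simp
qed

lemma curve_equation: "be * X ^ m + e * Z ^ m + e * be = 0"
proof -
  have "e * Z ^ m = (e * c) * (X ^ m + e)" by (simp add: Z_power)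
  then show ?thesis unfolding c_def by (simp add: algebra_simps)
qed

lemma X_not_const: "a \<in> K \<Longrightarrow> X \<noteq> a"
proof
  assume a: "a \<in> K" "X = a"
  have "[:- a, 1:] \<in> polys_over K" using a by (intro polys_over_closed[OF K_ring] Kcl)
  from poly_nonzero[OF this] show False using a by simp
qed

text \<open>Any place at the point, not only \<open>v\<close>: that there is no other is proved by
  treating all of them at once.\<close>

definition centered :: "('a \<Rightarrow> int) \<Rightarrow> bool" where
  "centered w \<longleftrightarrow> place_val K w \<and> res K w X (e ^ 3) \<and> res K w Y (e * be)"

lemma centered_v: "centered v"
  using v vX vY ce beK unfolding centered_def res_def vge_def
  by (auto intro: Kcl)

lemma res_Z: "centered w \<Longrightarrow> res K w Z (be ^ 3)"
proof -
  assume c: "centered w"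
  then have w: "place_val K w" by (simp add: centered_def)
  have "res K w Z ((e * be) ^ 3 / e ^ 3)"
    unfolding Z_def using c ce by (intro res_divide[OF K w] res_power[OF K w]) (auto simp: centered_def)
  then show ?thesis using ce by (simp add: power_mult_distrib)
qed

text \<open>The residue of \<open>\<delta>\<close> at the point; it equals
  \<open>- (1 + e + e\<^sup>2)\<close>, so it vanishes only at the node.\<close>

definition d0 :: 'a where "d0 = e * be - 1"

lemma d0: "d0 \<noteq> 0" "d0 \<in> K"
proof -
  have "d0 = - (1 + e + e\<^sup>2)" unfolding d0_def by (simp add: be_def power2_eq_square algebra_simps)
  then show "d0 \<noteq> 0" using e3 neg_equal_0_iff_equal by metis
  show "d0 \<in> K" unfolding d0_def using ce beK by (intro Kcl)
qed

lemma res_\<delta>: assumes c: "centered w" shows "res K w \<delta> d0"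
proof -
  have w: "place_val K w" using c by (simp add: centered_def)
  show ?thesis
    unfolding \<delta>_def d0_def using c by (intro res_diff[OF K w] res_1[OF K w]) (auto simp: centered_def)
qed

lemma \<delta>_nonzero: "\<delta> \<noteq> 0"
  using res_unit(1)[OF K v res_\<delta>[OF centered_v] d0(1)] .

lemma res_s: assumes c: "centered w" shows "res K w s e"
proof -
  have w: "place_val K w" using c by (simp add: centered_def)
  have "res K w s (1 - (e ^ 3 - 1) / d0)"
    unfolding s_def using c res_\<delta>[OF c] d0
    by (intro res_diff[OF K w] res_divide[OF K w] res_1[OF K w]) (auto simp: centered_def)
  also have "1 - (e ^ 3 - 1) / d0 = e"
  proof -
    have "e ^ 3 - 1 = (1 - e) * d0"
      unfolding d0_def by (simp add: be_def power3_eq_cube algebra_simps)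
    then show ?thesis using d0 by simp
  qed
  finally show ?thesis .
qed

lemma X_eq_\<delta>: "X = 1 + (1 - s) * \<delta>"
  using \<delta>_nonzero by (simp add: s_def)

lemma Y_eq_\<delta>: "Y = 1 + \<delta>"
  by (simp add: \<delta>_def)

lemma Z_eq_\<delta>: "Z = T + 1 + (2 + s) * \<delta>"
proof -
  have "Z = T - 1 - X + 3 * Y" by (simp add: T_def)
  also have "\<dots> = T - 1 - (1 + (1 - s) * \<delta>) + 3 * (1 + \<delta>)"
    using X_eq_\<delta> Y_eq_\<delta> by metis
  finally show ?thesis by (simp add: algebra_simps)
qed

text \<open>Substitute the expressions in \<open>s\<close> and \<open>\<delta>\<close> into
  \<open>X Z = Y^3\<close>. The terms of degree 0 and 1 in \<open>\<delta>\<close> cancel because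
  \<open>\<delta> = 0\<close> is the node, and dividing by \<open>\<delta>\<^sup>2\<close> leaves
  the claim.\<close>

lemma \<theta>_eq: "\<theta> = Y + s + s\<^sup>2"
proof -
  have "X * (T + 1 + (2 + s) * \<delta>) = (1 + \<delta>) ^ 3"
    using XZ Z_eq_\<delta> Y_eq_\<delta> by metis
  then have "T * X = (1 + \<delta>) ^ 3 - (1 + (1 - s) * \<delta>) * (1 + (2 + s) * \<delta>)"
    using X_eq_\<delta> by (metis (no_types, lifting) add.assoc add_diff_cancel_right' distrib_left mult.commute)
  also have "\<dots> = \<delta>\<^sup>2 * (1 + \<delta> + s + s\<^sup>2)"
    by (simp add: power2_eq_square power3_eq_cube algebra_simps)
  finally show ?thesis
    using \<delta>_nonzero Y_eq_\<delta> by (simp add: \<theta>_def)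
qed

lemma \<delta>_eq_\<theta>: "\<delta> = \<theta> - (1 + s + s\<^sup>2)"
  by (simp add: \<theta>_eq \<delta>_def)

lemma X_eq: "X = s ^ 3 + (1 - s) * \<theta>"
proof -
  have "X = 1 + (1 - s) * (\<theta> - (1 + s + s\<^sup>2))" using X_eq_\<delta> \<delta>_eq_\<theta> by metis
  then show ?thesis by (simp add: power2_eq_square power3_eq_cube algebra_simps)
qed

lemma Z_eq: "Z = - ((1 + s) ^ 3) + (T + (2 + s) * \<theta>)"
proof -
  have "Z = T + 1 + (2 + s) * (\<theta> - (1 + s + s\<^sup>2))" using Z_eq_\<delta> \<delta>_eq_\<theta> by metis
  then show ?thesis by (simp add: power2_eq_square power3_eq_cube algebra_simps)
qed

text \<open>Cofactors in \<open>X^m - (s^3)^m\<close> and in the analogous difference for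
  \<open>Z\<close>; \<open>\<kappa>\<close> collects what multiplies \<open>T\<close> when the curve
  equation is expanded around the nodal cubic.\<close>

definition S1 :: 'a where "S1 = (\<Sum>i<m. (s ^ 3) ^ (m - Suc i) * X ^ i)"
definition S2 :: 'a where "S2 = (\<Sum>i<m. (- ((1 + s) ^ 3)) ^ (m - Suc i) * Z ^ i)"
definition \<kappa> :: 'a where
  "\<kappa> = be * (1 - s) * (X / \<delta>\<^sup>2) * S1 + e * (1 + (2 + s) * (X / \<delta>\<^sup>2)) * S2"

text \<open>Modulo \<open>T\<close> the point \<open>(X, Y, Z)\<close> is \<open>(s^3, - s - s^2, - (1 + s)^3)\<close>, and there the curve equation
  \<open>be X^m + e Z^m + e be = 0\<close> reads \<open>(s - e)^(q+1) = 0\<close>.\<close>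

lemma T_\<kappa>: "T * \<kappa> = (s - e) ^ (q + 1)"
proof -
  have "X ^ m = (s ^ 3) ^ m + (1 - s) * \<theta> * S1"
  proof -
    have "X ^ m - (s ^ 3) ^ m = (X - s ^ 3) * S1" unfolding S1_def by (rule power_diff_sumr2)
    also have "X - s ^ 3 = (1 - s) * \<theta>" using X_eq by (metis add_diff_cancel_left')
    finally show ?thesis by (simp add: algebra_simps)
  qed
  moreover have "Z ^ m = (- ((1 + s) ^ 3)) ^ m + (T + (2 + s) * \<theta>) * S2"
  proof -
    have "Z ^ m - (- ((1 + s) ^ 3)) ^ m = (Z - (- ((1 + s) ^ 3))) * S2"
      unfolding S2_def by (rule power_diff_sumr2)
    also have "Z - (- ((1 + s) ^ 3)) = T + (2 + s) * \<theta>" using Z_eq by (metis add_diff_cancel_left')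
    finally show ?thesis by (simp add: algebra_simps)
  qed
  moreover have "(s ^ 3) ^ m = s ^ q * s"
    using q by (metis power_Suc2 power_mult Suc_eq_plus1)
  moreover have "(- ((1 + s) ^ 3)) ^ m = (1 + s ^ q) * (1 + s)"
  proof -
    have "(- ((1 + s) ^ 3)) ^ m = (- 1) ^ m * ((1 + s) ^ 3) ^ m"
      by (metis power_mult_distrib mult_minus1)
    also have "\<dots> = (1 + s) ^ q * (1 + s)"
      using q sign by (metis power_Suc2 power_mult Suc_eq_plus1 mult_1)
    finally show ?thesis by (simp add: frobenius)
  qed
  moreover have \<theta>: "\<theta> = T * (X / \<delta>\<^sup>2)" by (simp add: \<theta>_def)
  ultimately have "0 = be * (s ^ q * s + (1 - s) * (T * (X / \<delta>\<^sup>2)) * S1)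
      + e * ((1 + s ^ q) * (1 + s) + (T + (2 + s) * (T * (X / \<delta>\<^sup>2))) * S2) + e * be"
    using curve_equation by metis
  also have "\<dots> = T * \<kappa> + (be * (s ^ q * s) + e * ((1 + s ^ q) * (1 + s)) + e * be)"
  proof -
    have "be * (A + (1 - s) * (T * R) * S1) + e * (B + (T + (2 + s) * (T * R)) * S2) + e * be
      = T * (be * (1 - s) * R * S1 + e * (1 + (2 + s) * R) * S2) + (be * A + e * B + e * be)"
      for A B R :: 'a by (simp add: algebra_simps)
    then show ?thesis unfolding \<kappa>_def .
  qed
  also have "be * (s ^ q * s) + e * ((1 + s ^ q) * (1 + s)) + e * be = - ((s ^ q - e) * (s - e))"
    by (simp add: be_def algebra_simps)
  finally have "T * \<kappa> = (s ^ q - e) * (s - e)" by (simp add: algebra_simps)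
  moreover have "s ^ q - e = (s - e) ^ q"
    using frobenius[of "s - e" e] e_frob by simp
  ultimately show ?thesis by simp
qed

text \<open>The residue times \<open>d0\<^sup>2 * be * e\<close> is
  \<open>m * e\<^sup>2 * be\<^sup>2 * (1 + e + e\<^sup>2)\<close>, which is nonzero. Hence
  \<open>T\<close> has exactly the order of \<open>(s - e)^(q+1)\<close>.\<close>

lemma \<kappa>_residue:
  assumes c: "centered w"
  shows "\<kappa> \<noteq> 0" "w \<kappa> = 0"
proof -
  have w: "place_val K w" using c by (simp add: centered_def)
  note r = res_add[OF K w] res_diff[OF K w] res_mult[OF K w] res_divide[OF K w]
    res_power[OF K w] res_uminus[OF K w]
  have rX: "res K w X (e ^ 3)" using c by (simp add: centered_def)
  note rs = res_s[OF c] and rZ = res_Z[OF c]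
  \<comment> \<open>Both follow from \<open>x^(3 m) = x^(q+1) = x^2\<close> for elements fixed by
    the \<open>q\<close>-th power.\<close>
  have pe: "(e ^ 3) ^ (m - 1) * e = 1" "(be ^ 3) ^ (m - 1) * be = 1"
  proof -
    have "(x ^ 3) ^ (m - 1) * x = 1" if x: "x ^ q = x" "x \<noteq> 0" for x :: 'a
    proof -
      have "(x ^ 3) ^ (m - 1) * x ^ 3 = (x ^ 3) ^ m" using m2 by (metis power_minus_mult zero_less_numeral less_le_trans)
      also have "\<dots> = x ^ q * x" using q by (metis power_Suc2 power_mult Suc_eq_plus1)
      finally have "x\<^sup>2 * ((x ^ 3) ^ (m - 1) * x) = x\<^sup>2 * 1"
        using x by (simp add: power2_eq_square power3_eq_cube mult_ac)
      then show ?thesis using x by simp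
    qed
    then show "(e ^ 3) ^ (m - 1) * e = 1" "(be ^ 3) ^ (m - 1) * be = 1"
      using e_frob be_frob ce be0 by auto
  qed
  have const_sum: "(\<Sum>i<m. a ^ (m - Suc i) * a ^ i) = of_nat m * a ^ (m - 1)" for a :: 'a
  proof -
    have "(\<Sum>i<m. a ^ (m - Suc i) * a ^ i) = (\<Sum>i<m. a ^ (m - 1))"
      by (rule sum.cong) (auto simp flip: power_add)
    then show ?thesis by simp
  qed
  have rS1: "res K w S1 (of_nat m * (e ^ 3) ^ (m - 1))"
    unfolding S1_def const_sum[symmetric] by (intro res_sum[OF K w] r rs rX)
  have "res K w (- ((1 + s) ^ 3)) (- ((1 + e) ^ 3))"
    by (intro r rs res_1[OF K w])
  moreover have "- ((1 + e) ^ 3) = be ^ 3"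
    by (simp add: be_def power3_eq_cube algebra_simps)
  ultimately have rS2: "res K w S2 (of_nat m * (be ^ 3) ^ (m - 1))"
    unfolding S2_def const_sum[symmetric] by (intro res_sum[OF K w] r rZ) simp
  have rX\<delta>: "res K w (X / \<delta>\<^sup>2) (e ^ 3 / d0\<^sup>2)"
    using rX res_\<delta>[OF c] d0 by (intro r) auto
  let ?k = "be * (1 - e) * (e ^ 3 / d0\<^sup>2) * (of_nat m * (e ^ 3) ^ (m - 1))
    + e * (1 + (2 + e) * (e ^ 3 / d0\<^sup>2)) * (of_nat m * (be ^ 3) ^ (m - 1))"
  have rk: "res K w \<kappa> ?k"
    unfolding \<kappa>_def
    by (intro r rs rS1 rS2 rX\<delta> res_1[OF K w] res_numeral[OF K w] res_const[OF K w] ce beK)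
  \<comment> \<open>The factor clears the denominator \<open>d0\<^sup>2\<close> and supplies the
    \<open>e\<close> and \<open>be\<close> that turn the high powers into 1 by
    \<open>pe\<close>.\<close>
  have "d0\<^sup>2 * be * e * ?k = of_nat m *
    (be\<^sup>2 * (1 - e) * e ^ 3 * ((e ^ 3) ^ (m - 1) * e) + e\<^sup>2 * (d0\<^sup>2 + (2 + e) * e ^ 3) * ((be ^ 3) ^ (m - 1) * be))"
  proof -
    have *: "D * be * e * (be * (1 - e) * (E / D) * (M * A) + e * (1 + (2 + e) * (E / D)) * (M * B))
      = M * (be\<^sup>2 * (1 - e) * E * (A * e) + e\<^sup>2 * (D + (2 + e) * E) * (B * be))"
      if "D \<noteq> 0" for D E M A B :: 'a
      using that by (simp add: field_simps power2_eq_square)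
    show ?thesis by (rule *) (use d0 in simp)
  qed
  also have "\<dots> = of_nat m * (be\<^sup>2 * (1 - e) * e ^ 3 + e\<^sup>2 * (d0\<^sup>2 + (2 + e) * e ^ 3))"
    unfolding pe by simp
  also have "be\<^sup>2 * (1 - e) * e ^ 3 + e\<^sup>2 * (d0\<^sup>2 + (2 + e) * e ^ 3) = e\<^sup>2 * be\<^sup>2 * (1 + e + e\<^sup>2)"
    unfolding d0_def by (simp add: be_def power2_eq_square power3_eq_cube algebra_simps)
  finally have "d0\<^sup>2 * be * e * ?k \<noteq> 0"
    using m_nonzero ce be0 e3 by simp
  then have "?k \<noteq> 0" by (rule contrapos_nn) (simp only: mult_zero_right)
  from res_unit[OF K w rk this] show "\<kappa> \<noteq> 0" "w \<kappa> = 0" .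
qed

lemma T_nonzero: "T \<noteq> 0"
proof
  assume T: "T = 0"
  then have "s = e" using T_\<kappa> by auto
  moreover have "\<theta> = 0" using T by (simp add: \<theta>_def)
  ultimately have "X = e ^ 3" using X_eq by simp
  then show False using X_not_const[of "e ^ 3"] ce by (auto intro: Kcl)
qed

lemma s_minus_e_nonzero: "s - e \<noteq> 0"
  using T_\<kappa> T_nonzero \<kappa>_residue(1)[OF centered_v] by auto

lemma place_T: assumes c: "centered w" shows "w T = int (q + 1) * w (s - e)"
proof -
  have w: "place_val K w" using c by (simp add: centered_def)
  have "w (T * \<kappa>) = w T + w \<kappa>"
    by (rule place_mult[OF K w T_nonzero \<kappa>_residue(1)[OF c]])
  then show ?thesis
    using T_\<kappa> \<kappa>_residue(2)[OF c] place_power[OF K w s_minus_e_nonzero, of "q + 1"] by simp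
qed

section \<open>Smoothness of the point and uniqueness of its place\<close>

definition RR :: "'a set" where "RR = adjoin (adjoin K X) Y"

lemma RR_subring: "is_subring RR"
  unfolding RR_def by (rule adjoin_subring[OF adjoin_subring[OF K_ring]])

lemma RR_gens: "K \<subseteq> RR" "X \<in> RR" "Y \<in> RR"
proof -
  have A: "adjoin K X \<subseteq> RR" unfolding RR_def by (rule adjoin_superset[OF adjoin_subring[OF K_ring]])
  then show "K \<subseteq> RR" "X \<in> RR" using adjoin_superset[OF K_ring] adjoin_self[OF K_ring] by blast+
  show "Y \<in> RR" unfolding RR_def by (rule adjoin_self[OF adjoin_subring[OF K_ring]])
qed

lemmas RRcl = subring_closed[OF RR_subring]

abbreviation "x0 \<equiv> e ^ 3"
abbreviation "y0 \<equiv> e * be"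

lemma x0y0: "x0 \<in> K" "y0 \<in> K"
  using ce beK by (auto intro: Kcl)

text \<open>First-order expansion at the point: the elements having one form a ring that contains
  \<open>K\<close>, \<open>X\<close> and \<open>Y\<close>.\<close>

lemma RR_decomposition:
  assumes "f \<in> RR"
  shows "\<exists>k\<in>K. \<exists>g\<in>RR. \<exists>h\<in>RR. f = k + (X - x0) * g + (Y - y0) * h"
proof -
  define A where "A = {f \<in> RR. \<exists>k\<in>K. \<exists>g\<in>RR. \<exists>h\<in>RR. f = k + (X - x0) * g + (Y - y0) * h}"
  have AI: "f \<in> A" if "k \<in> K" "g \<in> RR" "h \<in> RR" "f = k + (X - x0) * g + (Y - y0) * h" for f k g h
  proof -
    have "k + (X - x0) * g + (Y - y0) * h \<in> RR"
      using that(1-3) RR_gens ce beK by (intro RRcl) auto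
    then show ?thesis using that unfolding A_def by blast
  qed
  have AE: thesis if "f \<in> A"
    "\<And>k g h. f \<in> RR \<Longrightarrow> k \<in> K \<Longrightarrow> g \<in> RR \<Longrightarrow> h \<in> RR \<Longrightarrow> f = k + (X - x0) * g + (Y - y0) * h \<Longrightarrow> thesis"
    for f thesis using that unfolding A_def by blast
  have KA: "K \<subseteq> A"
    using AI[OF _ RRcl(1) RRcl(1)] by auto
  have "X \<in> A" by (rule AI[OF x0y0(1) RRcl(2) RRcl(1)]) simp
  have "Y \<in> A" by (rule AI[OF x0y0(2) RRcl(1) RRcl(2)]) simp
  have sub: "is_subring A"
  proof (rule is_subringI)
    show "0 \<in> A" "1 \<in> A" using KA Kcl(1,2) by auto
  next
    fix f f' assume "f \<in> A" "f' \<in> A"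
    from \<open>f \<in> A\<close> obtain k g h where 1: "f \<in> RR" "k \<in> K" "g \<in> RR" "h \<in> RR"
      "f = k + (X - x0) * g + (Y - y0) * h" by (rule AE)
    from \<open>f' \<in> A\<close> obtain k' g' h' where 2: "f' \<in> RR" "k' \<in> K" "g' \<in> RR" "h' \<in> RR"
      "f' = k' + (X - x0) * g' + (Y - y0) * h'" by (rule AE)
    have "f + f' = (k + k') + (X - x0) * (g + g') + (Y - y0) * (h + h')"
      by (subst 1(5), subst 2(5)) (simp add: algebra_simps)
    then show "f + f' \<in> A"
      by (rule AI[OF Kcl(3)[OF 1(2) 2(2)] RRcl(3)[OF 1(3) 2(3)] RRcl(3)[OF 1(4) 2(4)]])
    have kR: "k \<in> RR" using 1 RR_gens by blast
    have "f * f' = k * f' + (X - x0) * (g * f') + (Y - y0) * (h * f')"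
      by (subst 1(5)) (simp add: algebra_simps)
    also have "k * f' = k * k' + (X - x0) * (k * g') + (Y - y0) * (k * h')"
      by (subst 2(5)) (simp add: algebra_simps)
    finally have "f * f' = k * k' + (X - x0) * (k * g' + g * f') + (Y - y0) * (k * h' + h * f')"
      by (simp add: algebra_simps)
    moreover have "k * g' + g * f' \<in> RR" "k * h' + h * f' \<in> RR" "k * k' \<in> K"
      using 1(1-4) 2(1-4) kR by (auto intro!: RRcl(3,5) Kcl(5))
    ultimately show "f * f' \<in> A" using AI by blast
  next
    fix f assume "f \<in> A"
    then obtain k g h where 1: "f \<in> RR" "k \<in> K" "g \<in> RR" "h \<in> RR"
      "f = k + (X - x0) * g + (Y - y0) * h" by (rule AE)
    have "- f = - k + (X - x0) * - g + (Y - y0) * - h"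
      by (subst 1(5)) (simp add: algebra_simps)
    then show "- f \<in> A"
      by (rule AI[OF Kcl(6)[OF 1(2)] RRcl(6)[OF 1(3)] RRcl(6)[OF 1(4)]])
  qed
  have "RR \<subseteq> A"
    unfolding RR_def
    by (intro adjoin_least adjoin_subring[OF K_ring] sub KA K_ring \<open>X \<in> A\<close> \<open>Y \<in> A\<close>)
  then show ?thesis using assms unfolding A_def by blast
qed

lemma point_equation: "y0 ^ n = c * x0 ^ m * (x0 ^ m + e)"
proof -
  have c: "res K v X x0" "res K v Y y0" using centered_v by (auto simp: centered_def)
  have "res K v (Y ^ n) (y0 ^ n)" by (intro res_power[OF K v] c)
  moreover have "res K v (Y ^ n) (c * x0 ^ m * (x0 ^ m + e))"
    unfolding Y_power
    by (intro res_mult[OF K v] res_add[OF K v] res_power[OF K v] c res_const[OF K v] ce)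
  ultimately show ?thesis by (rule res_unique[OF K v])
qed

text \<open>Subtract the equation of the point from that of the curve and divide out
  \<open>Y - y0\<close> and \<open>X - x0\<close>. The cofactor \<open>U\<close> has residue
  \<open>n * y0^(n-1)\<close>, the partial derivative in \<open>Y\<close>, where \<open>n\<close> is
  1 in the field.\<close>

lemma smooth_point:
  "\<exists>U\<in>RR. \<exists>W\<in>RR. U * (Y - y0) = (X - x0) * W \<and> (\<forall>w. centered w \<longrightarrow> U \<noteq> 0 \<and> w U = 0)"
proof -
  define U where "U = (\<Sum>i<n. y0 ^ (n - Suc i) * Y ^ i)"
  define W1 where "W1 = (\<lambda>k. \<Sum>i<k. x0 ^ (k - Suc i) * X ^ i)"
  have W1: "X ^ k - x0 ^ k = (X - x0) * W1 k" for k unfolding W1_def by (rule power_diff_sumr2)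
  have W1R: "W1 k \<in> RR" for k
    unfolding W1_def using ce RR_gens by (intro RRcl) auto
  have UR: "U \<in> RR"
    unfolding U_def using ce beK RR_gens by (intro RRcl) auto
  have "U * (Y - y0) = Y ^ n - y0 ^ n"
    unfolding U_def by (subst power_diff_sumr2) simp
  also have "\<dots> = c * (X ^ (2 * m) - x0 ^ (2 * m)) + c * e * (X ^ m - x0 ^ m)"
    unfolding Y_power point_equation by (simp add: algebra_simps power_mult power2_eq_square mult_2 power_add)
  also have "\<dots> = (X - x0) * (c * W1 (2 * m) + c * e * W1 m)"
    unfolding W1 by (simp only: algebra_simps)
  finally have "U * (Y - y0) = (X - x0) * (c * W1 (2 * m) + c * e * W1 m)" .
  moreover have "c * W1 (2 * m) + c * e * W1 m \<in> RR"
    using ce RR_gens W1R by (intro RRcl) auto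
  moreover have "U \<noteq> 0 \<and> w U = 0" if c: "centered w" for w
  proof -
    have w: "place_val K w" using c by (simp add: centered_def)
    have "res K w U (\<Sum>i<n. y0 ^ (n - Suc i) * y0 ^ i)"
      unfolding U_def using c x0y0
      by (intro res_sum[OF K w] res_mult[OF K w] res_power[OF K w] res_const[OF K w])
        (auto simp: centered_def)
    also have "(\<Sum>i<n. y0 ^ (n - Suc i) * y0 ^ i) = (\<Sum>i<n. y0 ^ (n - 1))"
      by (rule sum.cong) (auto simp flip: power_add)
    also have "\<dots> = y0 ^ (n - 1)" using n_one by (simp del: of_nat_mult)
    finally show ?thesis
      using res_unit[OF K w, of U "y0 ^ (n - 1)"] ce be0 by simp
  qed
  ultimately show ?thesis using UR by blast
qed

text \<open>A function vanishing at the point is, up to the unit \<open>U\<close>, a multiple of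
  \<open>X - x0\<close> by another element of \<open>RR\<close> of smaller value. No step depends on
  \<open>w\<close>, so one \<open>i\<close> serves all places at the point.\<close>

lemma RR_value:
  assumes "f \<in> RR" "f \<noteq> 0"
  shows "\<exists>i::int. \<forall>w. centered w \<longrightarrow> w f = i * w (X - x0)"
  using assms
proof (induction "nat (v f)" arbitrary: f rule: less_induct)
  case (less f)
  obtain U W where UW: "U \<in> RR" "W \<in> RR" "U * (Y - y0) = (X - x0) * W"
    and U: "\<And>w. centered w \<Longrightarrow> U \<noteq> 0 \<and> w U = 0" using smooth_point by blast
  obtain k g h where kgh: "k \<in> K" "g \<in> RR" "h \<in> RR" "f = k + (X - x0) * g + (Y - y0) * h"
    using RR_decomposition[OF less.prems(1)] by blast
  have X0: "X - x0 \<noteq> 0" using X_not_const[OF x0y0(1)] by simp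
  have cent: "place_val K w" "vge w 1 (X - x0)" "vge w 1 (Y - y0)" "vge w 0 g'"
    if c: "centered w" "g' \<in> RR" for w g'
  proof -
    show w: "place_val K w" and "vge w 1 (X - x0)" "vge w 1 (Y - y0)"
      using c by (auto simp: centered_def res_def)
    have "is_subring {f. vge w 0 f}"
      using vge_const[OF K w] Kcl(1,2)
      by (intro is_subringI) (auto intro: vge_add[OF K w] vge_uminus[OF K w] vge_mult_0[OF K w])
    then have "RR \<subseteq> {f. vge w 0 f}"
      unfolding RR_def using c vge_const[OF K w] res_vge[OF K w]
      by (intro adjoin_least adjoin_subring[OF K_ring] K_ring) (auto simp: centered_def)
    then show "vge w 0 g'" using c by auto
  qed
  show ?case
  proof (cases "k = 0")
    case False
    have "w f = 0" if c: "centered w" for w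
    proof -
      note w = cent(1)[OF c RRcl(1)]
      have "vge w 1 ((X - x0) * g + (Y - y0) * h)"
        using cent[OF c kgh(2)] cent[OF c kgh(3)]
        by (intro vge_add[OF K w] vge_mult_0[OF K w]) auto
      then have "res K w f k" using kgh by (simp add: res_def)
      then show ?thesis by (rule res_unit(2)[OF K w _ False])
    qed
    then show ?thesis by (intro exI[of _ 0]) auto
  next
    case True
    \<comment> \<open>The quotient of \<open>U * f\<close> by \<open>X - x0\<close>, after
      \<open>U * (Y - y0)\<close> is replaced by \<open>(X - x0) * W\<close>.\<close>
    define f1 where "f1 = U * g + W * h"
    have f1R: "f1 \<in> RR" unfolding f1_def using UW kgh by (intro RRcl)
    have "U * f = U * ((X - x0) * g) + (U * (Y - y0)) * h"
      by (subst kgh(4)) (simp add: True algebra_simps)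
    also have "\<dots> = (X - x0) * f1" unfolding UW(3) f1_def by (simp add: algebra_simps)
    finally have Uf: "U * f = (X - x0) * f1" .
    have f1: "f1 \<noteq> 0" using Uf U[OF centered_v] less.prems by auto
    have val: "w f = w (X - x0) + w f1" if c: "centered w" for w
    proof -
      note w = cent(1)[OF c RRcl(1)]
      have "w (U * f) = w U + w f" using U[OF c] less.prems by (intro place_mult[OF K w]) auto
      moreover have "w (U * f) = w (X - x0) + w f1" unfolding Uf by (rule place_mult[OF K w X0 f1])
      ultimately show ?thesis using U[OF c] by simp
    qed
    have "v (X - x0) > 0" using vX by simp
    moreover have "v f1 \<ge> 0" using cent(4)[OF centered_v f1R] f1 by (simp add: vge_def)
    ultimately have "nat (v f1) < nat (v f)" using val[OF centered_v] by simp
    from less.hyps[OF this f1R f1] obtain i where i: "\<And>w. centered w \<Longrightarrow> w f1 = i * w (X - x0)" by blast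
    then show ?thesis using val by (intro exI[of _ "i + 1"]) (simp add: algebra_simps)
  qed
qed

lemma value_multiple:
  assumes "f \<noteq> 0"
  shows "\<exists>i::int. \<forall>w. centered w \<longrightarrow> w f = i * w (X - x0)"
proof -
  let ?Q = "{f / g | f g. f \<in> RR \<and> g \<in> RR}"
  have "?Q = UNIV"
    using fractions_superset[OF RR_subring] RR_gens by (intro gen fractions_subfield[OF RR_subring]) auto
  then have "f \<in> ?Q" by simp
  then obtain g h where gh: "g \<in> RR" "h \<in> RR" "f = g / h" by blast
  then have nz: "g \<noteq> 0" "h \<noteq> 0" using assms by auto
  obtain i where i: "\<And>w. centered w \<Longrightarrow> w g = i * w (X - x0)" using RR_value[OF gh(1) nz(1)] by blast
  obtain j where j: "\<And>w. centered w \<Longrightarrow> w h = j * w (X - x0)" using RR_value[OF gh(2) nz(2)] by blast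
  have "w f = (i - j) * w (X - x0)" if c: "centered w" for w
  proof -
    have w: "place_val K w" using c by (simp add: centered_def)
    show ?thesis using i[OF c] j[OF c] gh(3) place_divide[OF K w nz] by (simp add: algebra_simps)
  qed
  then show ?thesis by blast
qed

text \<open>Some function has value 1, and this value is a multiple of
  \<open>w (X - x0)\<close>.\<close>

lemma uniformizer_X: assumes c: "centered w" shows "w (X - x0) = 1"
proof -
  have w: "place_val K w" using c by (simp add: centered_def)
  obtain t where t: "t \<noteq> 0" "w t = 1" using w by (auto simp: place_val_def)
  obtain i :: int where "\<forall>w. centered w \<longrightarrow> w t = i * w (X - x0)" using value_multiple[OF t(1)] by blast
  then have "i * w (X - x0) = 1" using c t by simp
  moreover have "w (X - x0) > 0"
    using c X_not_const[OF x0y0(1)] by (auto simp: centered_def res_def vge_def)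
  ultimately show ?thesis by (simp add: zmult_eq_1_iff)
qed

lemma centered_unique: assumes "centered w" "f \<noteq> 0" shows "w f = v f"
  using value_multiple[OF assms(2)] uniformizer_X[OF assms(1)] uniformizer_X[OF centered_v]
    assms(1) centered_v by (metis mult.right_neutral)

text \<open>If \<open>s - e\<close> vanished doubly, so would \<open>T\<close> and hence
  \<open>\<theta>\<close>; then \<open>X - x0\<close>, a combination of \<open>s - e\<close> and
  \<open>\<theta>\<close> with integral coefficients, would have order at least 2.\<close>

lemma uniformizer_s: "v (s - e) = 1"
proof -
  have ge: "vge v 1 (s - e)" using res_s[OF centered_v] by (simp add: res_def)
  have vs: "v (s - e) \<ge> 1" using ge s_minus_e_nonzero by (simp add: vge_def)
  have "\<not> v (s - e) \<ge> 2"
  proof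
    assume s2: "v (s - e) \<ge> 2"
    have rs: "vge v 0 s" by (rule res_vge[OF K v res_s[OF centered_v]])
    have ve: "vge v 0 e" by (rule vge_const[OF K v ce(3)])
    have "v T \<ge> 2"
    proof -
      have "v T = v (s - e) + int q * v (s - e)"
        using place_T[OF centered_v] by (simp add: algebra_simps)
      moreover have "0 \<le> int q * v (s - e)" using s2 by (intro mult_nonneg_nonneg) auto
      ultimately show ?thesis using s2 by linarith
    qed
    then have vT: "vge v 2 T" by (simp add: vge_def)
    have rX: "res K v (X / \<delta>\<^sup>2) (x0 / d0\<^sup>2)"
      using centered_v res_\<delta>[OF centered_v] d0
      by (intro res_divide[OF K v] res_power[OF K v]) (auto simp: centered_def)
    have "vge v 2 (T * (X / \<delta>\<^sup>2))" by (rule vge_mult_0[OF K v vT res_vge[OF K v rX]])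
    then have "vge v 2 \<theta>" by (simp add: \<theta>_def)
    then have "vge v 2 (\<theta> * (1 - s))"
      using rs vge_const[OF K v Kcl(2)] by (intro vge_mult_0[OF K v] vge_diff[OF K v])
    moreover have "vge v 2 ((s - e) * (s\<^sup>2 + s * e + e\<^sup>2))"
    proof (rule vge_mult_0[OF K v])
      show "vge v 2 (s - e)" using s2 by (simp add: vge_def)
      show "vge v 0 (s\<^sup>2 + s * e + e\<^sup>2)"
        using rs ve by (intro vge_add[OF K v] vge_power_0[OF K v] vge_mult_0[OF K v])
    qed
    ultimately have "vge v 2 ((s - e) * (s\<^sup>2 + s * e + e\<^sup>2) + \<theta> * (1 - s))"
      by (intro vge_add[OF K v])
    also have "(s - e) * (s\<^sup>2 + s * e + e\<^sup>2) + \<theta> * (1 - s) = X - x0"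
      by (subst X_eq) (simp add: power2_eq_square power3_eq_cube algebra_simps)
    finally show False
      using uniformizer_X[OF centered_v] X_not_const[OF x0y0(1)] by (simp add: vge_def)
  qed
  then show ?thesis using vs by simp
qed

lemma order_T: "v T = int (q + 1)"
  using place_T[OF centered_v] uniformizer_s by simp

end

section \<open>Forms of degree \<open>d\<close>, and the zeros and poles of \<open>T\<close>\<close>

context kummer_curve
begin

lemma good_const: "a \<in> K \<Longrightarrow> good 0 a"
  unfolding good_def using vge_const[OF K] by auto

lemma good_add: "good d f \<Longrightarrow> good d g \<Longrightarrow> good d (f + g)"
  unfolding good_def using vge_add[OF K] by blast

lemma good_mult: assumes f: "good d f" and g: "good d' g" shows "good (d + d') (f * g)"
  unfolding good_def
proof (intro allI impI conjI)
  fix w assume w: "place_val K w"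
  {
    assume X: "w X \<ge> 0"
    show "vge w 0 (f * g)" by (rule vge_mult_0[OF K w goodD(1)[OF f w X] goodD(1)[OF g w X]])
  next
    assume X: "w X < 0"
    show "vge w (int (d + d') * w X) (f * g)"
      using vge_mult[OF K w goodD(2)[OF f w X] goodD(2)[OF g w X]] by (simp add: distrib_right)
  }
qed

lemma good_mono: assumes f: "good d f" and "d \<le> d'" shows "good d' f"
  unfolding good_def
proof (intro allI impI conjI)
  fix w assume w: "place_val K w"
  {
    assume "w X \<ge> 0"
    then show "vge w 0 f" by (rule goodD(1)[OF f w])
  next
    assume X: "w X < 0"
    have "int d' * w X \<le> int d * w X" using X assms(2) by (intro mult_right_mono_neg) auto
    then show "vge w (int d' * w X) f" by (rule vge_mono[OF goodD(2)[OF f w X]])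
  }
qed

lemma good_scale: "a \<in> K \<Longrightarrow> good d f \<Longrightarrow> good d (a * f)"
  using good_mult[OF good_const] by fastforce

lemma good_1: "good 0 1"
  by (rule good_const[OF subring_1[OF K_ring]])

lemma good_power: "good d f \<Longrightarrow> good (k * d) (f ^ k)"
  by (induction k) (auto intro: good_1 good_mult)

lemma good_X: "good 1 X"
  by (auto simp: good_def vge_def)

lemma place_Y_nonneg: assumes w: "place_val K w" "w X \<ge> 0" shows "w (X ^ m + e) \<ge> 0" "w Y \<ge> 0"
proof -
  have "vge w 0 X" using w by (simp add: vge_def)
  then have "vge w 0 (poly Bp X)" by (rule vge_poly[OF K w(1) Bp(1)])
  then show B: "w (X ^ m + e) \<ge> 0" using B_nonzero by (simp add: Bp(3) vge_def)
  have "int n * w Y \<ge> 0" unfolding place_Y[OF w(1)] using B w(2) by simp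
  then show "w Y \<ge> 0" using m_pos by (simp add: zero_le_mult_iff)
qed

lemma good_Y: "good 1 Y"
  unfolding good_def using place_Y_nonneg(2) place_Y_pole by (fastforce simp: vge_def)

end

context curve_point
begin

lemma place_Z: "place_val K w \<Longrightarrow> int m * w Z = w (X ^ m + e)"
  using place_power[OF K _ Z_nonzero, of w m] place_mult[OF K, of w c "X ^ m + e"]
    place_const[OF K _ ce(1,2), of w] ce B_nonzero Z_power by simp

lemma place_Z_pole: assumes w: "place_val K w" "w X < 0" shows "w Z = w X"
proof -
  have "w (X ^ m + e) = int m * w X"
    using place_pole[OF w Bp(1,5)] Bp(2,3) by simp
  then show ?thesis using place_Z[OF w(1)] m_pos by simp
qed

lemma place_Z_nonneg: assumes w: "place_val K w" "w X \<ge> 0" shows "w Z \<ge> 0"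
proof -
  have "int m * w Z \<ge> 0" using place_Z[OF w(1)] place_Y_nonneg(1)[OF w] by simp
  then show ?thesis using m_pos by (simp add: zero_le_mult_iff)
qed

lemma good_Z: "good 1 Z"
  by (simp add: good_def vge_def place_Z_nonneg place_Z_pole)

lemma good_T: "good 1 T"
proof -
  have "good 1 (1 + X + Z + (- 3) * Y)"
    using good_mono[OF good_1, of 1]
    by (intro good_add good_scale good_X good_Y good_Z subring_uminus[OF K_ring] subring_numeral[OF K_ring])
      auto
  then show ?thesis by (simp add: T_def)
qed

text \<open>If \<open>\<delta>\<close> vanishes at \<open>w\<close>, the place lies over the node,
  where the curve equation would read \<open>1 + e + e\<^sup>2 = 0\<close>. Otherwise
  \<open>s\<close> and \<open>\<kappa>\<close> are integral,
  \<open>T * \<kappa> = (s - e)^(q+1)\<close> gives \<open>s\<close> the residue \<open>e\<close>,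
  and \<open>X\<close>, \<open>Y\<close> are determined by \<open>s\<close> and
  \<open>\<theta>\<close>.\<close>

lemma zero_T_centered:
  assumes w: "place_val K w" "w X \<ge> 0" "w T > 0"
  shows "centered w"
proof -
  note wr = res_add[OF K w(1)] res_diff[OF K w(1)] res_mult[OF K w(1)] res_power[OF K w(1)]
    res_uminus[OF K w(1)] res_1[OF K w(1)] res_numeral[OF K w(1)]
  have X: "vge w 0 X" and Y: "vge w 0 Y" and Z: "vge w 0 Z" and T: "vge w 1 T"
    using w place_Y_nonneg[OF w(1,2)] place_Z_nonneg[OF w(1,2)] by (auto simp: vge_def)
  have c0: "vge w 0 a" if "a \<in> K" for a by (rule vge_const[OF K w(1) that])
  have c1: "vge w 0 1" by (rule c0[OF Kcl(2)])
  note v0 = vge_add[OF K w(1)] vge_diff[OF K w(1)] vge_uminus[OF K w(1)] vge_mult_0[OF K w(1)]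
    vge_power_0[OF K w(1)]
  have \<delta>0: "vge w 0 \<delta>" unfolding \<delta>_def by (intro v0 Y c1)
  show ?thesis
  proof (cases "w \<delta> > 0")
    case True
    have rY: "res K w Y 1"
      using True Kcl(2) by (simp add: res_def vge_def \<delta>_def)
    have "res K w (X * Z) (1 ^ 3)" unfolding XZ by (intro wr rY)
    then have rXZ: "vge w 1 (X * Z - 1)" by (simp add: res_def)
    have rT: "res K w T 0" using T by (simp add: res_0_iff[OF K w(1)])
    have "res K w (T + 3 * Y - 1) (0 + 3 * 1 - 1)" by (intro wr rT rY)
    then have rs: "res K w (X + Z) 2" by (simp add: T_def)
    then have "vge w 1 (X + Z - 2)" by (simp add: res_def)
    \<comment> \<open>With \<open>X + Z = 2\<close> and \<open>X Z = 1\<close> modulo the place,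
      \<open>X\<close> is a double root of \<open>(X - 1)^2\<close>.\<close>
    from vge_diff[OF K w(1) vge_mult_0'[OF K w(1) X this] rXZ]
    have "vge w 1 (X * (X + Z - 2) - (X * Z - 1))" .
    also have "X * (X + Z - 2) - (X * Z - 1) = (X - 1) ^ 2" by (simp add: power2_eq_square algebra_simps)
    finally have "vge w 1 (X - 1)" by (rule vge_1_of_power[OF K w(1), of 2, rotated]) simp
    then have rX: "res K w X 1" using Kcl(2) by (simp add: res_def)
    have "res K w (X + Z - X) (2 - 1)" by (intro wr rs rX)
    then have rZ: "res K w Z 1" by simp
    have "res K w (be * X ^ m + e * Z ^ m + e * be) (be * 1 ^ m + e * 1 ^ m + e * be)"
      by (intro wr rX rZ res_const[OF K w(1)] beK ce)
    then have "res K w 0 (be + e + e * be)" unfolding curve_equation by simp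
    then have "be + e + e * be = 0"
      using res_unique[OF K w(1) _ res_const[OF K w(1) Kcl(1)]] by blast
    moreover have "be + e + e * be = - (1 + e + e\<^sup>2)"
      by (simp add: be_def power2_eq_square algebra_simps)
    ultimately show ?thesis using e3 neg_equal_0_iff_equal by metis
  next
    case False
    then have w\<delta>: "w \<delta> = 0" using \<delta>0 \<delta>_nonzero by (simp add: vge_def)
    have i\<delta>: "vge w 0 (inverse \<delta>)" by (rule vge_unit_inverse[OF K w(1) \<delta>_nonzero w\<delta>])
    have s0: "vge w 0 s"
      unfolding s_def divide_inverse by (intro v0 c1 X i\<delta>)
    have X\<delta>: "vge w 0 (X / \<delta>\<^sup>2)"
      unfolding divide_inverse power_inverse[symmetric] by (intro v0 X i\<delta>)
    have "vge w 1 \<theta>"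
      using vge_mult_0[OF K w(1) T X\<delta>] by (simp add: \<theta>_def)
    then have r\<theta>: "res K w \<theta> 0" by (simp add: res_0_iff[OF K w(1)])
    have S: "vge w 0 S1" "vge w 0 S2"
      unfolding S1_def S2_def
      by (intro vge_sum[OF K w(1)] v0 s0 X Z c1)+
    have "vge w 0 \<kappa>"
      unfolding \<kappa>_def by (intro v0 S X\<delta> s0 c1 c0 beK ce Kcl(10))
    then have "vge w 1 (T * \<kappa>)" by (rule vge_mult_0[OF K w(1) T])
    then have "vge w 1 (s - e)"
      unfolding T_\<kappa> by (rule vge_1_of_power[OF K w(1), rotated]) simp
    then have rs: "res K w s e" using ce by (simp add: res_def)
    have "res K w (s ^ 3 + (1 - s) * \<theta>) (e ^ 3 + (1 - e) * 0)"
      by (intro wr rs r\<theta>)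
    then have rX: "res K w X x0" by (simp flip: X_eq)
    have "res K w (\<theta> - s - s\<^sup>2) (0 - e - e\<^sup>2)" by (intro wr rs r\<theta>)
    moreover have "\<theta> - s - s\<^sup>2 = Y" by (simp add: \<theta>_eq)
    moreover have "0 - e - e\<^sup>2 = y0" by (simp add: be_def power2_eq_square algebra_simps)
    ultimately have "res K w Y y0" by simp
    then show ?thesis using rX w(1) by (simp add: centered_def)
  qed
qed

text \<open>Modulo the place only \<open>X + Z\<close> counts, since \<open>Y\<close> has a smaller
  pole. A residue \<open>- 1\<close> of \<open>Z / X\<close> would give \<open>e = - be\<close> by
  the curve equation and \<open>(- 1)^m = 1\<close>, against \<open>1 + e + be = 0\<close>.\<close>

lemma place_T_pole:
  assumes w: "place_val K w" "w X < 0"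
  shows "w T = w X"
proof -
  note X0 = s_nonzero
  define \<rho> where "\<rho> = Z / X"
  have \<rho>0: "\<rho> \<noteq> 0" "w \<rho> = 0"
    using Z_nonzero X0 place_divide[OF K w(1) Z_nonzero X0] place_Z_pole[OF w] by (auto simp: \<rho>_def)
  have iX: "vge w 1 (inverse X)" using w place_inverse[OF K w(1) X0] by (simp add: vge_def)
  have iY: "vge w 1 (Y / X)"
    using w place_divide[OF K w(1) Y_nonzero X0] place_Y_pole[OF w] by (simp add: vge_def)
  have v3: "vge w 0 (3 :: 'a)" by (rule vge_const[OF K w(1) Kcl(10)])
  have r0: "vge w 0 (1 + \<rho>)"
    using \<rho>0 vge_const[OF K w(1) Kcl(2)] by (intro vge_add[OF K w(1)]) (auto simp: vge_def)
  have "\<not> vge w 1 (1 + \<rho>)"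
  proof
    assume "vge w 1 (1 + \<rho>)"
    then have "res K w \<rho> (- 1)" using Kcl(2,6) by (simp add: res_def add.commute)
    then have "res K w (e * \<rho> ^ m) (e * (- 1) ^ m)"
      by (intro res_mult[OF K w(1)] res_power[OF K w(1)] res_const[OF K w(1)] ce)
    moreover have "e * \<rho> ^ m = - be - e * be * inverse X ^ m"
    proof -
      have "e * Z ^ m = - be * X ^ m - e * be" using curve_equation by (simp add: algebra_simps eq_neg_iff_add_eq_0)
      then have "e * \<rho> ^ m = (- be * X ^ m - e * be) / X ^ m" by (simp add: \<rho>_def power_divide)
      also have "\<dots> = - be - e * be * inverse X ^ m" using X0 by (simp add: field_simps)
      finally show ?thesis .
    qed
    moreover have "res K w (- be - e * be * inverse X ^ m) (- be - e * be * 0 ^ m)"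
      using iX by (intro res_diff[OF K w(1)] res_mult[OF K w(1)] res_power[OF K w(1)]
          res_const[OF K w(1)] Kcl(6) beK ce) (simp add: res_0_iff[OF K w(1)])
    ultimately have "e * (- 1) ^ m = - be - e * be * 0 ^ m"
      using res_unique[OF K w(1)] by metis
    then have "e = - be" using sign m_pos by (simp add: power_0_left)
    then show False by (simp add: be_def)
  qed
  then have r: "1 + \<rho> \<noteq> 0" "w (1 + \<rho>) = 0"
    using r0 by (auto simp: vge_def)
  have "vge w 1 (inverse X - Y / X * 3)"
    by (intro vge_diff[OF K w(1)] iX vge_mult_0[OF K w(1) iY v3])
  then have *: "1 + \<rho> + (inverse X - Y / X * 3) \<noteq> 0" "w (1 + \<rho> + (inverse X - Y / X * 3)) = 0"
    using place_dominant[OF K w(1) r(1)] r(2) by auto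
  have "T = X * (1 + \<rho> + (inverse X - Y / X * 3))"
    using X0 by (simp add: T_def \<rho>_def field_simps)
  then show ?thesis using place_mult[OF K w(1) X0 *(1)] *(2) by simp
qed

lemma zeta_facts: "\<zeta> ^ 3 = 1" "\<zeta> \<noteq> \<zeta>\<^sup>2" "(\<zeta>\<^sup>2) ^ 3 = 1" "\<zeta>\<^sup>2 \<in> K" "\<zeta> + \<zeta>\<^sup>2 = - 1" "\<zeta>\<^sup>2 + (\<zeta>\<^sup>2)\<^sup>2 = - 1"
proof -
  have z2: "\<zeta>\<^sup>2 = - 1 - \<zeta>" using zeta(2) by (simp add: eq_neg_iff_add_eq_0 algebra_simps)
  have "\<zeta> ^ 3 = \<zeta> * \<zeta>\<^sup>2" by (simp add: power3_eq_cube power2_eq_square)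
  also have "\<dots> = - \<zeta> - \<zeta>\<^sup>2" by (simp add: z2 power2_eq_square[symmetric] algebra_simps)
  finally show z3: "\<zeta> ^ 3 = 1" by (simp add: z2)
  then show "(\<zeta>\<^sup>2) ^ 3 = 1" by (metis power_mult mult.commute power_one)
  show "\<zeta>\<^sup>2 \<in> K" by (rule Kcl(7)[OF zeta(1)])
  show sum: "\<zeta> + \<zeta>\<^sup>2 = - 1" by (simp add: z2)
  have "(\<zeta>\<^sup>2)\<^sup>2 = \<zeta> ^ 3 * \<zeta>" by (simp add: power2_eq_square power3_eq_cube)
  then show "\<zeta>\<^sup>2 + (\<zeta>\<^sup>2)\<^sup>2 = - 1" using z3 sum by (simp add: add.commute)
  show "\<zeta> \<noteq> \<zeta>\<^sup>2"
  proof
    assume eq: "\<zeta> = \<zeta>\<^sup>2"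
    have "\<zeta> \<noteq> 0" using z3 by auto
    then have "\<zeta> = 1" using eq by (simp add: power2_eq_square)
    then have "(3 :: 'a) = 0" using zeta(2) by simp
    then have "of_nat (3 * m) = (0 :: 'a)" by simp
    then show False using m by simp
  qed
qed

section \<open>Forms as polynomials on the nodal cubic\<close>

text \<open>Congruence modulo order \<open>q + 1\<close> at the point, which is equality on the
  nodal cubic as far as the curve follows it. Integrality is included to make the relation
  compatible with products.\<close>

definition close :: "'a \<Rightarrow> 'a \<Rightarrow> bool" where
  "close G f \<longleftrightarrow> vge v 0 G \<and> vge v 0 f \<and> vge v (int (q + 1)) (G - f)"

lemma close_add: "close G f \<Longrightarrow> close G' f' \<Longrightarrow> close (G + G') (f + f')"
  using vge_add[OF K v, of "int (q + 1)" "G - f" "G' - f'"] vge_add[OF K v, of 0]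
  by (simp add: close_def algebra_simps)

lemma close_mult: assumes "close G f" "close G' f'" shows "close (G * G') (f * f')"
proof -
  have "vge v (int (q + 1)) ((G - f) * G')" "vge v (int (q + 1)) (f * (G' - f'))"
    using assms by (auto simp: close_def intro: vge_mult_0[OF K v] vge_mult_0'[OF K v])
  from vge_add[OF K v this] show ?thesis
    using assms by (simp add: close_def algebra_simps vge_mult_0[OF K v])
qed

lemma close_const: "a \<in> K \<Longrightarrow> close a a"
  by (simp add: close_def vge_const[OF K v])

lemma close_power: "close G f \<Longrightarrow> close (G ^ k) (f ^ k)"
  by (induction k) (auto intro: close_mult close_const Kcl(2))

lemma s_integral: "vge v 0 s"
  by (rule res_vge[OF K v res_s[OF centered_v]])

lemma theta_order: "vge v (int (q + 1)) \<theta>"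
proof -
  have vT: "vge v (int (q + 1)) T" using order_T by (simp add: vge_def)
  have rX: "res K v (X / \<delta>\<^sup>2) (x0 / d0\<^sup>2)"
    using centered_v res_\<delta>[OF centered_v] d0
    by (intro res_divide[OF K v] res_power[OF K v]) (auto simp: centered_def)
  have "vge v (int (q + 1)) (T * (X / \<delta>\<^sup>2))" by (rule vge_mult_0[OF K v vT res_vge[OF K v rX]])
  then show ?thesis by (simp add: \<theta>_def)
qed

lemma close_X: "close X (s ^ 3)"
proof -
  have "vge v (int (q + 1)) ((1 - s) * \<theta>)"
    using s_integral vge_const[OF K v Kcl(2)] theta_order
    by (intro vge_mult_0'[OF K v] vge_diff[OF K v])
  moreover have "X - s ^ 3 = (1 - s) * \<theta>" using X_eq by (metis add_diff_cancel_left')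
  moreover have "vge v 0 X" using centered_v res_vge[OF K v] by (auto simp: centered_def)
  ultimately show ?thesis
    unfolding close_def using s_integral vge_power_0[OF K v] by metis
qed

lemma close_Y: "close (- Y) (s + s\<^sup>2)"
proof -
  have "- Y - (s + s\<^sup>2) = - \<theta>" by (simp add: \<theta>_eq)
  moreover have "vge v 0 Y" using centered_v res_vge[OF K v] by (auto simp: centered_def)
  ultimately show ?thesis
    unfolding close_def using s_integral theta_order vge_uminus[OF K v] vge_power_0[OF K v] vge_add[OF K v]
    by metis
qed

text \<open>On the nodal cubic \<open>X\<close> and \<open>- Y\<close> become \<open>s^3\<close> and
  \<open>s + s\<^sup>2\<close>, so the monomials \<open>X^i * (- Y)^j\<close> attain every degree
  except 1, and each takes equal values on the two branches.\<close>

lemma leading_form: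
  assumes "2 \<le> k" "k \<le> 3 * d"
  shows "\<exists>M. \<exists>p\<in>polys_over K. good d M \<and> close M (poly p s) \<and> degree p = k \<and> lead_coeff p = 1 \<and>
    poly p \<zeta> = poly p (\<zeta>\<^sup>2)"
proof -
  let ?r = "[:0, 1, 1:] :: 'a poly"
  have rK: "?r \<in> polys_over K" by (intro polys_over_closed[OF K_ring] Kcl(1,2))
  have mK: "monom 1 i \<in> polys_over K" for i by (intro polys_over_monom[OF K_ring] Kcl(2))
  have gY: "good 1 (- Y)" using good_scale[OF Kcl(6)[OF Kcl(2)] good_Y] by simp
  have gen: ?thesis if k: "k = 3 * i + 2 * j" "i + j \<le> d" for i j
  proof (intro exI bexI conjI)
    let ?p = "monom 1 (3 * i) * ?r ^ j"
    show "good d (X ^ i * (- Y) ^ j)"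
      using good_mult[OF good_power[OF good_X, of i] good_power[OF gY, of j]] k(2)
      by (auto intro: good_mono)
    have ev: "poly ?p x = (x ^ 3) ^ i * (x + x\<^sup>2) ^ j" for x
      by (simp add: poly_monom power2_eq_square distrib_left flip: power_mult)
    show "close (X ^ i * (- Y) ^ j) (poly ?p s)"
      unfolding ev by (intro close_mult close_power close_X close_Y)
    show "degree ?p = k"
      using k(1) by (simp add: degree_mult_eq degree_monom_eq degree_power_eq)
    show "lead_coeff ?p = 1"
      by (simp add: lead_coeff_mult lead_coeff_power degree_monom_eq)
    show "poly ?p \<zeta> = poly ?p (\<zeta>\<^sup>2)"
      unfolding ev using zeta_facts by simp
    show "?p \<in> polys_over K" by (intro polys_over_mult[OF K_ring] polys_over_power[OF K_ring] rK mK)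
  qed
  \<comment> \<open>For \<open>k = 1\<close> modulo 3 one needs \<open>2 * 2\<close> and one factor
    \<open>X\<close> less; \<open>k \<ge> 2\<close> then means \<open>k \<ge> 4\<close>.\<close>
  have "k mod 3 = 0 \<or> k mod 3 = 1 \<or> k mod 3 = 2" by linarith
  then consider "k = 3 * (k div 3) + 2 * 0" | "k = 3 * (k div 3 - 1) + 2 * 2" | "k = 3 * (k div 3) + 2 * 1"
    using assms(1) by fastforce
  then show ?thesis
    using gen[of "k div 3" 0] gen[of "k div 3 - 1" 2] gen[of "k div 3" 1] assms by cases auto
qed

text \<open>The condition at \<open>\<zeta>\<close> and \<open>\<zeta>\<^sup>2\<close> says that \<open>g\<close> takes the same value on the two branches at the node.\<close>

lemma form_of_polynomial:
  assumes "g \<in> polys_over K" "degree g \<le> 3 * d" "poly g \<zeta> = poly g (\<zeta>\<^sup>2)"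
  shows "\<exists>G. good d G \<and> close G (poly g s)"
  using assms
proof (induction "degree g" arbitrary: g rule: less_induct)
  case (less g)
  show ?case
  proof (cases "degree g \<le> 1")
    case True
    define a b where "a = coeff g 0" and "b = coeff g 1"
    have g: "g = [:a, b:]"
      by (rule poly_eqI) (use True in \<open>auto simp: a_def b_def coeff_pCons coeff_eq_0 split: nat.split\<close>)
    \<comment> \<open>The branch condition kills the linear coefficient; this is why degree 1 is not
      missed.\<close>
    then have "b * (\<zeta> - \<zeta>\<^sup>2) = 0" using less.prems(3) by (simp add: algebra_simps)
    then have "b = 0" using zeta_facts(2) by simp
    then have "g = [:a:]" using g by simp
    then have "poly g s = a" by simp
    moreover have "a \<in> K" unfolding a_def by (rule polys_over_coeff[OF K_ring less.prems(1)])
    ultimately show ?thesis using close_const good_mono[OF good_const, of a d] by auto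
  next
    case False
    obtain M p where M: "p \<in> polys_over K" "good d M" "close M (poly p s)" "degree p = degree g"
      "lead_coeff p = 1" "poly p \<zeta> = poly p (\<zeta>\<^sup>2)"
      using leading_form[of "degree g" d] False less.prems by auto
    define a where "a = lead_coeff g"
    have a: "a \<in> K" unfolding a_def by (rule polys_over_coeff[OF K_ring less.prems(1)])
    define g' where "g' = g - smult a p"
    have "degree g' < degree g"
    proof -
      have "coeff g' (degree g) = 0" using M(4,5) by (simp add: g'_def a_def)
      moreover have "degree g' \<le> degree g"
        unfolding g'_def using M(4) by (intro degree_diff_le) auto
      ultimately show ?thesis using False
        by (metis degree_0 le_neq_implies_less leading_coeff_0_iff not_le zero_le)
    qed
    moreover have "g' \<in> polys_over K"
      unfolding g'_def using less.prems M a by (intro polys_over_diff[OF K_ring] polys_over_smult[OF K_ring])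
    moreover have "poly g' \<zeta> = poly g' (\<zeta>\<^sup>2)" using less.prems M by (simp add: g'_def)
    ultimately obtain G where G: "good d G" "close G (poly g' s)"
      using less.hyps[of g'] less.prems(2) by auto
    have "good d (G + a * M)" by (intro good_add G good_scale a M)
    moreover have "close (G + a * M) (poly g' s + a * poly p s)"
      by (intro close_add close_mult close_const G a M)
    moreover have "poly g' s + a * poly p s = poly g s" by (simp add: g'_def)
    ultimately show ?thesis by metis
  qed
qed

lemma close_order:
  assumes "close G f" "f \<noteq> 0" "v f < int (q + 1)"
  shows "G \<noteq> 0" "v G = v f"
proof -
  have "vge v (v f + 1) (G - f)" using assms vge_mono by (fastforce simp: close_def)
  from place_dominant[OF K v assms(2) this] show "G \<noteq> 0" "v G = v f" by auto
qed

lemma form_low_order: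
  assumes d: "d > 0" "3 * d \<le> q" and ne: "(\<zeta> - e) ^ (3 * d) \<noteq> (\<zeta>\<^sup>2 - e) ^ (3 * d)"
  shows "\<exists>G. good d G \<and> G \<noteq> 0 \<and> v G = int (3 * d - 1)"
proof -
  define k where "k = 3 * d - 1"
  have k: "3 * d = Suc k" using d by (simp add: k_def)
  define A B where "A = (\<zeta>\<^sup>2 - e) ^ k" and "B = (\<zeta> - e) ^ k"
  \<comment> \<open>The line with \<open>l(\<zeta>)\<close> and \<open>l(\<zeta>\<^sup>2)\<close>
    proportional to \<open>A\<close> and \<open>B\<close>, so that \<open>(s - e)^k * l\<close>
    meets the branch condition. By the hypothesis \<open>ne\<close> it does not vanish at
    \<open>e\<close>, hence the order is exactly \<open>k\<close>.\<close>
  define l where "l = [:B * \<zeta> - A * \<zeta>\<^sup>2, A - B:]"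
  have AB: "A \<in> K" "B \<in> K" unfolding A_def B_def using zeta zeta_facts ce by (auto intro: Kcl)
  have lK: "l \<in> polys_over K"
    unfolding l_def using AB zeta(1) zeta_facts(4)
    by (intro polys_over_pCons[OF K_ring] polys_over_0[OF K_ring] Kcl(4,5))
  have lz: "poly l \<zeta> = A * (\<zeta> - \<zeta>\<^sup>2)" "poly l (\<zeta>\<^sup>2) = B * (\<zeta> - \<zeta>\<^sup>2)"
    by (simp_all add: l_def algebra_simps)
  have le: "poly l e \<noteq> 0"
  proof
    assume "poly l e = 0"
    then have "B * (\<zeta> - e) = A * (\<zeta>\<^sup>2 - e)" by (simp add: l_def algebra_simps)
    then show False using ne unfolding k by (simp add: A_def B_def mult.commute)
  qed
  have eK: "[:- e, 1:] \<in> polys_over K" using ce by (intro polys_over_closed[OF K_ring] Kcl)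
  define g where "g = [:- e, 1:] ^ k * l"
  have gK: "g \<in> polys_over K"
    unfolding g_def by (intro polys_over_mult[OF K_ring] polys_over_power[OF K_ring] eK lK)
  have "degree g \<le> degree ([:- e, 1:] ^ k) + degree l" unfolding g_def by (rule degree_mult_le)
  also have "degree ([:- e, 1:] ^ k) = k" by (simp add: degree_power_eq)
  also have "degree l \<le> 1" by (simp add: l_def)
  finally have deg: "degree g \<le> 3 * d" using k by simp
  have "poly g \<zeta> = poly g (\<zeta>\<^sup>2)" by (simp add: g_def lz A_def B_def)
  from form_of_polynomial[OF gK deg this] obtain G where G: "good d G" "close G (poly g s)" by blast
  have "res K v (poly l s) (poly l e)"
    unfolding l_def using res_s[OF centered_v] AB zeta(1) zeta_facts(4)
    by (auto intro!: res_add[OF K v] res_mult[OF K v] res_const[OF K v] Kcl(4,5))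
  note ls = res_unit[OF K v this le]
  have gs: "poly g s = (s - e) ^ k * poly l s" by (simp add: g_def)
  have gs0: "poly g s \<noteq> 0" unfolding gs using ls s_minus_e_nonzero by simp
  have vg: "v (poly g s) = int k"
    unfolding gs using place_mult[OF K v _ ls(1), of "(s - e) ^ k"] s_minus_e_nonzero ls(2)
      place_power[OF K v s_minus_e_nonzero, of k] uniformizer_s by simp
  show ?thesis
    using close_order[OF G(2) gs0] vg G(1) d k by auto
qed

lemma form_top_order:
  assumes d: "3 * d \<le> q" and eq: "(\<zeta> - e) ^ (3 * d) = (\<zeta>\<^sup>2 - e) ^ (3 * d)"
  shows "\<exists>G. good d G \<and> G \<noteq> 0 \<and> v G = int (3 * d)"
proof -
  have eK: "[:- e, 1:] \<in> polys_over K" using ce by (intro polys_over_closed[OF K_ring] Kcl)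
  define g where "g = [:- e, 1:] ^ (3 * d)"
  have gK: "g \<in> polys_over K" unfolding g_def by (intro polys_over_power[OF K_ring] eK)
  have deg: "degree g \<le> 3 * d" by (simp add: g_def degree_power_eq)
  have "poly g \<zeta> = poly g (\<zeta>\<^sup>2)" using eq by (simp add: g_def)
  from form_of_polynomial[OF gK deg this] obtain G where G: "good d G" "close G (poly g s)" by blast
  have gs: "poly g s = (s - e) ^ (3 * d)" by (simp add: g_def)
  have gs0: "poly g s \<noteq> 0" unfolding gs using s_minus_e_nonzero by simp
  have vg: "v (poly g s) = int (3 * d)"
    unfolding gs using place_power[OF K v s_minus_e_nonzero, of "3 * d"] uniformizer_s by simp
  show ?thesis using close_order[OF G(2) gs0] vg G(1) d by auto
qed

section \<open>Pole numbers at the point\<close>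

abbreviation "H \<equiv> weierstrass_semigroup K v"

lemma H_of_form:
  assumes G: "good d G" "G \<noteq> 0" "v G = int k" and k: "k \<le> d * (q + 1)"
  shows "d * (q + 1) - k \<in> H"
proof -
  let ?f = "G / T ^ d"
  have Td: "T ^ d \<noteq> 0" using T_nonzero by simp
  have val: "w ?f = w G - int d * w T" if w: "place_val K w" for w
    using place_divide[OF K w G(2) Td] place_power[OF K w T_nonzero] by simp
  have "v ?f = - int (d * (q + 1) - k)"
    using val[OF v] order_T G(3) k by (simp add: of_nat_diff algebra_simps)
  moreover have "w ?f \<ge> 0" if w: "place_val K w" and ne: "\<exists>g. g \<noteq> 0 \<and> w g \<noteq> v g" for w
  proof (cases "w X \<ge> 0")
    case True
    \<comment> \<open>A zero of \<open>T\<close> away from the poles of \<open>X\<close> is centered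
      at the point, and \<open>v\<close> is the only such place.\<close>
    have "\<not> w T > 0" using zero_T_centered[OF w True] centered_unique ne by blast
    moreover have "w T \<ge> 0" using goodD(1)[OF good_T w True] T_nonzero by (simp add: vge_def)
    ultimately have "w T = 0" by simp
    then show ?thesis using val[OF w] goodD(1)[OF G(1) w True] G(2) by (simp add: vge_def)
  next
    case False
    then have X: "w X < 0" by simp
    have "int d * w X \<le> w G" using goodD(2)[OF G(1) w X] G(2) by (simp add: vge_def)
    then show ?thesis using val[OF w] place_T_pole[OF w X] by simp
  qed
  moreover have "?f \<noteq> 0" using G(2) Td by simp
  ultimately show ?thesis unfolding weierstrass_semigroup_def by blast
qed

lemma H_zero: "0 \<in> H"
  using H_of_form[of 0 1 0] good_1 place_1[OF K v] by simp

lemma H_add: assumes "a \<in> H" "b \<in> H" shows "a + b \<in> H"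
proof -
  obtain f where f: "f \<noteq> 0" "v f = - int a"
    "\<And>w. place_val K w \<Longrightarrow> \<exists>g. g \<noteq> 0 \<and> w g \<noteq> v g \<Longrightarrow> w f \<ge> 0"
    using assms(1) unfolding weierstrass_semigroup_def by blast
  obtain g where g: "g \<noteq> 0" "v g = - int b"
    "\<And>w. place_val K w \<Longrightarrow> \<exists>g. g \<noteq> 0 \<and> w g \<noteq> v g \<Longrightarrow> w g \<ge> 0"
    using assms(2) unfolding weierstrass_semigroup_def by blast
  have "f * g \<noteq> 0" "v (f * g) = - int (a + b)"
    using f g place_mult[OF K v] by auto
  moreover have "w (f * g) \<ge> 0" if "place_val K w" "\<exists>g. g \<noteq> 0 \<and> w g \<noteq> v g" for w
    using f(3)[OF that] g(3)[OF that] place_mult[OF K that(1) f(1) g(1)] by simp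
  ultimately show ?thesis unfolding weierstrass_semigroup_def by blast
qed

text \<open>From the forms \<open>X - x0\<close> and \<open>1\<close> of degree 1, which have the
  orders 1 and 0.\<close>

lemma H_q: "q \<in> H" "q + 1 \<in> H"
proof -
  have "good 1 (- x0)" using x0y0(1) good_mono[OF good_const, of "- x0" 1] Kcl(6) by simp
  then have g: "good 1 (X - x0)" using good_add[OF good_X] by fastforce
  show "q \<in> H"
    using H_of_form[OF g, of 1] uniformizer_X[OF centered_v] X_not_const[OF x0y0(1)] by simp
  show "q + 1 \<in> H"
    using H_of_form[OF good_mono[OF good_1], of 1 0] place_1[OF K v] by simp
qed

lemma H_good:
  assumes f: "f \<noteq> 0" "v f = - int a" "a \<le> d * (q + 1)"
    and reg: "\<And>w. place_val K w \<Longrightarrow> \<exists>g. g \<noteq> 0 \<and> w g \<noteq> v g \<Longrightarrow> w f \<ge> 0"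
  shows "good d (f * T ^ d)" "v (f * T ^ d) = int (d * (q + 1)) - int a"
proof -
  have Td: "T ^ d \<noteq> 0" using T_nonzero by simp
  have val: "w (f * T ^ d) = w f + int d * w T" if w: "place_val K w" for w
    using place_mult[OF K w f(1) Td] place_power[OF K w T_nonzero] by simp
  show vF: "v (f * T ^ d) = int (d * (q + 1)) - int a"
    using val[OF v] order_T f by (simp add: algebra_simps)
  show "good d (f * T ^ d)"
    unfolding good_def
  proof (intro allI impI conjI)
    fix w assume w: "place_val K w"
    {
      assume X: "w X \<ge> 0"
      have "w (f * T ^ d) \<ge> 0"
      proof (cases "\<exists>g. g \<noteq> 0 \<and> w g \<noteq> v g")
        case True
        have "w T \<ge> 0" using goodD(1)[OF good_T w X] T_nonzero by (simp add: vge_def)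
        then show ?thesis using val[OF w] reg[OF w True] by simp
      next
        \<comment> \<open>Here \<open>w\<close> coincides with \<open>v\<close> on nonzero
          functions, and \<open>T^d\<close> cancels the pole because
          \<open>a \<le> d * (q + 1)\<close>.\<close>
        case False
        have "f * T ^ d \<noteq> 0" using f Td by simp
        then have "w (f * T ^ d) = v (f * T ^ d)" using False by blast
        moreover have "int a \<le> int (d * (q + 1))" by (rule of_nat_mono[OF f(3)])
        ultimately show ?thesis using vF by linarith
      qed
      then show "vge w 0 (f * T ^ d)" by (simp add: vge_def)
    next
      assume X: "w X < 0"
      \<comment> \<open>A pole of \<open>X\<close> is therefore a place different from
        \<open>v\<close>, where \<open>f\<close> is regular.\<close>
      have vX0: "v X \<ge> 0" using centered_v res_vge[OF K v] s_nonzero by (auto simp: centered_def vge_def)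
      have "w X \<noteq> v X" using X vX0 by simp
      then have "w f \<ge> 0" using reg[OF w] s_nonzero by blast
      then show "vge w (int d * w X) (f * T ^ d)"
        using val[OF w] place_T_pole[OF w X] by (simp add: vge_def)
    }
  qed
qed

text \<open>Functions with distinct pole orders are independent over \<open>K\<close>. Their
  combinations, multiplied by \<open>T^d\<close>, are counted inside the Riemann-Roch space, and the
  two powers of \<open>card K\<close> are compared.\<close>

lemma card_H: assumes "card K \<ge> 2" shows "card (H \<inter> {..d * (q + 1)}) \<le> card (Ind d)"
proof -
  let ?A = "H \<inter> {..d * (q + 1)}"
  have "\<forall>a. \<exists>F. a \<in> ?A \<longrightarrow> F \<noteq> 0 \<and> good d F \<and> v F = int (d * (q + 1)) - int a"
  proof
    fix a
    show "\<exists>F. a \<in> ?A \<longrightarrow> F \<noteq> 0 \<and> good d F \<and> v F = int (d * (q + 1)) - int a"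
    proof (cases "a \<in> ?A")
      case True
      then obtain f where f: "f \<noteq> 0" "v f = - int a"
        "\<And>w. place_val K w \<Longrightarrow> \<exists>g. g \<noteq> 0 \<and> w g \<noteq> v g \<Longrightarrow> w f \<ge> 0"
        unfolding weierstrass_semigroup_def by blast
      have le: "a \<le> d * (q + 1)" using True by simp
      have "good d (f * T ^ d)" by (rule H_good(1)[OF f(1,2) le]) (rule f(3))
      moreover have "v (f * T ^ d) = int (d * (q + 1)) - int a"
        by (rule H_good(2)[OF f(1,2) le]) (rule f(3))
      ultimately show ?thesis
        using f(1) T_nonzero
        by (intro exI[of _ "f * T ^ d"]) auto
    qed blast
  qed
  then obtain F where F: "\<And>a. a \<in> ?A \<Longrightarrow> F a \<noteq> 0 \<and> good d (F a) \<and> v (F a) = int (d * (q + 1)) - int a"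
    by metis
  define \<Phi> where "\<Phi> = (\<lambda>b. \<Sum>a\<in>?A. b a * F a)"
  have sub: "\<Phi> ` (?A \<rightarrow>\<^sub>E K) \<subseteq> {f. good d f}"
  proof
    fix f assume "f \<in> \<Phi> ` (?A \<rightarrow>\<^sub>E K)"
    then obtain b where b: "b \<in> ?A \<rightarrow>\<^sub>E K" "f = \<Phi> b" by blast
    have "good d (\<Sum>a\<in>B. b a * F a)" if "B \<subseteq> ?A" "finite B" for B
      using that(2,1)
    proof (induction B rule: finite_induct)
      case empty
      then show ?case using good_mono[OF good_const[OF Kcl(1)], of d] by simp
    next
      case (insert a B)
      then have "good d (b a * F a)" using b F by (intro good_scale) auto
      then show ?case using insert by (simp add: good_add)
    qed
    then show "f \<in> {f. good d f}" using b by (simp add: \<Phi>_def)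
  qed
  have inj: "inj_on \<Phi> (?A \<rightarrow>\<^sub>E K)"
  proof (rule inj_onI)
    fix b b' assume b: "b \<in> ?A \<rightarrow>\<^sub>E K" "b' \<in> ?A \<rightarrow>\<^sub>E K" "\<Phi> b = \<Phi> b'"
    define I where "I = {a \<in> ?A. b a \<noteq> b' a}"
    have "I = {}"
    proof (rule ccontr)
      assume "I \<noteq> {}"
      have vI: "(b a - b' a) * F a \<noteq> 0" "v ((b a - b' a) * F a) = int (d * (q + 1)) - int a" if "a \<in> I" for a
      proof -
        have a: "a \<in> ?A" "b a - b' a \<noteq> 0" using that by (auto simp: I_def)
        have "b a - b' a \<in> K" using b a(1) by (intro Kcl) auto
        then show "(b a - b' a) * F a \<noteq> 0" "v ((b a - b' a) * F a) = int (d * (q + 1)) - int a"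
          using F[OF a(1)] a place_const[OF K v] place_mult[OF K v a(2), of "F a"] by auto
      qed
      have "inj_on (\<lambda>a. v ((b a - b' a) * F a)) I"
        by (rule inj_onI) (simp add: vI)
      then have "(\<Sum>a\<in>I. (b a - b' a) * F a) \<noteq> 0"
        using place_sum_distinct[OF K v _ \<open>I \<noteq> {}\<close> vI(1)] by (simp add: I_def)
      moreover have "(\<Sum>a\<in>I. (b a - b' a) * F a) = (\<Sum>a\<in>?A. (b a - b' a) * F a)"
        by (rule sum.mono_neutral_left) (auto simp: I_def)
      moreover have "\<dots> = \<Phi> b - \<Phi> b'"
        by (simp add: \<Phi>_def left_diff_distrib sum_subtractf)
      ultimately show False using b(3) by simp
    qed
    then have "b a = b' a" if "a \<in> ?A" for a using that by (auto simp: I_def)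
    then show "b = b'" using b(1,2) by (metis PiE_ext)
  qed
  have "card K ^ card ?A = card (?A \<rightarrow>\<^sub>E K)" by (simp add: card_funcsetE)
  also have "\<dots> = card (\<Phi> ` (?A \<rightarrow>\<^sub>E K))" by (rule card_image[OF inj, symmetric])
  also have "\<dots> \<le> card {f. good d f}" by (rule card_mono[OF card_good(1) sub])
  also have "\<dots> \<le> card K ^ card (Ind d)" by (rule card_good(2))
  finally show ?thesis using assms by (simp add: power_increasing_iff)
qed

end

context curve_point
begin

text \<open>The forms constructed above show that the generators are pole numbers. Equality follows
  from \<open>eqI\<close>, since \<open>card_H\<close> in degree \<open>m\<close> and
  \<open>card_Ind\<close> give exactly the count that the generated semigroup already
  reaches.\<close>

lemma H_generated:
  assumes K2: "card K \<ge> 2" and k: "2 \<le> k" "k \<le> m"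
    and low: "\<And>d. 0 < d \<Longrightarrow> d < k \<Longrightarrow> (\<zeta> - e) ^ (3 * d) \<noteq> (\<zeta>\<^sup>2 - e) ^ (3 * d)"
    and top: "k < m \<Longrightarrow> (\<zeta> - e) ^ (3 * k) = (\<zeta>\<^sup>2 - e) ^ (3 * k)"
  shows "H = gen_semigroup ({q, q + 1} \<union> {d * (q + 1) - (3 * d - 1) | d. 0 < d \<and> d < k} \<union>
      (if k < m then {k * (q + 1) - 3 * k} else {}))" (is "H = gen_semigroup ?G")
proof -
  have three: "3 * d \<le> d * (q + 1)" for d
  proof -
    have "d * 3 \<le> d * (q + 1)" by (rule mult_le_mono2) (use q m2 in linarith)
    then show ?thesis by simp
  qed
  have "d * (q + 1) - (3 * d - 1) \<in> H" if d: "0 < d" "d < k" for d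
  proof -
    have "3 * d \<le> q" using d k q by linarith
    from form_low_order[OF d(1) this low[OF d]] obtain G where
      "good d G" "G \<noteq> 0" "v G = int (3 * d - 1)" by blast
    then show ?thesis by (rule H_of_form[OF _ _ _ order.trans[OF diff_le_self three]])
  qed
  moreover have "k * (q + 1) - 3 * k \<in> H" if "k < m"
  proof -
    have "3 * k \<le> q" using that q by linarith
    from form_top_order[OF this top[OF that]] obtain G where
      "good k G" "G \<noteq> 0" "v G = int (3 * k)" by blast
    then show ?thesis using three[of k] by (intro H_of_form)
  qed
  ultimately have "?G \<subseteq> H" using H_q by auto
  then have sub: "gen_semigroup ?G \<subseteq> H"
    by (rule gen_semigroup_least) (auto intro: H_zero H_add)
  interpret level_semigroup "gen_semigroup ?G" q m k
  proof
    show "0 \<in> gen_semigroup ?G" by (rule gen_semigroup.zero)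
    show "x + y \<in> gen_semigroup ?G" if "x \<in> gen_semigroup ?G" "y \<in> gen_semigroup ?G" for x y
      using that by (rule gen_semigroup_add)
    show "q \<in> gen_semigroup ?G" "q + 1 \<in> gen_semigroup ?G"
      by (rule gen_semigroup_generator, blast)+
    show "d * (q + 1) - (3 * d - 1) \<in> gen_semigroup ?G" if "0 < d" "d < k" for d
      using that by (intro gen_semigroup_generator) blast
    show "k * (q + 1) - 3 * k \<in> gen_semigroup ?G" if "k < m"
      using that by (intro gen_semigroup_generator) simp
  qed (fact q m2 k)+
  show ?thesis
    using eqI[OF sub] card_H[OF K2, of m] card_Ind by simp
qed

end

section \<open>Passage from the given coordinates to the rescaled curve\<close>

theorem theorem4p5:
  fixes q m :: nat and K :: "'a::field set" and x y a b \<zeta> :: 'a and v :: "'a \<Rightarrow> int"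
  assumes q: "prime_power q" "q \<ge> 5" "q mod 3 = 2"
    and m: "m = (q + 1) div 3"
    and K: "is_subfield K" "finite K" "card K = q ^ 2"
    and trans: "transcendental_over K x"
    and gen: "\<forall>F. is_subfield F \<and> K \<subseteq> F \<and> x \<in> F \<and> y \<in> F \<longrightarrow> F = UNIV"
    and curve: "y ^ (q + 1) + x ^ (2 * m) + x ^ m = 0"
    and zeta: "\<zeta> \<in> K" "\<zeta>\<^sup>2 + \<zeta> + 1 = 0"
    and ab: "a \<in> K" "b \<in> K" "a \<noteq> 0" "a ^ m + 1 \<noteq> 0"
    and P: "place_val K v" "v (x - a) > 0" "v (y - b) > 0"
    and alpha: "(a ^ m / (1 + a ^ m))\<^sup>2 - a ^ m / (1 + a ^ m) + 1 \<noteq> 0"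
  shows "(P_order \<zeta> (a ^ m / (1 + a ^ m)) \<le> m - 2 \<longrightarrow>
           weierstrass_semigroup K v =
             gen_semigroup ({q, q + 1, (q - 1) + P_order \<zeta> (a ^ m / (1 + a ^ m)) * (q - 2) - 1}
               \<union> {(q - 1) + j * (q - 2) | j. j < P_order \<zeta> (a ^ m / (1 + a ^ m))}))
       \<and> (P_order \<zeta> (a ^ m / (1 + a ^ m)) = m - 1 \<longrightarrow>
           weierstrass_semigroup K v =
             gen_semigroup ({q, q + 1} \<union> {(q - 1) + j * (q - 2) | j. j \<le> m - 2}))"
proof -
  have q3: "q + 1 = 3 * m" using q(3) m by presburger
  have m2: "m \<ge> 2" using q3 q(2) by linarith
  note cl = subring_closed[OF subfield_subring[OF K(1)]]
  have q0: "of_nat q = (0 :: 'a)" and frob: "\<And>f g :: 'a. (f + g) ^ q = f ^ q + g ^ q"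
    using subfield_frobenius[OF K(1,2) q(1) K(3)] by auto
  have frob_diff: "(f - g) ^ q = f ^ q - g ^ q" for f g :: 'a
    using frob[of "f - g" g] by simp
  have three_m: "of_nat (3 * m) = (1 :: 'a)"
    using q3 q0 by (metis add_0 of_nat_1 of_nat_add)
  have kq: "(q + 1) * (q - 1) = card K - 1"
    using K(3) q(2) by (simp add: power2_eq_square algebra_simps)
  \<comment> \<open>\<open>d^(q+1)\<close> is the norm of \<open>d\<close> to the field with
    \<open>q\<close> elements.\<close>
  have fermat: "(d ^ (q + 1)) ^ q = d ^ (q + 1)" if "d \<in> K" for d
  proof (cases "d = 0")
    case False
    have "(d ^ (q + 1)) ^ q = (d ^ (q + 1)) ^ Suc (q - 1)" using q(2) by simp
    also have "\<dots> = d ^ ((q + 1) * (q - 1)) * d ^ (q + 1)" by (simp only: power_Suc2 power_mult)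
    also have "d ^ ((q + 1) * (q - 1)) = 1"
      unfolding kq by (rule subfield_fermat[OF K(1,2) that False])
    finally show ?thesis by simp
  qed (use q in simp)
  \<comment> \<open>If \<open>m\<close> is odd, then \<open>q = 3 m - 1\<close> is even, so the
    characteristic is 2 and \<open>- 1 = 1\<close>.\<close>
  have sign: "(- 1) ^ m = (1 :: 'a)"
  proof (cases "even m")
    case False
    then have "even q" using q3 by presburger
    then have "(2 :: 'a) = 0"
    proof -
      obtain p k where pk: "prime p" "k > 0" "q = p ^ k" using q(1) by (auto simp: prime_power_def)
      then have "p = 2" using \<open>even q\<close> by (metis even_power prime_odd_nat prime_ge_2_nat le_neq_implies_less)
      then have "(2 :: 'a) ^ k = 0" using q0 pk by simp
      then show ?thesis by simp
    qed
    then have "1 + 1 = (0 :: 'a)" by simp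
    then have "(- 1 :: 'a) = 1" by (rule minus_unique)
    then show ?thesis by (metis power_one)
  qed simp

  define e be where "e = a ^ m" and "be = - 1 - e"
  have eK: "e \<in> K" "e \<noteq> 0" using ab by (auto simp: e_def intro: cl)
  have beK: "be \<in> K" unfolding be_def using eK by (intro cl)
  have e1: "1 + e \<noteq> 0" using ab(4) by (simp add: e_def add.commute)
  have "1 + e = - be" by (simp add: be_def)
  then have be0: "be \<noteq> 0" using e1 by auto
  have e_cube: "e ^ 3 = a ^ (q + 1)" unfolding q3 e_def by (simp add: mult.commute flip: power_mult)
  have e3: "1 + e + e\<^sup>2 \<noteq> 0"
  proof
    assume "1 + e + e\<^sup>2 = 0"
    moreover have "(e / (1 + e))\<^sup>2 - e / (1 + e) + 1 = (1 + e + e\<^sup>2) / (1 + e)\<^sup>2"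
    proof -
      have "(e / t)\<^sup>2 - e / t + 1 = (e\<^sup>2 - e * t + t\<^sup>2) / t\<^sup>2" if "t \<noteq> 0" for t
        using that by (simp add: field_simps power2_eq_square)
      from this[OF e1] show ?thesis by (simp add: power2_eq_square algebra_simps)
    qed
    ultimately show False using alpha by (simp add: e_def)
  qed
  have rx: "res K v x a" and ry: "res K v y b"
    using P ab by (auto simp: res_def vge_def)
  have point: "b ^ (q + 1) = e * be"
  proof -
    have "res K v (y ^ (q + 1) + x ^ (2 * m) + x ^ m) (b ^ (q + 1) + a ^ (2 * m) + a ^ m)"
      by (intro res_add[OF K(1) P(1)] res_power[OF K(1) P(1)] rx ry)
    then have "b ^ (q + 1) + a ^ (2 * m) + a ^ m = 0"
      unfolding curve using res_unique[OF K(1) P(1) _ res_const[OF K(1) P(1) cl(1)]] by blast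
    moreover have "a ^ (2 * m) = e\<^sup>2" by (simp add: e_def mult.commute flip: power_mult)
    ultimately have "b ^ (q + 1) + (e\<^sup>2 + e) = 0" by (simp add: e_def add.assoc)
    then have "b ^ (q + 1) = - (e\<^sup>2 + e)" by (rule iffD2[OF eq_neg_iff_add_eq_0])
    also have "\<dots> = e * be" by (simp add: be_def power2_eq_square algebra_simps)
    finally show ?thesis .
  qed
  \<comment> \<open>The norms \<open>a^(q+1) = e^3\<close> and \<open>b^(q+1) = e * be\<close> are
    fixed by the \<open>q\<close>-th power. The second makes \<open>e^q\<close> equal to
    \<open>e\<close> or \<open>- 1 - e\<close>; in the latter case the first gives
    \<open>(2 e + 1) (1 + e + e\<^sup>2) = 0\<close>, so \<open>2 e + 1 = 0\<close> and
    \<open>- 1 - e = e\<close> again.\<close>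
  have e_frob: "e ^ q = e"
  proof -
    have 1: "(e ^ q) ^ 3 = e ^ 3"
      using fermat[OF ab(1)] unfolding e_cube[symmetric] by (simp add: mult.commute flip: power_mult)
    have "(e * be) ^ q = e * be" using fermat[OF ab(2)] unfolding point .
    moreover have "be ^ q = - 1 - e ^ q"
    proof -
      have "(1 + (e + be)) ^ q = 0" using q(2) by (simp add: be_def power_0_left)
      then have "be ^ q + (1 + e ^ q) = 0" by (simp add: frob ac_simps)
      then have "be ^ q = - (1 + e ^ q)" by (rule iffD2[OF eq_neg_iff_add_eq_0])
      then show ?thesis by simp
    qed
    ultimately have "e ^ q * (- 1 - e ^ q) = e * (- 1 - e)" by (simp add: power_mult_distrib be_def)
    moreover have "(e ^ q - e) * (e ^ q + (e + 1)) = e * (- 1 - e) * (- 1) + e ^ q * (- 1 - e ^ q) * (- 1) - 2 * (e * (- 1 - e) * (- 1))"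
      by (simp add: algebra_simps)
    ultimately have "(e ^ q - e) * (e ^ q + (e + 1)) = 0" by simp
    then have "e ^ q = e \<or> e ^ q = - (e + 1)"
      unfolding mult_eq_0_iff eq_neg_iff_add_eq_0[symmetric] by simp
    then consider "e ^ q = e" | "e ^ q = - 1 - e" by fastforce
    then show ?thesis
    proof cases
      case 2
      have "(2 * e + 1) * (1 + e + e\<^sup>2) = e ^ 3 - (- 1 - e) ^ 3"
        by (simp add: power3_eq_cube power2_eq_square algebra_simps)
      then have "(2 * e + 1) * (1 + e + e\<^sup>2) = 0" using 1[unfolded 2] by simp
      then have "2 * e + 1 = 0" using e3 by simp
      moreover have "- 1 - e = e - (2 * e + 1)" by (simp add: algebra_simps)
      ultimately have "- 1 - e = e" by simp
      then show ?thesis using 2 by simp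
    qed
  qed
  have b0: "b \<noteq> 0" using point eK be0 by auto
  have aq: "a ^ q \<in> K" "a ^ q \<noteq> 0" "b ^ q \<in> K" "b ^ q \<noteq> 0" using ab b0 by (auto intro: cl)

  \<comment> \<open>The factors make the coordinates of the point norms:
    \<open>a^(q+1) = e^3\<close> and \<open>b^(q+1) = e * be\<close>.\<close>
  define X Y c where "X = a ^ q * x" and "Y = b ^ q * y" and "c = - be / e"
  have x_poly: "poly p x \<noteq> 0" if "p \<in> polys_over K" "p \<noteq> 0" for p
    using trans that by (auto simp: transcendental_over_def polys_over_def)
  have trX: "transcendental_over K X"
    unfolding transcendental_over_def
  proof (intro allI impI notI)
    fix p assume p: "p \<noteq> 0 \<and> (\<forall>i. coeff p i \<in> K)" "poly p X = 0"
    define r where "r = (\<Sum>i\<le>degree p. monom (coeff p i * (a ^ q) ^ i) i)"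
    have "r \<in> polys_over K"
      unfolding r_def using p ab
      by (intro polys_over_sum[OF subfield_subring[OF K(1)]] polys_over_monom[OF subfield_subring[OF K(1)]] cl) auto
    moreover have "coeff r (degree p) = lead_coeff p * (a ^ q) ^ degree p"
      by (simp add: r_def coeff_sum)
    then have "r \<noteq> 0" using p aq by auto
    moreover have "poly r x = poly p X"
      by (simp add: r_def poly_sum poly_monom poly_altdef[of p] X_def power_mult_distrib mult_ac)
    ultimately show False using x_poly p(2) by metis
  qed
  \<comment> \<open>A place is unspecified at 0, so \<open>x - a\<close> and \<open>y - b\<close>
    must be nonzero before their values can be carried over to \<open>X - e^3\<close> and
    \<open>Y - e * be\<close>.\<close>
  have x_a: "x \<noteq> a"
  proof
    assume "x = a"
    moreover have "[:- a, 1:] \<in> polys_over K"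
      using ab by (intro polys_over_closed[OF subfield_subring[OF K(1)]] cl)
    ultimately show False using x_poly[of "[:- a, 1:]"] by simp
  qed
  have y_b: "y \<noteq> b"
  proof
    assume "y = b"
    let ?p = "monom 1 (2 * m) + (monom 1 m + [:b ^ (q + 1):])"
    have "?p \<in> polys_over K"
      using ab by (intro polys_over_closed[OF subfield_subring[OF K(1)]] cl)
    moreover have "coeff ?p (2 * m) = 1" using m2 by (simp add: coeff_pCons split: nat.split)
    then have "?p \<noteq> 0" by (metis coeff_0 zero_neq_one)
    moreover have "poly ?p x = 0"
      using curve \<open>y = b\<close> by (simp add: poly_monom algebra_simps)
    ultimately show False using x_poly by blast
  qed
  note q_ge = q(2) and q_mod = q(3) and K_card = K(3)
  interpret curve_point K X Y c e m q v \<zeta> be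
  proof
    show "F = UNIV" if F: "is_subfield F" "K \<subseteq> F" "X \<in> F" "Y \<in> F" for F
    proof -
      have "X / a ^ q \<in> F" "Y / b ^ q \<in> F" using F aq by (auto intro: subfield_divide)
      then have "x \<in> F" "y \<in> F" using aq by (auto simp: X_def Y_def)
      then show ?thesis using gen F by blast
    qed
    show "of_nat (3 * m) \<noteq> (0 :: 'a)" unfolding three_m by simp
    show "c \<in> K" unfolding c_def using eK beK by (intro subfield_divide[OF K(1)] cl)
    show "c \<noteq> 0" using be0 eK by (simp add: c_def)
    show "card {\<eta> \<in> K. \<eta> ^ (3 * m) = 1} = 3 * m"
      using card_unit_roots[OF K(1,2) kq[unfolded q3]] q(2) m2 by simp
    show "Y ^ (3 * m) = c * X ^ m * (X ^ m + e)"
    proof -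
      have Xm: "X ^ m = e * x ^ m"
      proof -
        have "X ^ m = e ^ q * x ^ m"
          by (simp add: X_def power_mult_distrib e_def mult.commute flip: power_mult)
        then show ?thesis by (simp add: e_frob)
      qed
      have "Y ^ (q + 1) = (b ^ (q + 1)) ^ q * y ^ (q + 1)"
        unfolding Y_def power_mult_distrib by (simp only: power_mult[symmetric] mult.commute)
      also have "\<dots> = e * be * y ^ (q + 1)" using fermat[OF ab(2)] point by simp
      also have "y ^ (q + 1) = - (x ^ m * (x ^ m + 1))"
      proof (rule iffD2[OF eq_neg_iff_add_eq_0])
        have "x ^ m * (x ^ m + 1) = x ^ (2 * m) + x ^ m"
          by (simp add: distrib_left mult_2 power_add)
        then show "y ^ (q + 1) + x ^ m * (x ^ m + 1) = 0" using curve by (simp add: add.assoc)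
      qed
      also have "e * be * - (x ^ m * (x ^ m + 1)) = c * X ^ m * (X ^ m + e)"
        unfolding Xm using eK by (simp add: c_def algebra_simps)
      finally show ?thesis unfolding q3 .
    qed
    show "e * c = - be" using eK by (simp add: c_def)
    have "X - e ^ 3 = a ^ q * (x - a)" by (simp add: X_def e_cube algebra_simps)
    then show "v (X - e ^ 3) > 0"
      using place_mult[OF K(1) P(1) aq(2), of "x - a"] x_a P(2) place_const[OF K(1) P(1) aq(1,2)] by simp
    have "Y - e * be = b ^ q * (y - b)" unfolding point[symmetric] by (simp add: Y_def algebra_simps)
    then show "v (Y - e * be) > 0"
      using place_mult[OF K(1) P(1) aq(4), of "y - b"] y_b P(3) place_const[OF K(1) P(1) aq(3,4)] by simp
  qed (use K trX eK q3 m2 q0 frob sign e_frob be0 e3 P zeta in \<open>auto simp: be_def\<close>)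

  define \<alpha> where "\<alpha> = e / (1 + e)"
  \<comment> \<open>Multiplication by \<open>1 + e\<close> turns \<open>\<alpha> + \<zeta>\<close>
    into \<open>\<zeta>\<^sup>2 * (\<zeta>\<^sup>2 - e)\<close> and
    \<open>\<alpha> + \<zeta>\<^sup>2\<close> into \<open>\<zeta> * (\<zeta> - e)\<close>; the cube
    roots of unity disappear in a \<open>3 d\<close>-th power.\<close>
  have Pcal_iff: "Pcal \<zeta> d \<alpha> = 0 \<longleftrightarrow> (\<zeta> - e) ^ (3 * d) = (\<zeta>\<^sup>2 - e) ^ (3 * d)" for d
  proof -
    have three: "(3 :: 'a) \<noteq> 0" using three_m by auto
    have "\<alpha> \<noteq> 0" "\<alpha> \<noteq> 1" using eK e1 by (auto simp: \<alpha>_def)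
    then have den: "3 * (\<zeta> - \<zeta>\<^sup>2) * \<alpha> * (\<alpha> - 1) \<noteq> 0" using three zeta_facts(2) by simp
    have "(\<alpha> + \<zeta>) * (1 + e) = \<zeta>\<^sup>2 * (\<zeta>\<^sup>2 - e)"
    proof -
      have "(\<alpha> + \<zeta>) * (1 + e) = (1 + \<zeta>) * e + \<zeta>" using e1 by (simp add: \<alpha>_def field_simps)
      also have "1 + \<zeta> = - \<zeta>\<^sup>2 + (1 + (\<zeta> + \<zeta>\<^sup>2))" by simp
      also have "\<dots> = - \<zeta>\<^sup>2" unfolding zeta_facts(5) by simp
      also have "- \<zeta>\<^sup>2 * e + \<zeta> = \<zeta>\<^sup>2 * (\<zeta>\<^sup>2 - e)"
      proof -
        have "\<zeta>\<^sup>2 * \<zeta>\<^sup>2 = \<zeta> ^ 3 * \<zeta>" by (simp add: power2_eq_square power3_eq_cube)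
        then show ?thesis using zeta_facts(1) by (simp add: algebra_simps)
      qed
      finally show ?thesis .
    qed
    then have 1: "(\<alpha> + \<zeta>) ^ (3 * d) * (1 + e) ^ (3 * d) = (\<zeta>\<^sup>2 - e) ^ (3 * d)"
      using zeta_facts(3) by (simp add: power_mult flip: power_mult_distrib) (simp add: power_mult_distrib)
    have "(\<alpha> + \<zeta>\<^sup>2) * (1 + e) = \<zeta> * (\<zeta> - e)"
    proof -
      have "(\<alpha> + \<zeta>\<^sup>2) * (1 + e) = (1 + \<zeta>\<^sup>2) * e + \<zeta>\<^sup>2" using e1 by (simp add: \<alpha>_def field_simps)
      also have "1 + \<zeta>\<^sup>2 = - \<zeta> + (1 + (\<zeta> + \<zeta>\<^sup>2))" by simp
      also have "\<dots> = - \<zeta>" unfolding zeta_facts(5) by simp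
      finally show ?thesis by (simp add: power2_eq_square algebra_simps)
    qed
    then have 2: "(\<alpha> + \<zeta>\<^sup>2) ^ (3 * d) * (1 + e) ^ (3 * d) = (\<zeta> - e) ^ (3 * d)"
      using zeta_facts(1) by (simp add: power_mult flip: power_mult_distrib) (simp add: power_mult_distrib)
    have "Pcal \<zeta> d \<alpha> = 0 \<longleftrightarrow> (\<alpha> + \<zeta>) ^ (3 * d) = (\<alpha> + \<zeta>\<^sup>2) ^ (3 * d)"
      using den by (simp add: Pcal_def)
    also have "\<dots> \<longleftrightarrow> (\<alpha> + \<zeta>) ^ (3 * d) * (1 + e) ^ (3 * d) = (\<alpha> + \<zeta>\<^sup>2) ^ (3 * d) * (1 + e) ^ (3 * d)"
      using e1 by simp
    finally show ?thesis unfolding 1 2 by auto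
  qed
  have z_frob: "\<zeta> ^ q = \<zeta>\<^sup>2" "(\<zeta>\<^sup>2) ^ q = \<zeta>"
  proof -
    have "q = 3 * (q div 3) + 2" using q_mod by presburger
    then have "\<zeta> ^ q = (\<zeta> ^ 3) ^ (q div 3) * \<zeta>\<^sup>2" by (metis power_add power_mult)
    then show 1: "\<zeta> ^ q = \<zeta>\<^sup>2" using zeta_facts(1) by simp
    have "(\<zeta>\<^sup>2) ^ q = (\<zeta> ^ q)\<^sup>2" by (simp add: mult.commute flip: power_mult)
    also have "\<dots> = \<zeta> ^ 3 * \<zeta>" unfolding 1 by (simp add: power2_eq_square power3_eq_cube)
    finally show "(\<zeta>\<^sup>2) ^ q = \<zeta>" using zeta_facts(1) by simp
  qed
  \<comment> \<open>The \<open>q\<close>-th power swaps \<open>\<zeta>\<close> and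
    \<open>\<zeta>\<^sup>2\<close>, so both sides are
    \<open>(\<zeta> - e) * (\<zeta>\<^sup>2 - e)\<close>. Hence the P-order is at most
    \<open>m - 1\<close>.\<close>
  have Pcal_m: "Pcal \<zeta> m \<alpha> = 0"
    unfolding Pcal_iff q3[symmetric] by (simp add: frob_diff z_frob e_frob mult.commute)
  define i where "i = P_order \<zeta> \<alpha>"
  have ex: "m - 1 > 0 \<and> Pcal \<zeta> (m - 1 + 1) \<alpha> = 0" using m2 Pcal_m by simp
  have i: "i > 0" "Pcal \<zeta> (i + 1) \<alpha> = 0"
    using LeastI[of "\<lambda>i. i > 0 \<and> Pcal \<zeta> (i + 1) \<alpha> = 0", OF ex] by (auto simp: i_def P_order_def)
  have i_le: "i \<le> m - 1"
    unfolding i_def P_order_def by (rule Least_le) (rule ex)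
  have i_least: "Pcal \<zeta> (j + 1) \<alpha> \<noteq> 0" if "0 < j" "j < i" for j
    using not_less_Least[of j "\<lambda>i. i > 0 \<and> Pcal \<zeta> (i + 1) \<alpha> = 0"] that
    by (auto simp: i_def P_order_def)
  \<comment> \<open>The P-order concerns indices from 2 on, so \<open>d = 1\<close> is checked
    separately: the difference of the cubes is
    \<open>3 * e * (1 + e) * (\<zeta> - \<zeta>\<^sup>2)\<close>.\<close>
  have low: "(\<zeta> - e) ^ (3 * d) \<noteq> (\<zeta>\<^sup>2 - e) ^ (3 * d)" if d: "0 < d" "d < i + 1" for d
  proof (cases "d = 1")
    case True
    have "(\<zeta> - e) ^ 3 - (\<zeta>\<^sup>2 - e) ^ 3
      = 3 * e * (1 + e) * (\<zeta> - \<zeta>\<^sup>2) + (\<zeta> ^ 3 - (\<zeta>\<^sup>2) ^ 3) + 3 * e * (\<zeta> * \<zeta> ^ 3 - \<zeta>)"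
      by (simp add: power2_eq_square power3_eq_cube algebra_simps)
    then have eq: "(\<zeta> - e) ^ 3 - (\<zeta>\<^sup>2 - e) ^ 3 = 3 * e * (1 + e) * (\<zeta> - \<zeta>\<^sup>2)"
      using zeta_facts(1,3) by simp
    have "(3 :: 'a) \<noteq> 0" using three_m by auto
    then have "(\<zeta> - e) ^ 3 - (\<zeta>\<^sup>2 - e) ^ 3 \<noteq> 0" unfolding eq using eK e1 zeta_facts(2) by simp
    then show ?thesis using True by simp
  next
    case False
    then show ?thesis using i_least[of "d - 1"] d Pcal_iff[of d] by simp
  qed
  have K2: "card K \<ge> 2"
    using q_ge K_card power_mono[of 5 q 2] by simp
  \<comment> \<open>Degree \<open>d\<close> corresponds to the index \<open>j = d - 1\<close> of the
    statement.\<close>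
  have gens: "{d * (q + 1) - (3 * d - 1) | d. 0 < d \<and> d < i + 1} = {(q - 1) + j * (q - 2) | j. j < i}"
  proof -
    have eq: "Suc j * (q + 1) - (3 * Suc j - 1) = (q - 1) + j * (q - 2)" for j
    proof -
      have "q = q - 2 + 2" using q_ge by simp
      then obtain r where "q = r + 2" by blast
      then show ?thesis by (simp add: algebra_simps)
    qed
    show ?thesis
    proof (intro set_eqI iffI)
      fix t assume "t \<in> {d * (q + 1) - (3 * d - 1) | d. 0 < d \<and> d < i + 1}"
      then obtain d where "t = d * (q + 1) - (3 * d - 1)" "0 < d" "d < i + 1" by blast
      then show "t \<in> {(q - 1) + j * (q - 2) | j. j < i}"
        using eq[of "d - 1"] by (intro CollectI exI[of _ "d - 1"]) auto
    next
      fix t assume "t \<in> {(q - 1) + j * (q - 2) | j. j < i}"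
      then obtain j where "t = (q - 1) + j * (q - 2)" "j < i" by blast
      then show "t \<in> {d * (q + 1) - (3 * d - 1) | d. 0 < d \<and> d < i + 1}"
        using eq[of j] by (intro CollectI exI[of _ "Suc j"]) auto
    qed
  qed
  \<comment> \<open>The threshold degree is \<open>i + 1\<close>; for \<open>i = m - 1\<close> it is
    \<open>m\<close>, and the last generator disappears.\<close>
  have H: "H = gen_semigroup ({q, q + 1} \<union> {(q - 1) + j * (q - 2) | j. j < i} \<union>
      (if i + 1 < m then {(i + 1) * (q + 1) - 3 * (i + 1)} else {}))"
    unfolding gens[symmetric]
  proof (rule H_generated[OF K2])
    show "2 \<le> i + 1" "i + 1 \<le> m" using i i_le m2 by auto
    show "(\<zeta> - e) ^ (3 * (i + 1)) = (\<zeta>\<^sup>2 - e) ^ (3 * (i + 1))"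
      using i(2) unfolding Pcal_iff .
  qed (rule low)
  have topeq: "(i + 1) * (q + 1) - 3 * (i + 1) = (q - 1) + i * (q - 2) - 1"
  proof -
    have "q = q - 2 + 2" using q_ge by simp
    then obtain r where "q = r + 2" by blast
    then show ?thesis by (simp add: algebra_simps)
  qed
  have 1: "H = gen_semigroup ({q, q + 1, (q - 1) + i * (q - 2) - 1} \<union> {(q - 1) + j * (q - 2) | j. j < i})"
    if "i \<le> m - 2"
  proof -
    have lt: "i + 1 < m" using that m2 by simp
    have "H = gen_semigroup ({q, q + 1} \<union> {(q - 1) + j * (q - 2) | j. j < i} \<union> {(q - 1) + i * (q - 2) - 1})"
      using H lt unfolding topeq by simp
    also have "{q, q + 1} \<union> {(q - 1) + j * (q - 2) | j. j < i} \<union> {(q - 1) + i * (q - 2) - 1}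
      = {q, q + 1, (q - 1) + i * (q - 2) - 1} \<union> {(q - 1) + j * (q - 2) | j. j < i}" by blast
    finally show ?thesis .
  qed
  have 2: "H = gen_semigroup ({q, q + 1} \<union> {(q - 1) + j * (q - 2) | j. j \<le> m - 2})" if "i = m - 1"
  proof -
    have "\<not> i + 1 < m" using that m2 by simp
    moreover have "j < i \<longleftrightarrow> j \<le> m - 2" for j using that m2 by auto
    ultimately show ?thesis using H by simp
  qed
  show ?thesis
    using 1 2 unfolding i_def \<alpha>_def e_def by blast
qed

end
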